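(* For all $w,v\in W$, $$Y_\Pi\bullet\bigl(\mathbf E^\lambda_w\cdot\mathcal E^{-\lambda}_v\bigr)=\mathbf 1\;\delta^{\mathrm{Kr}}_{w,v}\sum_{u\in W}{}^{u^{\mathrm d}}\!\left(\frac{\theta_\Pi(\lambda)}{\theta_\Pi(\hbar-\lambda)}\right),$$ where $\theta_\Pi(\lambda)=\prod_{\alpha>0}\theta(\lambda_{\alpha^\vee})$, $\theta_\Pi(\hbar-\lambda)=\prod_{\alpha>0}\theta(\hbar-\lambda_{\alpha^\vee})$ and $\delta^{\mathrm{Kr}}$ is the Kronecker symbol.
   Context: Setting. $G$ is a reductive group over $\mathbb C$ with Borel subgroup $B$ and maximal torus $T$; $X^*(T)$, $X_*(T)$ are the character and cocharacter groups, $\Sigma\subset X^*(T)$ the roots, $\alpha_1,\dots,\alpha_n$ the simple roots, $\alpha^\vee$ the coroot of $\alpha$, $W$ the Weyl group with simple reflections $s_i=s_{\alpha_i}$, identity $e$ and longest element $w_0$. Fix $\tau\in\mathbb C$ with $\operatorname{Im}\tau>0$, $q=e^{2\pi i\tau}$, and let $$\theta(x)=\tfrac{1}{2\pi i}\bigl(e^{\pi i x}-e^{-\pi i x}\bigr)\prod_{s>0}(1-q^se^{2\pi i x})(1-q^se^{-2\pi i x})\prod_{s>0}(1-q^s)^{-2},$$ an odd entire function of $x\in\mathbb C$. Fix $\hbar\in\mathbb C$. $\mathcal Q$ is the field of meromorphic functions of $(z,\lambda)\in (X_*(T)\otimes\mathbb C)\times(X^*(T)\otimes\mathbb C)$. For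 $\mu\in X^*(T)$, $z_\mu$ is the linear function $z\mapsto\langle\mu,z\rangle$; for $\mu^\vee\in X_*(T)$, $\lambda_{\mu^\vee}$ is the linear function $\lambda\mapsto\langle\lambda,\mu^\vee\rangle$. $W$ acts on $\mathcal Q$ in two commuting ways: through $z$, written ${}^{w}a$ (so ${}^w z_\mu=z_{w\mu}$, $\lambda$ unchanged), and through $\lambda$ (the dynamical action), written ${}^{w^{\mathrm d}}a$ (so ${}^{w^{\mathrm d}}\lambda_{\mu^\vee}=\lambda_{w\mu^\vee}$, $z$ unchanged). $\mathcal Q_{W^{\mathrm d}\times W}$ is the twisted group algebra: the free left $\mathcal Q$-module with basis $\delta_w^{\mathrm d}\delta_v$, $w,v\in W$, with product $\delta_w\delta_v^{\mathrm d}=\delta_v^{\mathrm d}\delta_w$, $(a\delta^{\mathrm d}_w\delta_v)(a'\delta^{\mathrm d}_{w'}\delta_{v'})=a\cdot{}^{v w^{\mathrm d}}a'\,\delta^{\mathrm d}_{ww'}\delta_{vv'}$ for $a,a'\in\mathcal Q$. Elliptic Demazure–Lusztig operators. For a simple root $\alpha$, $$T_{\alpha}^{\lambda}=\frac{\theta(\hbar-z_\alpha)\theta(\lambda_{\alpha^\vee})}{\theta(z_\alpha)\theta(\hbar-\lambda_{\alpha^\vee})}\delta_{s_\alpha} \delta_{s_\alpha}^{\mathrm d}+\frac{\theta(\hbar)\theta(z_\alpha-\lambda_{\alpha^\vee})}{\theta(z_\alpha)\theta(\hbar-\lambda_{\alpha^\vee})}\delta_{s_\alpha}^{\mathrm d},$$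 $$T_{\alpha}^{-\lambda}=-\frac{\theta(\hbar-z_\alpha)\theta(\lambda_{\alpha^\vee})}{\theta(z_\alpha)\theta(\hbar+\lambda_{\alpha^\vee})}\delta_{s_\alpha} \delta_{s_\alpha}^{\mathrm d}+\frac{\theta(\hbar)\theta(z_\alpha+\lambda_{\alpha^\vee})}{\theta(z_\alpha)\theta(\hbar+\lambda_{\alpha^\vee})}\delta_{s_\alpha}^{\mathrm d}$$ (the second is the first with $\lambda$ replaced by $-\lambda$ in the coefficients). It is known that $(T_\alpha^{\pm\lambda})^2=1$ and that the braid relations of $W$ hold; hence $T_w^{\pm\lambda}:=T_{\alpha_{i_1}}^{\pm\lambda}\cdots T_{\alpha_{i_k}}^{\pm\lambda}$ for a reduced decomposition $w=s_{i_1}\cdots s_{i_k}$ is well defined, and $T_w^{\pm\lambda}T_v^{\pm\lambda}=T_{wv}^{\pm\lambda}$. Dual. $\mathcal Q_W^*=\operatorname{Hom}(W,\mathcal Q)$ is the free $\mathcal Q$-module of functions $W\to\mathcal Q$ with basis $f_w$, $f_w(v)=\delta^{\mathrm{Kr}}_{w,v}$, with pointwise product and identity $\mathbf 1=\sum_{w}f_w$. The algebra $\mathcal Q_{W^{\mathrm d}\times W}$ acts on it by the additive action $$a\delta_w^{\mathrm d}\delta_v\bullet(f_ub)=f_{uv^{-1}}\cdot{}^{uv^{-1}}a\cdot{}^{w^{\mathrm d}}b,\qquad a,b\in\mathcal Q.$$ The elliptic Schubert class is $\mathbf E^\lambda_w=T^\lambda_{w^{-1}}\bullet f_e$ and the opposite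 elliptic Schubert class is $\mathcal E^{-\lambda}_w=T^{-\lambda}_{w^{-1}w_0}\bullet f_{w_0}$. Let $\mathbf g=\prod_{\alpha>0}\frac{\theta(\hbar-z_\alpha)}{\theta(z_\alpha)}$ and $Y_\Pi=\sum_{v,w\in W}\delta_v^{\mathrm d}\delta_w\frac1{\mathbf g}\in\mathcal Q_{W^{\mathrm d}\times W}$. (The pairing $\langle f,f'\rangle=Y_\Pi\bullet(f\cdot f')$ is the Poincaré pairing.) *)

theory Defs
  imports "HOL-Complex_Analysis.Complex_Analysis" "HOL-Library.Poly_Mapping"
begin

section \<open>Meromorphic functions of several complex variables\<close>

text \<open>
  After the choice of a basis of \<open>X_*(T)\<close> and of the dual basis of \<open>X^*(T)\<close>, a point
  \<open>(z, \<lambda>)\<close> of \<open>(X_*(T) \<otimes> \<complex>) \<times> (X^*(T) \<otimes> \<complex>)\<close> is a pair of vectors indexed by \<open>'n\<close>, where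
  \<open>CARD('n)\<close> is the rank of \<open>T\<close>.
\<close>

type_synonym 'n pt = "(complex^'n) \<times> (complex^'n)"

definition cscale :: "complex \<Rightarrow> 'n::finite pt \<Rightarrow> 'n pt" where
  "cscale c p = (c *s fst p, c *s snd p)"

definition holo_on :: "'n::finite pt set \<Rightarrow> ('n pt \<Rightarrow> complex) \<Rightarrow> bool" where
  "holo_on U f \<longleftrightarrow>
    (\<forall>p\<in>U. \<exists>f'. (f has_derivative f') (at p) \<and> (\<forall>c v. f' (cscale c v) = c * f' v))"

definition is_mero :: "('n::finite pt \<Rightarrow> complex) \<Rightarrow> bool" where
  "is_mero f \<longleftrightarrow>
    (\<forall>p. \<exists>r>0. \<exists>g h. holo_on (ball p r) g \<and> holo_on (ball p r) h \<and>
        (\<exists>x\<in>ball p r. h x \<noteq> 0) \<and> (\<forall>x\<in>ball p r. h x \<noteq> 0 \<longrightarrow> f x = g x / h x))"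

text \<open>
  The values of a total function \<open>f\<close> on the polar set are irrelevant: two representatives define
  the same meromorphic function if they agree on a dense open set.
\<close>

definition agree :: "('n::finite pt \<Rightarrow> complex) \<Rightarrow> ('n pt \<Rightarrow> complex) \<Rightarrow> bool" where
  "agree f g \<longleftrightarrow> (\<exists>S. open S \<and> closure S = UNIV \<and> (\<forall>x\<in>S. f x = g x))"

definition mero_rel :: "('n::finite pt \<Rightarrow> complex) \<Rightarrow> ('n pt \<Rightarrow> complex) \<Rightarrow> bool" where
  "mero_rel f g \<longleftrightarrow> is_mero f \<and> is_mero g \<and> agree f g"

lemma open_dense_Int:
  fixes S T :: "'a::topological_space set"
  assumes "open S" "closure S = UNIV" "open T" "closure T = UNIV"
  shows "open (S \<inter> T)" "closure (S \<inter> T) = UNIV"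
proof -
  show "open (S \<inter> T)" using assms by auto
  show "closure (S \<inter> T) = UNIV"
    using closure_open_Int_superset[of S T] assms by simp
qed

lemma agree_refl: "agree f f"
  unfolding agree_def by (rule exI[of _ UNIV]) auto

lemma agree_sym: "agree f g \<Longrightarrow> agree g f"
  unfolding agree_def by metis

lemma agree_comb2:
  assumes "agree f f'" "agree g g'"
  shows "agree (\<lambda>x. F (f x) (g x)) (\<lambda>x. F (f' x) (g' x))"
proof -
  from assms obtain S T where "open S" "closure S = UNIV" "\<forall>x\<in>S. f x = f' x"
    and "open T" "closure T = UNIV" "\<forall>x\<in>T. g x = g' x"
    unfolding agree_def by metis
  then show ?thesis
    unfolding agree_def using open_dense_Int[of S T] by (intro exI[of _ "S \<inter> T"]) auto
qed

lemma agree_trans: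
  assumes "agree f g" "agree g k"
  shows "agree f k"
proof -
  from assms obtain S T where "open S" "closure S = UNIV" "\<forall>x\<in>S. f x = g x"
    and "open T" "closure T = UNIV" "\<forall>x\<in>T. g x = k x"
    unfolding agree_def by metis
  then show ?thesis
    unfolding agree_def using open_dense_Int[of S T] by (intro exI[of _ "S \<inter> T"]) auto
qed

lemma holo_on_const: "holo_on U (\<lambda>x. c)"
  unfolding holo_on_def by (intro ballI exI[of _ "\<lambda>_. 0"]) auto

lemma holo_on_add:
  assumes "holo_on U f" "holo_on U g"
  shows "holo_on U (\<lambda>x. f x + g x)"
  unfolding holo_on_def
proof
  fix p assume "p \<in> U"
  with assms obtain f' g' where f': "(f has_derivative f') (at p)" "\<forall>c v. f' (cscale c v) = c * f' v"
    and g': "(g has_derivative g') (at p)" "\<forall>c v. g' (cscale c v) = c * g' v"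
    unfolding holo_on_def by meson
  show "\<exists>k. ((\<lambda>x. f x + g x) has_derivative k) (at p) \<and> (\<forall>c v. k (cscale c v) = c * k v)"
    by (rule exI[of _ "\<lambda>v. f' v + g' v"])
      (use f' g' in \<open>auto intro!: derivative_eq_intros simp: algebra_simps\<close>)
qed

lemma holo_on_mult:
  assumes "holo_on U f" "holo_on U g"
  shows "holo_on U (\<lambda>x. f x * g x)"
  unfolding holo_on_def
proof
  fix p assume "p \<in> U"
  with assms obtain f' g' where f': "(f has_derivative f') (at p)" "\<forall>c v. f' (cscale c v) = c * f' v"
    and g': "(g has_derivative g') (at p)" "\<forall>c v. g' (cscale c v) = c * g' v"
    unfolding holo_on_def by meson
  show "\<exists>k. ((\<lambda>x. f x * g x) has_derivative k) (at p) \<and> (\<forall>c v. k (cscale c v) = c * k v)"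
    by (rule exI[of _ "\<lambda>v. f p * g' v + f' v * g p"])
      (use f' g' in \<open>auto intro!: derivative_eq_intros simp: algebra_simps\<close>)
qed

lemma holo_on_subset: "holo_on U f \<Longrightarrow> V \<subseteq> U \<Longrightarrow> holo_on V f"
  unfolding holo_on_def by blast

lemma holo_on_continuous_on:
  assumes "holo_on U f"
  shows "continuous_on U f"
  unfolding continuous_on_eq_continuous_within
proof
  fix p assume "p \<in> U"
  with assms obtain f' where "(f has_derivative f') (at p)"
    unfolding holo_on_def by blast
  then have "continuous (at p) f" by (rule has_derivative_continuous)
  then show "continuous (at p within U) f" by (rule continuous_at_imp_continuous_at_within)
qed

lemma bounded_linear_cscale: "bounded_linear (\<lambda>c. cscale c d)"
proof -
  have "linear (\<lambda>c. cscale c d)"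
    by (rule linearI) (auto simp: cscale_def vec_eq_iff algebra_simps)
  then show ?thesis by (simp add: linear_conv_bounded_linear)
qed

lemma holo_on_identity:
  fixes p :: "'n::finite pt"
  assumes h: "holo_on (ball p r) h" and V: "open V" "V \<subseteq> ball p r" "V \<noteq> {}"
    and zero: "\<And>x. x \<in> V \<Longrightarrow> h x = 0" and x: "x \<in> ball p r"
  shows "h x = 0"
proof -
  obtain v where v: "v \<in> V" using V by blast
  define l where "l = (\<lambda>t. v + cscale t (x - v))"
  define S where "S = l -` ball p r"
  define S' where "S' = l -` V"
  have l0: "l 0 = v" and l1: "l 1 = x"
    by (auto simp: l_def cscale_def prod_eq_iff vec_eq_iff)
  have cont: "continuous_on UNIV l"
    unfolding l_def by (intro continuous_intros bounded_linear.continuous_on[OF bounded_linear_cscale])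
  have oS: "open S" and oS': "open S'"
    unfolding S_def S'_def using cont V(1) by (auto intro!: open_vimage)
  have linl: "linear (\<lambda>t. cscale t (x - v))"
    using bounded_linear_cscale bounded_linear.linear by blast
  have "convex S"
    unfolding convex_def
  proof (intro ballI allI impI)
    fix s t :: complex and a b :: real
    assume st: "s \<in> S" "t \<in> S" and ab: "0 \<le> a" "0 \<le> b" "a + b = 1"
    have "l (a *\<^sub>R s + b *\<^sub>R t) = (a + b) *\<^sub>R v + (a *\<^sub>R cscale s (x - v) + b *\<^sub>R cscale t (x - v))"
      using ab unfolding l_def by (simp add: linear_add[OF linl] linear_scale[OF linl])
    also have "\<dots> = a *\<^sub>R l s + b *\<^sub>R l t"
      unfolding l_def by (simp add: scaleR_add_left scaleR_add_right)
    also have "\<dots> \<in> ball p r"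
      using st ab convex_ball[of p r] unfolding convex_def S_def by auto
    finally show "a *\<^sub>R s + b *\<^sub>R t \<in> S" by (simp add: S_def)
  qed
  then have conS: "connected S" by (rule convex_connected)
  have hol: "(h \<circ> l) holomorphic_on S"
    unfolding holomorphic_on_open[OF oS]
  proof (intro ballI allI impI)
    fix t assume "t \<in> S"
    then have "l t \<in> ball p r" by (simp add: S_def)
    then obtain h' where h': "(h has_derivative h') (at (l t))" "\<forall>c v. h' (cscale c v) = c * h' v"
      using h unfolding holo_on_def by blast
    have "(l has_derivative (\<lambda>s. cscale s (x - v))) (at t)"
      unfolding l_def
      using has_derivative_add[OF has_derivative_const
          bounded_linear_imp_has_derivative[OF bounded_linear_cscale]] by simp
    from diff_chain_at[OF this h'(1)]
    have "(h \<circ> l has_derivative (\<lambda>s. h' (x - v) * s)) (at t)"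
      using h'(2) by (simp add: o_def mult.commute)
    then have "(h \<circ> l has_field_derivative h' (x - v)) (at t)"
      by (simp add: has_field_derivative_def)
    then show "\<exists>d. (h \<circ> l has_field_derivative d) (at t)" by blast
  qed
  have "0 \<in> S'" using v l0 by (simp add: S'_def)
  have "(h \<circ> l) 1 = (\<lambda>_. 0) (1::complex)"
  proof (rule analytic_continuation_open[where f = "h \<circ> l" and g = "\<lambda>_. 0" and z = 1,
          OF oS' oS _ conS])
    show "S' \<noteq> {}" using \<open>0 \<in> S'\<close> by blast
    show "S' \<subseteq> S" using V by (auto simp: S_def S'_def)
    show "(h \<circ> l) holomorphic_on S" by (rule hol)
    show "(\<lambda>_. 0) holomorphic_on S" by simp
    show "1 \<in> S" using x l1 by (simp add: S_def)
    show "\<And>z. z \<in> S' \<Longrightarrow> (h \<circ> l) z = 0" using zero by (simp add: S'_def)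
  qed
  then show ?thesis using l1 by simp
qed

lemma holo_on_nonzero_open:
  assumes "holo_on (ball p r) h"
  shows "open {x\<in>ball p r. h x \<noteq> 0}"
proof -
  have "open (ball p r \<inter> h -` (- {0}))"
    by (intro continuous_open_preimage holo_on_continuous_on[OF assms]) auto
  moreover have "ball p r \<inter> h -` (- {0}) = {x\<in>ball p r. h x \<noteq> 0}" by auto
  ultimately show ?thesis by simp
qed

lemma holo_on_nonzero_dense:
  assumes h: "holo_on (ball p r) h" and nz: "x \<in> ball p r" "h x \<noteq> 0"
  shows "ball p r \<subseteq> closure {x\<in>ball p r. h x \<noteq> 0}"
proof (rule ccontr)
  let ?V = "ball p r \<inter> - closure {x\<in>ball p r. h x \<noteq> 0}"
  assume "\<not> ?thesis"
  then have "?V \<noteq> {}" by blast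
  moreover have "open ?V" by auto
  moreover have "h y = 0" if "y \<in> ?V" for y
    using that closure_subset[of "{x\<in>ball p r. h x \<noteq> 0}"] by blast
  ultimately have "h x = 0"
    using holo_on_identity[OF h, of ?V x] nz(1) by blast
  with nz show False by simp
qed

lemma holo_on_mult_nz:
  assumes g: "holo_on (ball p r) g" "x \<in> ball p r" "g x \<noteq> 0"
    and h: "holo_on (ball p r) h" "y \<in> ball p r" "h y \<noteq> 0"
  shows "\<exists>x\<in>ball p r. g x * h x \<noteq> 0"
proof (rule ccontr)
  assume A: "\<not> ?thesis"
  let ?V = "{x\<in>ball p r. g x \<noteq> 0}"
  have "h y = 0"
  proof (rule holo_on_identity[OF h(1) holo_on_nonzero_open[OF g(1)]])
    show "?V \<subseteq> ball p r" by blast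
    show "?V \<noteq> {}" using g by blast
    show "h x = 0" if "x \<in> ?V" for x using that A by auto
    show "y \<in> ball p r" by (rule h)
  qed
  with h show False by simp
qed

lemma is_meroE:
  assumes "is_mero f"
  obtains r g h where "r > 0" "holo_on (ball p r) g" "holo_on (ball p r) h"
    "\<exists>x\<in>ball p r. h x \<noteq> 0" "\<forall>x\<in>ball p r. h x \<noteq> 0 \<longrightarrow> f x = g x / h x"
  using assms[unfolded is_mero_def, THEN spec, of p] by (elim exE conjE) (rule that)

lemma is_meroI:
  assumes "\<And>p. \<exists>r>0. \<exists>g h. holo_on (ball p r) g \<and> holo_on (ball p r) h \<and>
        (\<exists>x\<in>ball p r. h x \<noteq> 0) \<and> (\<forall>x\<in>ball p r. h x \<noteq> 0 \<longrightarrow> f x = g x / h x)"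
  shows "is_mero f"
  using assms unfolding is_mero_def by (rule allI)

lemma local_quotientI:
  assumes "r > 0" "holo_on (ball p r) g" "holo_on (ball p r) h"
    "\<exists>x\<in>ball p r. h x \<noteq> 0" "\<And>x. x \<in> ball p r \<Longrightarrow> h x \<noteq> 0 \<Longrightarrow> f x = g x / h x"
  shows "\<exists>r>0. \<exists>g h. holo_on (ball p r) g \<and> holo_on (ball p r) h \<and>
        (\<exists>x\<in>ball p r. h x \<noteq> 0) \<and> (\<forall>x\<in>ball p r. h x \<noteq> 0 \<longrightarrow> f x = g x / h x)"
  using assms by (intro exI[of _ r] exI[of _ g] exI[of _ h] conjI ballI impI)

lemma is_mero_common:
  assumes "is_mero f1" "is_mero f2"
  obtains r g1 h1 g2 h2 where "r > 0"
    "holo_on (ball p r) g1" "holo_on (ball p r) h1" "holo_on (ball p r) g2" "holo_on (ball p r) h2"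
    "\<exists>x\<in>ball p r. h1 x * h2 x \<noteq> 0"
    "\<And>x. x \<in> ball p r \<Longrightarrow> h1 x \<noteq> 0 \<Longrightarrow> f1 x = g1 x / h1 x"
    "\<And>x. x \<in> ball p r \<Longrightarrow> h2 x \<noteq> 0 \<Longrightarrow> f2 x = g2 x / h2 x"
proof -
  obtain r1 g1 h1 where 1: "r1 > 0" "holo_on (ball p r1) g1" "holo_on (ball p r1) h1"
    "\<exists>x\<in>ball p r1. h1 x \<noteq> 0" "\<forall>x\<in>ball p r1. h1 x \<noteq> 0 \<longrightarrow> f1 x = g1 x / h1 x"
    by (rule is_meroE[OF assms(1), of p])
  obtain r2 g2 h2 where 2: "r2 > 0" "holo_on (ball p r2) g2" "holo_on (ball p r2) h2"
    "\<exists>x\<in>ball p r2. h2 x \<noteq> 0" "\<forall>x\<in>ball p r2. h2 x \<noteq> 0 \<longrightarrow> f2 x = g2 x / h2 x"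
    by (rule is_meroE[OF assms(2), of p])
  define r where "r = min r1 r2"
  have r: "r > 0" "ball p r \<subseteq> ball p r1" "ball p r \<subseteq> ball p r2"
    using 1(1) 2(1) by (auto simp: r_def)
  have ne: "ball p r \<noteq> {}" using r(1) by simp
  have "\<exists>x\<in>ball p r. h1 x \<noteq> 0"
    using holo_on_identity[OF 1(3) open_ball r(2) ne] 1(4) by blast
  moreover have "\<exists>x\<in>ball p r. h2 x \<noteq> 0"
    using holo_on_identity[OF 2(3) open_ball r(3) ne] 2(4) by blast
  ultimately have "\<exists>x\<in>ball p r. h1 x * h2 x \<noteq> 0"
    using holo_on_mult_nz[OF holo_on_subset[OF 1(3) r(2)] _ _ holo_on_subset[OF 2(3) r(3)]] by blast
  from r(1) holo_on_subset[OF 1(2) r(2)] holo_on_subset[OF 1(3) r(2)]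
    holo_on_subset[OF 2(2) r(3)] holo_on_subset[OF 2(3) r(3)] this
  show thesis
  proof (rule that)
    show "f1 x = g1 x / h1 x" if "x \<in> ball p r" "h1 x \<noteq> 0" for x using that 1(5) r(2) by blast
    show "f2 x = g2 x / h2 x" if "x \<in> ball p r" "h2 x \<noteq> 0" for x using that 2(5) r(3) by blast
  qed
qed

lemma is_mero_const: "is_mero (\<lambda>x. c)"
proof (rule is_meroI)
  fix p :: "'n::finite pt"
  show "\<exists>r>0. \<exists>g h. holo_on (ball p r) g \<and> holo_on (ball p r) h \<and>
        (\<exists>x\<in>ball p r. h x \<noteq> 0) \<and> (\<forall>x\<in>ball p r. h x \<noteq> 0 \<longrightarrow> c = g x / h x)"
  proof (rule local_quotientI[OF zero_less_one holo_on_const[of _ c] holo_on_const[of _ 1]])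
    show "\<exists>x\<in>ball p 1. (1::complex) \<noteq> 0" by (rule bexI[of _ p]) simp_all
  qed simp
qed

lemma is_mero_add:
  assumes "is_mero f1" "is_mero f2"
  shows "is_mero (\<lambda>x. f1 x + f2 x)"
proof (rule is_meroI)
  fix p
  obtain r g1 h1 g2 h2 where *: "r > 0"
    "holo_on (ball p r) g1" "holo_on (ball p r) h1" "holo_on (ball p r) g2" "holo_on (ball p r) h2"
    "\<exists>x\<in>ball p r. h1 x * h2 x \<noteq> 0"
    "\<And>x. x \<in> ball p r \<Longrightarrow> h1 x \<noteq> 0 \<Longrightarrow> f1 x = g1 x / h1 x"
    "\<And>x. x \<in> ball p r \<Longrightarrow> h2 x \<noteq> 0 \<Longrightarrow> f2 x = g2 x / h2 x"
    by (rule is_mero_common[OF assms, of p]) (rule that)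
  show "\<exists>r>0. \<exists>g h. holo_on (ball p r) g \<and> holo_on (ball p r) h \<and>
        (\<exists>x\<in>ball p r. h x \<noteq> 0) \<and> (\<forall>x\<in>ball p r. h x \<noteq> 0 \<longrightarrow> f1 x + f2 x = g x / h x)"
    by (rule local_quotientI[OF *(1) holo_on_add[OF holo_on_mult[OF *(2,5)] holo_on_mult[OF *(4,3)]]
          holo_on_mult[OF *(3,5)] *(6)])
      (simp add: *(7,8) field_simps)
qed

lemma is_mero_mult:
  assumes "is_mero f1" "is_mero f2"
  shows "is_mero (\<lambda>x. f1 x * f2 x)"
proof (rule is_meroI)
  fix p
  obtain r g1 h1 g2 h2 where *: "r > 0"
    "holo_on (ball p r) g1" "holo_on (ball p r) h1" "holo_on (ball p r) g2" "holo_on (ball p r) h2"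
    "\<exists>x\<in>ball p r. h1 x * h2 x \<noteq> 0"
    "\<And>x. x \<in> ball p r \<Longrightarrow> h1 x \<noteq> 0 \<Longrightarrow> f1 x = g1 x / h1 x"
    "\<And>x. x \<in> ball p r \<Longrightarrow> h2 x \<noteq> 0 \<Longrightarrow> f2 x = g2 x / h2 x"
    by (rule is_mero_common[OF assms, of p]) (rule that)
  show "\<exists>r>0. \<exists>g h. holo_on (ball p r) g \<and> holo_on (ball p r) h \<and>
        (\<exists>x\<in>ball p r. h x \<noteq> 0) \<and> (\<forall>x\<in>ball p r. h x \<noteq> 0 \<longrightarrow> f1 x * f2 x = g x / h x)"
    by (rule local_quotientI[OF *(1) holo_on_mult[OF *(2,4)] holo_on_mult[OF *(3,5)] *(6)])
      (simp add: *(7,8))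
qed

lemma is_mero_inverse:
  assumes "is_mero f"
  shows "is_mero (\<lambda>x. inverse (f x))"
proof (rule is_meroI)
  fix p
  obtain r g h where *: "r > 0" "holo_on (ball p r) g" "holo_on (ball p r) h"
    "\<exists>x\<in>ball p r. h x \<noteq> 0" "\<forall>x\<in>ball p r. h x \<noteq> 0 \<longrightarrow> f x = g x / h x"
    by (rule is_meroE[OF assms, of p])
  show "\<exists>r>0. \<exists>g h. holo_on (ball p r) g \<and> holo_on (ball p r) h \<and>
        (\<exists>x\<in>ball p r. h x \<noteq> 0) \<and> (\<forall>x\<in>ball p r. h x \<noteq> 0 \<longrightarrow> inverse (f x) = g x / h x)"
  proof (cases "\<forall>x\<in>ball p r. g x = 0")
    case True
    show ?thesis
      by (rule local_quotientI[OF *(1) holo_on_const[of _ 0] *(3,4)]) (use *(5) True in simp)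
  next
    case False
    then have nz: "\<exists>x\<in>ball p r. g x * h x \<noteq> 0"
      using holo_on_mult_nz[OF *(2) _ _ *(3)] *(4) by blast
    show ?thesis
      by (rule local_quotientI[OF *(1) holo_on_mult[OF *(3,3)] holo_on_mult[OF *(2,3)] nz])
        (use *(5) in simp)
  qed
qed

lemma is_mero_uminus:
  assumes "is_mero f"
  shows "is_mero (\<lambda>x. - f x)"
  using is_mero_mult[OF is_mero_const[of "-1"] assms] by simp

lemma is_mero_diff:
  assumes "is_mero f" "is_mero g"
  shows "is_mero (\<lambda>x. f x - g x)"
  using is_mero_add[OF assms(1) is_mero_uminus[OF assms(2)]] by simp

lemma is_mero_divide:
  assumes "is_mero f" "is_mero g"
  shows "is_mero (\<lambda>x. f x / g x)"
  using is_mero_mult[OF assms(1) is_mero_inverse[OF assms(2)]] by (simp add: field_simps)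

lemma is_mero_dichotomy:
  fixes f :: "'n::finite pt \<Rightarrow> complex"
  assumes "is_mero f"
  shows "agree f (\<lambda>x. 0) \<or> agree (\<lambda>x. inverse (f x) * f x) (\<lambda>x. 1)"
proof -
  define Z where "Z = interior {x. f x = 0}"
  define N where "N = interior {x. f x \<noteq> 0}"
  define A where "A = interior (closure Z)"
  define B where "B = interior (closure N)"
  have ZN: "Z \<inter> N = {}" "open Z" "open N"
    using interior_subset[of "{x. f x = 0}"] interior_subset[of "{x. f x \<noteq> 0}"]
    by (auto simp: Z_def N_def)
  have oAB: "open A" "open B" by (auto simp: A_def B_def)
  have "x \<in> A \<or> x \<in> B" for x
  proof -
    obtain r g h where *: "r > 0" "holo_on (ball x r) g" "holo_on (ball x r) h"
      "\<exists>y\<in>ball x r. h y \<noteq> 0" "\<forall>y\<in>ball x r. h y \<noteq> 0 \<longrightarrow> f y = g y / h y"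
      by (rule is_meroE[OF assms, of x])
    show ?thesis
    proof (cases "\<forall>y\<in>ball x r. g y = 0")
      case True
      have "{y\<in>ball x r. h y \<noteq> 0} \<subseteq> Z"
        unfolding Z_def
        by (rule interior_maximal[OF _ holo_on_nonzero_open[OF *(3)]]) (use *(5) True in auto)
      then have "ball x r \<subseteq> closure Z"
        using holo_on_nonzero_dense[OF *(3)] *(4) closure_mono by blast
      then have "ball x r \<subseteq> A" unfolding A_def by (rule interior_maximal) simp
      then show ?thesis using *(1) centre_in_ball by blast
    next
      case False
      then have nz: "\<exists>x\<in>ball x r. g x * h x \<noteq> 0"
        using holo_on_mult_nz[OF *(2) _ _ *(3)] *(4) by blast
      note gh = holo_on_mult[OF *(2,3)]
      have "{y\<in>ball x r. g y * h y \<noteq> 0} \<subseteq> N"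
        unfolding N_def by (rule interior_maximal[OF _ holo_on_nonzero_open[OF gh]]) (use * in auto)
      then have "ball x r \<subseteq> closure N"
        using holo_on_nonzero_dense[OF gh] nz closure_mono by blast
      then have "ball x r \<subseteq> B" unfolding B_def by (rule interior_maximal) simp
      then show ?thesis using *(1) centre_in_ball by blast
    qed
  qed
  then have un: "A \<union> B = UNIV" by auto
  have "A \<inter> B = {}"
  proof (rule ccontr)
    assume ne: "A \<inter> B \<noteq> {}"
    have AB: "A \<subseteq> closure Z" "B \<subseteq> closure N"
      unfolding A_def B_def by (rule interior_subset)+
    have "(A \<inter> B) \<inter> Z \<noteq> {}"
      using open_Int_closure_eq_empty[of "A \<inter> B" Z] ne oAB AB by blast
    then have "(A \<inter> B \<inter> Z) \<inter> N \<noteq> {}"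
      using open_Int_closure_eq_empty[of "A \<inter> B \<inter> Z" N] oAB AB ZN by blast
    with ZN show False by blast
  qed
  then have "A = {} \<or> B = {}"
    using connectedD[OF connected_UNIV oAB] un by simp
  then have "A = UNIV \<or> B = UNIV" using un by blast
  then show ?thesis
  proof
    assume "A = UNIV"
    then have "closure Z = UNIV"
      using interior_subset[of "closure Z"] unfolding A_def by (metis top.extremum_uniqueI)
    moreover have "\<forall>x\<in>Z. f x = 0"
      using interior_subset[of "{x. f x = 0}"] unfolding Z_def by blast
    ultimately show ?thesis using ZN(2) unfolding agree_def by blast
  next
    assume "B = UNIV"
    then have "closure N = UNIV"
      using interior_subset[of "closure N"] unfolding B_def by (metis top.extremum_uniqueI)
    moreover have "\<forall>x\<in>N. inverse (f x) * f x = 1"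
      using interior_subset[of "{x. f x \<noteq> 0}"] unfolding N_def by (simp add: subset_eq)
    ultimately have "agree (\<lambda>x. inverse (f x) * f x) (\<lambda>x. 1)"
      using ZN(3) unfolding agree_def by blast
    then show ?thesis ..
  qed
qed

quotient_type 'n mero = "'n::finite pt \<Rightarrow> complex" / partial: mero_rel
proof (rule part_equivpI)
  show "\<exists>f. mero_rel f (f :: 'n::finite pt \<Rightarrow> complex)"
    by (rule exI[of _ "\<lambda>_. 0"]) (simp add: mero_rel_def is_mero_const agree_refl)
  show "symp (mero_rel :: ('n::finite pt \<Rightarrow> complex) \<Rightarrow> _)"
    by (auto simp: symp_def mero_rel_def intro: agree_sym)
  show "transp (mero_rel :: ('n::finite pt \<Rightarrow> complex) \<Rightarrow> _)"
    by (auto simp: transp_def mero_rel_def intro: agree_trans)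
qed

instantiation mero :: (finite) field
begin

lift_definition zero_mero :: "'a mero" is "\<lambda>_. 0"
  by (simp add: mero_rel_def is_mero_const agree_refl)
lift_definition one_mero :: "'a mero" is "\<lambda>_. 1"
  by (simp add: mero_rel_def is_mero_const agree_refl)
lift_definition plus_mero :: "'a mero \<Rightarrow> 'a mero \<Rightarrow> 'a mero" is "\<lambda>f g x. f x + g x"
  by (auto simp: mero_rel_def is_mero_add agree_comb2[where F = "(+)"])
lift_definition minus_mero :: "'a mero \<Rightarrow> 'a mero \<Rightarrow> 'a mero" is "\<lambda>f g x. f x - g x"
  by (auto simp: mero_rel_def is_mero_diff agree_comb2[where F = "(-)"])
lift_definition uminus_mero :: "'a mero \<Rightarrow> 'a mero" is "\<lambda>f x. - f x"
  using agree_comb2[where F = "\<lambda>a b. - a"] by (auto simp: mero_rel_def is_mero_uminus)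
lift_definition times_mero :: "'a mero \<Rightarrow> 'a mero \<Rightarrow> 'a mero" is "\<lambda>f g x. f x * g x"
  by (auto simp: mero_rel_def is_mero_mult agree_comb2[where F = "(*)"])
lift_definition inverse_mero :: "'a mero \<Rightarrow> 'a mero" is "\<lambda>f x. inverse (f x)"
  using agree_comb2[where F = "\<lambda>a b. inverse a"] by (auto simp: mero_rel_def is_mero_inverse)
lift_definition divide_mero :: "'a mero \<Rightarrow> 'a mero \<Rightarrow> 'a mero" is "\<lambda>f g x. f x / g x"
  by (auto simp: mero_rel_def is_mero_divide agree_comb2[where F = "(/)"])

instance
proof
  fix a b c :: "'a mero"
  show "a * b * c = a * (b * c)"
    by transfer (auto simp: mero_rel_def is_mero_mult mult.assoc agree_refl)
  show "a * b = b * a"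
    by transfer (auto simp: mero_rel_def is_mero_mult mult.commute agree_refl)
  show "1 * a = a"
    by transfer (auto simp: mero_rel_def agree_refl)
  show "a + b + c = a + (b + c)"
    by transfer (auto simp: mero_rel_def is_mero_add add.assoc agree_refl)
  show "a + b = b + a"
    by transfer (auto simp: mero_rel_def is_mero_add add.commute agree_refl)
  show "0 + a = a"
    by transfer (auto simp: mero_rel_def agree_refl)
  show "- a + a = 0"
    by transfer (auto simp: mero_rel_def is_mero_const agree_refl)
  show "a - b = a + - b"
    by transfer (auto simp: mero_rel_def is_mero_diff agree_refl)
  show "(a + b) * c = a * c + b * c"
    by transfer (auto simp: mero_rel_def is_mero_add is_mero_mult distrib_right agree_refl)
  show "(0::'a mero) \<noteq> 1"
  proof (transfer, rule notI)
    assume "mero_rel (\<lambda>_. 0) (\<lambda>_::'a pt. 1)"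
    then obtain S :: "'a pt set" where "closure S = UNIV" "\<forall>x\<in>S. (0::complex) = 1"
      unfolding mero_rel_def agree_def by blast
    then have "closure ({} :: 'a pt set) = UNIV" by (metis ex_in_conv zero_neq_one)
    then show False by simp
  qed
  show "a \<noteq> 0 \<Longrightarrow> inverse a * a = 1"
    by transfer
      (use is_mero_dichotomy in
        \<open>auto simp: mero_rel_def is_mero_const intro!: is_mero_mult is_mero_inverse\<close>)
  show "a div b = a * inverse b"
    by transfer
      (simp only: mero_rel_def is_mero_divide agree_refl divide_inverse[where 'a = complex, symmetric] simp_thms)
  show "inverse (0::'a mero) = 0"
    by transfer (auto simp: mero_rel_def is_mero_const agree_refl)
qed

end

section \<open>Root data and Weyl groups\<close>

definition pairing :: "'a::comm_ring_1^'n \<Rightarrow> 'a^'n \<Rightarrow> 'a" where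
  "pairing \<mu> \<nu> = (\<Sum>i\<in>UNIV. \<mu> $ i * \<nu> $ i)"

text \<open>
  The combinatorial data of \<open>(G, B, T)\<close>: the character and the cocharacter lattice are both
  \<open>\<int>\<^sup>n\<close>, in duality by the standard pairing, so that the two lattices are told apart by
  their role only.
\<close>

record 'n root_datum =
  roots :: "(int^'n) set"
  coroot :: "int^'n \<Rightarrow> int^'n"
  simple_roots :: "(int^'n) set"

definition root_datum :: "'n::finite root_datum \<Rightarrow> bool" where
  "root_datum D \<longleftrightarrow>
     finite (roots D) \<and> inj_on (coroot D) (roots D) \<and>
     (\<forall>\<alpha>\<in>roots D. pairing \<alpha> (coroot D \<alpha>) = 2) \<and>
     (\<forall>\<alpha>\<in>roots D. \<forall>\<beta>\<in>roots D.
        \<beta> - pairing \<beta> (coroot D \<alpha>) *s \<alpha> \<in> roots D \<and>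
        coroot D \<beta> - pairing \<alpha> (coroot D \<beta>) *s coroot D \<alpha> \<in> coroot D ` roots D) \<and>
     (\<forall>\<alpha>\<in>roots D. 2 *s \<alpha> \<notin> roots D)"

definition is_base :: "'n::finite root_datum \<Rightarrow> bool" where
  "is_base D \<longleftrightarrow>
     simple_roots D \<subseteq> roots D \<and>
     (\<forall>c. (\<Sum>\<beta>\<in>simple_roots D. c \<beta> *s \<beta>) = 0 \<longrightarrow> (\<forall>\<beta>\<in>simple_roots D. c \<beta> = 0)) \<and>
     (\<forall>\<alpha>\<in>roots D. \<exists>c. \<alpha> = (\<Sum>\<beta>\<in>simple_roots D. c \<beta> *s \<beta>) \<and>
        ((\<forall>\<beta>\<in>simple_roots D. c \<beta> \<ge> 0) \<or> (\<forall>\<beta>\<in>simple_roots D. c \<beta> \<le> 0)))"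

definition pos_roots :: "'n::finite root_datum \<Rightarrow> (int^'n) set" where
  "pos_roots D = {\<alpha>\<in>roots D. \<exists>c. \<alpha> = (\<Sum>\<beta>\<in>simple_roots D. c \<beta> *s \<beta>) \<and>
     (\<forall>\<beta>\<in>simple_roots D. c \<beta> \<ge> 0)}"

text \<open>
  Weyl group elements are the matrices of their action on the character lattice; on cocharacters
  they act by the contragredient \<open>transpose (matrix_inv w)\<close>.
\<close>

type_synonym 'n wmat = "int^'n^'n"

definition reflection :: "'n::finite root_datum \<Rightarrow> int^'n \<Rightarrow> 'n wmat" where
  "reflection D \<alpha> = matrix (\<lambda>\<mu>. \<mu> - pairing \<mu> (coroot D \<alpha>) *s \<alpha>)"

inductive_set weyl :: "'n::finite root_datum \<Rightarrow> 'n wmat set" for D where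
  one: "mat 1 \<in> weyl D"
| step: "w \<in> weyl D \<Longrightarrow> \<alpha> \<in> roots D \<Longrightarrow> reflection D \<alpha> ** w \<in> weyl D"

definition word_of :: "'n::finite root_datum \<Rightarrow> 'n wmat \<Rightarrow> (int^'n) list \<Rightarrow> bool" where
  "word_of D w ws \<longleftrightarrow>
     set ws \<subseteq> simple_roots D \<and> w = foldr (\<lambda>\<alpha> u. reflection D \<alpha> ** u) ws (mat 1)"

definition len :: "'n::finite root_datum \<Rightarrow> 'n wmat \<Rightarrow> nat" where
  "len D w = (LEAST k. \<exists>ws. word_of D w ws \<and> length ws = k)"

definition reduced_word :: "'n::finite root_datum \<Rightarrow> 'n wmat \<Rightarrow> (int^'n) list \<Rightarrow> bool" where
  "reduced_word D w ws \<longleftrightarrow> word_of D w ws \<and> length ws = len D w"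

definition longest :: "'n::finite root_datum \<Rightarrow> 'n wmat" where
  "longest D = (ARG_MAX (len D) w. w \<in> weyl D)"

section \<open>The theta function and the two Weyl group actions\<close>

definition theta :: "complex \<Rightarrow> complex \<Rightarrow> complex" where
  "theta \<tau> x =
     (let q = exp (2 * of_real pi * \<i> * \<tau>) in
      1 / (2 * of_real pi * \<i>) * (exp (of_real pi * \<i> * x) - exp (- (of_real pi * \<i> * x))) *
      prodinf (\<lambda>s. (1 - q ^ Suc s * exp (2 * of_real pi * \<i> * x)) *
            (1 - q ^ Suc s * exp (- (2 * of_real pi * \<i> * x)))) *
      prodinf (\<lambda>s. inverse ((1 - q ^ Suc s)\<^sup>2)))"

definition cvec :: "int^'n \<Rightarrow> complex^'n" where
  "cvec \<mu> = (\<chi> i. of_int (\<mu> $ i))"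

definition cmat :: "'n wmat \<Rightarrow> complex^'n^'n" where
  "cmat w = (\<chi> i j. of_int (w $ i $ j))"

definition z_lin :: "int^'n::finite \<Rightarrow> 'n pt \<Rightarrow> complex" where
  "z_lin \<mu> p = pairing (cvec \<mu>) (fst p)"

definition l_lin :: "int^'n::finite \<Rightarrow> 'n pt \<Rightarrow> complex" where
  "l_lin \<nu> p = pairing (snd p) (cvec \<nu>)"

definition theta_at :: "complex \<Rightarrow> ('n::finite pt \<Rightarrow> complex) \<Rightarrow> 'n mero" where
  "theta_at \<tau> F = abs_mero (\<lambda>p. theta \<tau> (F p))"

text \<open>
  \<open>w\<inverse>\<close> acts on cocharacters by \<open>transpose w\<close>, so \<open>(z, \<lambda>) \<mapsto> (w\<inverse> z, \<lambda>)\<close> is the substitution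
  in \<open>act\<close>, and \<open>(z, \<lambda>) \<mapsto> (z, w\<inverse> \<lambda>)\<close> the one in \<open>dyn_act\<close>.
\<close>

definition act :: "'n::finite wmat \<Rightarrow> 'n mero \<Rightarrow> 'n mero" where
  "act w a = abs_mero (\<lambda>p. rep_mero a (transpose (cmat w) *v fst p, snd p))"

definition dyn_act :: "'n::finite wmat \<Rightarrow> 'n mero \<Rightarrow> 'n mero" where
  "dyn_act w a = abs_mero (\<lambda>p. rep_mero a (fst p, cmat (matrix_inv w) *v snd p))"

section \<open>The twisted group algebra and its dual\<close>

text \<open>
  The coefficient of \<open>\<delta>\<^sup>d\<^sub>w \<delta>\<^sub>v\<close> is the value at \<open>(w, v)\<close>: the dynamical index comes first.
\<close>

type_synonym 'n twisted = "('n wmat \<times> 'n wmat) \<Rightarrow>\<^sub>0 'n mero"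

definition elt :: "'n::finite mero \<Rightarrow> 'n wmat \<Rightarrow> 'n wmat \<Rightarrow> 'n twisted" where
  "elt a w v = Poly_Mapping.single (w, v) a"

definition tmult :: "'n::finite twisted \<Rightarrow> 'n twisted \<Rightarrow> 'n twisted" (infixl "\<odot>" 70) where
  "A \<odot> B = (\<Sum>(w, v)\<in>Poly_Mapping.keys A. \<Sum>(w', v')\<in>Poly_Mapping.keys B.
     elt (Poly_Mapping.lookup A (w, v) * act v (dyn_act w (Poly_Mapping.lookup B (w', v'))))
       (w ** w') (v ** v'))"

text \<open>Elements of \<open>Hom(W, \<Q>)\<close> are total functions that vanish outside \<open>W\<close>.\<close>

type_synonym 'n dual = "'n wmat \<Rightarrow> 'n mero"

definition fbasis :: "'n::finite wmat \<Rightarrow> 'n dual" where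
  "fbasis w = (\<lambda>v. if v = w then 1 else 0)"

definition dual_one :: "'n::finite root_datum \<Rightarrow> 'n dual" where
  "dual_one D = (\<lambda>x. \<Sum>w\<in>weyl D. fbasis w x)"

definition bullet :: "'n::finite root_datum \<Rightarrow> 'n twisted \<Rightarrow> 'n dual \<Rightarrow> 'n dual" where
  "bullet D A f = (\<lambda>x. \<Sum>(w, v)\<in>Poly_Mapping.keys A. \<Sum>u\<in>weyl D.
     fbasis (u ** matrix_inv v) x *
       (act (u ** matrix_inv v) (Poly_Mapping.lookup A (w, v)) * dyn_act w (f u)))"

section \<open>Elliptic Demazure-Lusztig operators and Schubert classes\<close>

definition T_plus :: "'n::finite root_datum \<Rightarrow> complex \<Rightarrow> complex \<Rightarrow> int^'n \<Rightarrow> 'n twisted" where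
  "T_plus D \<tau> h \<alpha> =
    (let z = z_lin \<alpha>; l = l_lin (coroot D \<alpha>); s = reflection D \<alpha> in
       elt (theta_at \<tau> (\<lambda>p. h - z p) * theta_at \<tau> l /
            (theta_at \<tau> z * theta_at \<tau> (\<lambda>p. h - l p))) s s
     + elt (theta_at \<tau> (\<lambda>p. h) * theta_at \<tau> (\<lambda>p. z p - l p) /
            (theta_at \<tau> z * theta_at \<tau> (\<lambda>p. h - l p))) s (mat 1))"

definition T_minus :: "'n::finite root_datum \<Rightarrow> complex \<Rightarrow> complex \<Rightarrow> int^'n \<Rightarrow> 'n twisted" where
  "T_minus D \<tau> h \<alpha> =
    (let z = z_lin \<alpha>; l = l_lin (coroot D \<alpha>); s = reflection D \<alpha> in
       elt (- (theta_at \<tau> (\<lambda>p. h - z p) * theta_at \<tau> l /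
            (theta_at \<tau> z * theta_at \<tau> (\<lambda>p. h + l p)))) s s
     + elt (theta_at \<tau> (\<lambda>p. h) * theta_at \<tau> (\<lambda>p. z p + l p) /
            (theta_at \<tau> z * theta_at \<tau> (\<lambda>p. h + l p))) s (mat 1))"

text \<open>
  By the braid relations the following product does not depend on the reduced word.
\<close>

definition along_word ::
  "'n::finite root_datum \<Rightarrow> (int^'n \<Rightarrow> 'n twisted) \<Rightarrow> 'n wmat \<Rightarrow> 'n twisted" where
  "along_word D T w =
     foldr (\<lambda>\<alpha> A. T \<alpha> \<odot> A) (SOME ws. reduced_word D w ws) (elt 1 (mat 1) (mat 1))"

definition schubert_class ::
  "'n::finite root_datum \<Rightarrow> complex \<Rightarrow> complex \<Rightarrow> 'n wmat \<Rightarrow> 'n dual" where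
  "schubert_class D \<tau> h w =
     bullet D (along_word D (T_plus D \<tau> h) (matrix_inv w)) (fbasis (mat 1))"

definition opp_schubert_class ::
  "'n::finite root_datum \<Rightarrow> complex \<Rightarrow> complex \<Rightarrow> 'n wmat \<Rightarrow> 'n dual" where
  "opp_schubert_class D \<tau> h w =
     bullet D (along_word D (T_minus D \<tau> h) (matrix_inv w ** longest D)) (fbasis (longest D))"

definition g_elt :: "'n::finite root_datum \<Rightarrow> complex \<Rightarrow> complex \<Rightarrow> 'n mero" where
  "g_elt D \<tau> h =
     (\<Prod>\<alpha>\<in>pos_roots D. theta_at \<tau> (\<lambda>p. h - z_lin \<alpha> p) / theta_at \<tau> (z_lin \<alpha>))"

definition Y_Pi :: "'n::finite root_datum \<Rightarrow> complex \<Rightarrow> complex \<Rightarrow> 'n twisted" where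
  "Y_Pi D \<tau> h =
     (\<Sum>v\<in>weyl D. \<Sum>w\<in>weyl D. elt 1 v w \<odot> elt (1 / g_elt D \<tau> h) (mat 1) (mat 1))"

definition theta_Pi :: "'n::finite root_datum \<Rightarrow> complex \<Rightarrow> 'n mero" where
  "theta_Pi D \<tau> = (\<Prod>\<alpha>\<in>pos_roots D. theta_at \<tau> (l_lin (coroot D \<alpha>)))"

definition theta_Pi_shift :: "'n::finite root_datum \<Rightarrow> complex \<Rightarrow> complex \<Rightarrow> 'n mero" where
  "theta_Pi_shift D \<tau> h = (\<Prod>\<alpha>\<in>pos_roots D. theta_at \<tau> (\<lambda>p. h - l_lin (coroot D \<alpha>) p))"

end

theory Submission
  imports Defs
begin

text \<open>
  Because \<open>T\<^sup>\<lambda>\<close> and \<open>T\<^sup>-\<^sup>\<lambda>\<close> are adjoint for the Poincare pairing up to a dynamical reflection, which the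
  sum over \<open>\<delta>\<^sup>d\<close> absorbs, the pairing of the two classes is the value at \<open>e\<close> of \<open>T\<^sup>-\<^sup>\<lambda>\<close> along a word for
  \<open>w v\<inverse> w\<^sub>0\<close>, applied to \<open>f\<close> at \<open>w\<^sub>0\<close>. If \<open>w = v\<close> this word is reduced for \<open>w\<^sub>0\<close> and only one term
  survives. If \<open>w \<noteq> v\<close> the value is zero, for any word whose product \<open>x\<close> is not \<open>w\<^sub>0\<close>: on a line in the
  direction of a cocharacter \<open>\<nu>\<close> its quotient by \<open>g\<close> is entire, since the value has at most simple poles where
  \<open>z\<^sub>\<beta>\<close> is a period (a residue relation between \<open>y\<close> and \<open>s\<^sub>\<beta> y\<close> is preserved by the operators) and
  vanishes where \<open>z\<^sub>\<beta> = h\<close> modulo periods. The quotient has period 1, and the period \<open>\<tau>\<close> multiplies it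
  by the exponential of a linear form in \<open>\<lambda>\<close> that is not trivial because \<open>x \<noteq> w\<^sub>0\<close>; so it is zero by
  Liouville's theorem. In particular neither the braid relations nor \<open>T\<^sup>2 = 1\<close> are used.
\<close>

section \<open>Theta functions\<close>

text \<open>For \<open>w \<noteq> v\<close> the word joins two reduced words and is in general not
  reduced, so its matrix coefficient has no evident closed formula. Vanishing is drawn from
  properties that survive one operator at a time, so that induction on arbitrary words applies.
  Translation is the delicate one: crossing from x to x s_\<alpha> and staying at x have different
  multipliers, one in h, the other in \<lambda>. Both are changes of a single exponent, the pairing
  of x (h \<rho> - \<lambda>) with \<nu>, so all terms of the recursion share one multiplier. Its
  h-part is h times the pairing of 2 \<rho> with \<nu>, because w_0 \<rho> = - \<rho>, and division
  by g removes exactly this part. On a line the pole divisors become points, and a generic base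
  point keeps the points of different positive roots apart, so each pole is a simple pole in one
  variable. If h is itself a period, zeros and poles collide; but then \<theta>(h) = 0 leaves a
  single path through the recursion and the vanishing is immediate.\<close>

definition euler_prod :: "complex \<Rightarrow> complex \<Rightarrow> complex" where
  "euler_prod q u = prodinf (\<lambda>s. 1 - q ^ Suc s * u)"

lemma summable_nome_powers:
  fixes q :: complex
  assumes "norm q < 1"
  shows "summable (\<lambda>s. norm (q ^ Suc s) * r)"
proof -
  have "summable (\<lambda>s. norm q ^ Suc s * r)"
    using assms by (intro summable_mult2) (simp add: summable_geometric summable_mult)
  then show ?thesis by (simp add: norm_power norm_mult)
qed

lemma convergent_euler_prod:
  fixes q :: complex
  assumes "norm q < 1"
  shows "convergent_prod (\<lambda>s. 1 - q ^ Suc s * u)"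
proof -
  have "summable (\<lambda>s. norm ((1 - q ^ Suc s * u) - 1))"
    using summable_nome_powers[OF assms, of "norm u"] by (simp add: norm_mult)
  then show ?thesis
    by (intro abs_convergent_prod_imp_convergent_prod summable_imp_abs_convergent_prod)
qed

lemma euler_prod_eq_0_iff:
  assumes "norm q < 1"
  shows "euler_prod q u = 0 \<longleftrightarrow> (\<exists>s. q ^ Suc s * u = 1)"
proof -
  have "(\<lambda>s. 1 - q ^ Suc s * u) has_prod euler_prod q u"
    unfolding euler_prod_def using convergent_euler_prod[OF assms] by (rule convergent_prod_has_prod)
  from has_prod_eq_0_iff[OF this] show ?thesis by (auto simp: image_iff eq_commute[of 0])
qed

text \<open>Splitting off the factor \<open>s = 0\<close> of the product (qu; q)_infinity. The
  behaviour of theta under translation by \<tau> rests on this functional equation.\<close>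

lemma euler_prod_shift:
  assumes "norm q < 1"
  shows "euler_prod q u = (1 - q * u) * euler_prod q (q * u)"
proof -
  have "(\<lambda>s. 1 - q ^ Suc s * (q * u)) has_prod euler_prod q (q * u)"
    unfolding euler_prod_def using convergent_euler_prod[OF assms] by (rule convergent_prod_has_prod)
  then have "(\<lambda>s. 1 - q ^ Suc (Suc s) * u) has_prod euler_prod q (q * u)"
    by (simp add: mult_ac)
  from has_prod_Suc_imp[OF this]
  have "(\<lambda>s. 1 - q ^ Suc s * u) has_prod (euler_prod q (q * u) * (1 - q * u))" by simp
  then show ?thesis unfolding euler_prod_def by (simp add: has_prod_iff mult.commute)
qed

text \<open>The partial products converge uniformly on the closed disc of radius 1 around z: there
  |u| \<le> |z| + 1, so a geometric series majorises the deviations of the factors from 1.\<close>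

lemma holomorphic_euler_prod:
  assumes "norm q < 1"
  shows "euler_prod q holomorphic_on UNIV"
proof (rule holomorphic_uniform_sequence)
  show "(\<lambda>u. \<Prod>s<n. 1 - q ^ Suc s * u) holomorphic_on UNIV" for n
    by (intro holomorphic_intros)
  fix z :: complex
  have "uniformly_convergent_on (cball z 1) (\<lambda>n u. \<Prod>s<n. 1 - q ^ Suc s * u)"
  proof (rule uniformly_convergent_on_prod')
    show "uniformly_convergent_on (cball z 1) (\<lambda>n u. \<Sum>s<n. norm ((1 - q ^ Suc s * u) - 1))"
    proof (rule Weierstrass_m_test')
      show "summable (\<lambda>s. norm (q ^ Suc s) * (norm z + 1))"
        by (rule summable_nome_powers[OF assms])
      show "norm (norm (1 - q ^ Suc s * u - 1)) \<le> norm (q ^ Suc s) * (norm z + 1)"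
        if "u \<in> cball z 1" for s u
      proof -
        have "norm u \<le> norm z + 1"
          using that norm_triangle_ineq4[of z "z - u"] by (simp add: dist_norm)
        then show ?thesis by (simp add: norm_mult mult_left_mono del: power_Suc)
      qed
    qed
  qed (auto intro!: continuous_intros)
  then obtain g where g: "uniform_limit (cball z 1) (\<lambda>n u. \<Prod>s<n. 1 - q ^ Suc s * u) g sequentially"
    by (auto simp: uniformly_convergent_on_def)
  have "g u = euler_prod q u" if "u \<in> cball z 1" for u
  proof -
    have "(\<lambda>n. \<Prod>s<n. 1 - q ^ Suc s * u) \<longlonglongrightarrow> g u"
      using tendsto_uniform_limitI[OF g that] .
    moreover have "(\<lambda>n. \<Prod>s<n. 1 - q ^ Suc s * u) \<longlonglongrightarrow> euler_prod q u"
      unfolding euler_prod_def using convergent_euler_prod[OF assms]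
      by (simp add: convergent_prod_has_prod has_prod_imp_tendsto' del: power_Suc)
    ultimately show ?thesis by (rule LIMSEQ_unique)
  qed
  then have "uniform_limit (cball z 1) (\<lambda>n u. \<Prod>s<n. 1 - q ^ Suc s * u) (euler_prod q) sequentially"
    using g by (metis (mono_tags, lifting) uniform_limit_cong')
  then show "\<exists>d>0. cball z d \<subseteq> UNIV \<and>
      uniform_limit (cball z d) (\<lambda>n u. \<Prod>s<n. 1 - q ^ Suc s * u) (euler_prod q) sequentially"
    by (intro exI[of _ 1]) auto
qed simp

text \<open>Normalised so that integers are sent to 1 and \<tau> to q. Multipliers of theta
  functions are all written with it, so that identities between them become ring identities between
  exponents.\<close>

definition unit_exp :: "complex \<Rightarrow> complex" where
  "unit_exp c = exp (2 * of_real pi * \<i> * c)"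

lemma unit_exp_add: "unit_exp (a + b) = unit_exp a * unit_exp b"
  by (simp add: unit_exp_def exp_add distrib_left)

lemma unit_exp_diff: "unit_exp (a - b) = unit_exp a / unit_exp b"
  by (simp add: unit_exp_def exp_diff right_diff_distrib)

lemma unit_exp_minus: "unit_exp (- a) = inverse (unit_exp a)"
  by (simp add: unit_exp_def exp_minus)

lemma unit_exp_nonzero [simp]: "unit_exp a \<noteq> 0"
  by (simp add: unit_exp_def)

lemma unit_exp_0 [simp]: "unit_exp 0 = 1"
  by (simp add: unit_exp_def)

lemma unit_exp_of_int [simp]: "unit_exp (of_int n) = 1"
  unfolding unit_exp_def exp_eq_1 by (auto intro!: exI[of _ n])

lemma unit_exp_half: "unit_exp (1 / 2) = -1"
  by (simp add: unit_exp_def)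

lemma unit_exp_eq_1_iff: "unit_exp a = 1 \<longleftrightarrow> a \<in> \<int>"
proof
  assume "unit_exp a = 1"
  then have "Re (2 * of_real pi * \<i> * a) = 0" "\<exists>n::int. Im (2 * of_real pi * \<i> * a) = of_int (2 * n) * pi"
    unfolding unit_exp_def exp_eq_1 by blast+
  then obtain n :: int where "Im a = 0" "2 * pi * Re a = of_int (2 * n) * pi"
    by auto
  then have "a = of_int n" by (simp add: complex_eq_iff)
  then show "a \<in> \<int>" by simp
qed (auto elim!: Ints_cases)

lemma unit_exp_of_nat_mult: "unit_exp (of_nat n * a) = unit_exp a ^ n"
  by (simp add: unit_exp_def flip: exp_of_nat_mult) (simp add: mult_ac)

lemma holomorphic_euler_prod_unit_exp [holomorphic_intros]:
  assumes "norm q < 1" "f holomorphic_on A"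
  shows "(\<lambda>x. euler_prod q (unit_exp (f x))) holomorphic_on A"
proof -
  have "(\<lambda>x. unit_exp (f x)) holomorphic_on A"
    unfolding unit_exp_def using assms(2) by (intro holomorphic_intros)
  from holomorphic_on_compose_gen[OF this holomorphic_euler_prod[OF assms(1)]]
  show ?thesis by (simp add: o_def)
qed

lemma holomorphic_unit_exp [holomorphic_intros]:
  "f holomorphic_on A \<Longrightarrow> (\<lambda>x. unit_exp (f x)) holomorphic_on A"
  unfolding unit_exp_def by (intro holomorphic_intros)

section \<open>Theta on the lattice of 1 and \<tau>: multipliers, zeros, Liouville's theorem\<close>

locale elliptic_curve =
  fixes \<tau> :: complex
  assumes Im_pos: "Im \<tau> > 0"
begin

abbreviation "th \<equiv> theta \<tau>"

abbreviation lattice :: "int \<Rightarrow> int \<Rightarrow> complex" where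
  "lattice m n \<equiv> of_int m + of_int n * \<tau>"

definition period :: "complex \<Rightarrow> bool" where
  "period c \<longleftrightarrow> (\<exists>m n :: int. c = lattice m n)"

lemma norm_nome: "norm (unit_exp \<tau>) < 1"
  using Im_pos by (simp add: unit_exp_def)

definition theta_scale :: complex where
  "theta_scale = 1 / (2 * of_real pi * \<i>) * prodinf (\<lambda>s. inverse ((1 - unit_exp \<tau> ^ Suc s)\<^sup>2))"

lemma theta_eq:
  "th x = theta_scale * (unit_exp (x / 2) - unit_exp (- x / 2)) *
     (euler_prod (unit_exp \<tau>) (unit_exp x) * euler_prod (unit_exp \<tau>) (unit_exp (- x)))"
  unfolding theta_def theta_scale_def Let_def euler_prod_def
  by (subst prodinf_mult[OF convergent_euler_prod convergent_euler_prod])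
    (use norm_nome in \<open>simp_all add: unit_exp_def mult_ac\<close>)

lemma theta_scale_nonzero: "theta_scale \<noteq> 0"
proof -
  have nz: "1 - unit_exp \<tau> ^ Suc s \<noteq> 0" for s
    using norm_nome power_Suc_less_one[of "norm (unit_exp \<tau>)" s]
    by (metis norm_ge_zero norm_one norm_power less_irrefl right_minus_eq zero_less_norm_iff unit_exp_nonzero)
  have "convergent_prod (\<lambda>s. 1 - unit_exp \<tau> ^ Suc s)"
    using convergent_euler_prod[OF norm_nome, of 1] by simp
  then have "convergent_prod (\<lambda>s. inverse ((1 - unit_exp \<tau> ^ Suc s)\<^sup>2))"
    by (intro convergent_prod_inverse convergent_prod_power)
  then have "prodinf (\<lambda>s. inverse ((1 - unit_exp \<tau> ^ Suc s)\<^sup>2)) \<noteq> 0"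
    by (rule prodinf_nonzero) (use nz in simp)
  then show ?thesis unfolding theta_scale_def by simp
qed

lemma theta_minus: "th (- x) = - th x"
  unfolding theta_eq by (simp add: algebra_simps)

lemma theta_0 [simp]: "th 0 = 0"
  unfolding theta_eq by simp

lemma holomorphic_theta: "th holomorphic_on UNIV"
proof -
  have "(\<lambda>x. theta_scale * (unit_exp (x / 2) - unit_exp (- x / 2)) *
     (euler_prod (unit_exp \<tau>) (unit_exp x) * euler_prod (unit_exp \<tau>) (unit_exp (- x)))) holomorphic_on UNIV"
    by (intro holomorphic_intros norm_nome) auto
  then show ?thesis by (simp add: theta_eq[abs_def])
qed

lemma theta_add_1: "th (x + 1) = - th x"
proof -
  have 1: "unit_exp ((x + 1) / 2) = - unit_exp (x / 2)"
    unfolding add_divide_distrib unit_exp_add unit_exp_half by simp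
  have "- (x + 1) / 2 = - x / 2 - 1 / 2" by (simp add: field_simps)
  then have 2: "unit_exp (- (x + 1) / 2) = - unit_exp (- x / 2)"
    by (simp only: unit_exp_diff unit_exp_half) simp
  have 3: "unit_exp (x + 1) = unit_exp x" "unit_exp (- (x + 1)) = unit_exp (- x)"
    using unit_exp_of_int[of 1] unfolding unit_exp_minus unit_exp_add by simp_all
  show ?thesis unfolding theta_eq 1 2 3 by (simp only: minus_diff_minus mult_minus_left mult_minus_right)
qed

text \<open>The sine factor at x + \<tau> supplies 1 - qu, which completes the first Euler product
  to the one at x; the second product has a surplus factor 1 - 1/u, which supplies the sine factor
  at x.\<close>

lemma theta_add_tau: "th (x + \<tau>) = - unit_exp (- \<tau> / 2 - x) * th x"
proof -
  define q u w r where "q = unit_exp \<tau>" and "u = unit_exp x" and "w = unit_exp (x / 2)" and "r = unit_exp (\<tau> / 2)"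
  have nz: "q \<noteq> 0" "u \<noteq> 0" "w \<noteq> 0" "r \<noteq> 0" by (simp_all add: q_def u_def w_def r_def)
  have q: "q = r * r" and u: "u = w * w"
    by (simp_all add: q_def u_def w_def r_def flip: unit_exp_add)
  define E where "E = euler_prod q"
  have 1: "E u = (1 - q * u) * E (q * u)"
    unfolding E_def q_def by (rule euler_prod_shift[OF norm_nome])
  have "q * (1 / (q * u)) = 1 / u" using nz by simp
  then have 2: "E (1 / (q * u)) = (1 - 1 / u) * E (1 / u)"
    using euler_prod_shift[OF norm_nome, of "1 / (q * u)"] unfolding E_def q_def by metis
  have 3: "w * r - 1 / (w * r) = - (1 / (w * r)) * (1 - q * u)" "1 - 1 / u = (1 / w) * (w - 1 / w)"
    unfolding q u using nz by (simp_all add: field_simps)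
  have args: "unit_exp ((x + \<tau>) / 2) = w * r" "unit_exp (- (x + \<tau>) / 2) = 1 / (w * r)"
    "unit_exp (x + \<tau>) = q * u" "unit_exp (- (x + \<tau>)) = 1 / (q * u)"
    "unit_exp (- x / 2) = 1 / w" "unit_exp (- x) = 1 / u"
    unfolding q_def u_def w_def r_def divide_minus_left unit_exp_minus add_divide_distrib unit_exp_add
    by (simp_all add: field_simps)
  have "unit_exp (- \<tau> / 2 - x) = 1 / (r * u)"
    unfolding r_def u_def unit_exp_diff divide_minus_left unit_exp_minus by (simp add: field_simps)
  moreover have "th (x + \<tau>) = theta_scale * (w * r - 1 / (w * r)) * (E (q * u) * E (1 / (q * u)))"
    unfolding theta_eq args E_def q_def ..
  moreover have "th x = theta_scale * (w - 1 / w) * (E u * E (1 / u))"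
    unfolding theta_eq args E_def q_def u_def w_def ..
  moreover have "(w * r - 1 / (w * r)) * (E (q * u) * E (1 / (q * u))) =
      - (1 / (w * r * w)) * ((w - 1 / w) * (E u * E (1 / u)))"
    unfolding 1 2 3 by (simp add: mult_ac)
  ultimately show ?thesis by (simp add: u mult_ac)
qed

text \<open>The multiplier (-1)^(m+n) q^(-n^2/2) e^(-2 \<pi> i n x) of the translation by m + n
  \<tau>. The sign is kept as an exponential of (m + n)/2, so that comparing two multipliers is
  comparing two exponents.\<close>

definition theta_factor :: "int \<Rightarrow> int \<Rightarrow> complex \<Rightarrow> complex" where
  "theta_factor m n x =
     unit_exp ((of_int m + of_int n) / 2 - of_int n * of_int n * \<tau> / 2 - of_int n * x)"

lemma theta_factor_nonzero [simp]: "theta_factor m n x \<noteq> 0"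
  by (simp add: theta_factor_def)

lemma theta_add_int: "th (x + of_int m) = theta_factor m 0 x * th x"
proof (induction m rule: int_induct[where k = 0])
  case base show ?case by (simp add: theta_factor_def)
next
  case (step1 m)
  have "th (x + of_int (m + 1)) = - th (x + of_int m)"
    using theta_add_1[of "x + of_int m"] by (simp add: add_ac)
  moreover have "theta_factor (m + 1) 0 x = - theta_factor m 0 x"
    by (simp add: theta_factor_def add_divide_distrib unit_exp_add unit_exp_half)
  ultimately show ?case using step1 by simp
next
  case (step2 m)
  have "th (x + of_int (m - 1)) = - th (x + of_int m)"
    using theta_add_1[of "x + of_int (m - 1)"] by (simp add: add_ac)
  moreover have "theta_factor (m - 1) 0 x = - theta_factor m 0 x"
    by (simp add: theta_factor_def diff_divide_distrib unit_exp_diff unit_exp_half)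
  ultimately show ?case using step2 by simp
qed

lemma theta_factor_Suc:
  "theta_factor 0 (n + 1) x = - unit_exp (- \<tau> / 2 - (x + of_int n * \<tau>)) * theta_factor 0 n x"
proof -
  have "theta_factor 0 (n + 1) x =
      unit_exp (1 / 2) * (unit_exp (- \<tau> / 2 - (x + of_int n * \<tau>)) * theta_factor 0 n x)"
    unfolding theta_factor_def unit_exp_add[symmetric]
    by (rule arg_cong[where f = unit_exp]) (simp add: field_simps)
  then show ?thesis by (simp add: unit_exp_half)
qed

lemma theta_add_int_tau: "th (x + of_int n * \<tau>) = theta_factor 0 n x * th x"
proof (induction n rule: int_induct[where k = 0])
  case base show ?case by (simp add: theta_factor_def)
next
  case (step1 n)
  have "th (x + of_int (n + 1) * \<tau>) =
      - unit_exp (- \<tau> / 2 - (x + of_int n * \<tau>)) * th (x + of_int n * \<tau>)"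
    using theta_add_tau[of "x + of_int n * \<tau>"] by (simp add: algebra_simps)
  then show ?case using step1 theta_factor_Suc[of n x] by simp
next
  case (step2 n)
  have "th (x + of_int n * \<tau>) =
      - unit_exp (- \<tau> / 2 - (x + of_int (n - 1) * \<tau>)) * th (x + of_int (n - 1) * \<tau>)"
    using theta_add_tau[of "x + of_int (n - 1) * \<tau>"] by (simp add: algebra_simps)
  then show ?case using step2 theta_factor_Suc[of "n - 1" x] by simp
qed

lemma theta_add_period:
  "th (x + lattice m n) = theta_factor m n x * th x"
proof -
  have "theta_factor m n x = theta_factor m 0 (x + of_int n * \<tau>) * theta_factor 0 n x"
    unfolding theta_factor_def unit_exp_add[symmetric]
    by (rule arg_cong[where f = unit_exp]) (simp add: field_simps)
  then show ?thesis
    using theta_add_int[of "x + of_int n * \<tau>" m] theta_add_int_tau[of x n] by (simp add: add_ac)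
qed

text \<open>The three factors share out the lattice: the sine factor vanishes at the points with n =
  0, the Euler products at those with n < 0 and with n > 0.\<close>

lemma theta_eq_0_iff: "th x = 0 \<longleftrightarrow> period x"
proof
  assume "period x"
  then show "th x = 0"
    unfolding period_def using theta_add_period[of 0] by auto
next
  define q where "q = unit_exp \<tau>"
  assume "th x = 0"
  then consider "unit_exp (x / 2) = unit_exp (- x / 2)" | "euler_prod q (unit_exp x) = 0"
    | "euler_prod q (unit_exp (- x)) = 0"
    unfolding theta_eq q_def using theta_scale_nonzero by auto
  then show "period x"
  proof cases
    case 1
    then have "unit_exp (x / 2 - (- x / 2)) = 1" by (subst unit_exp_diff) simp
    then have "unit_exp x = 1" by simp
    then obtain m where "x = of_int m" unfolding unit_exp_eq_1_iff by (elim Ints_cases)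
    then show ?thesis unfolding period_def by (intro exI[of _ m] exI[of _ 0]) simp
  next
    case 2
    then obtain s where "q ^ Suc s * unit_exp x = 1"
      using euler_prod_eq_0_iff[OF norm_nome] unfolding q_def by blast
    then have "unit_exp (of_nat (Suc s) * \<tau> + x) = 1"
      unfolding unit_exp_add unit_exp_of_nat_mult q_def .
    then obtain m where "of_nat (Suc s) * \<tau> + x = of_int m" unfolding unit_exp_eq_1_iff by (elim Ints_cases)
    then show ?thesis unfolding period_def
      by (intro exI[of _ m] exI[of _ "- int (Suc s)"]) (simp add: algebra_simps)
  next
    case 3
    then obtain s where "q ^ Suc s * unit_exp (- x) = 1"
      using euler_prod_eq_0_iff[OF norm_nome] unfolding q_def by blast
    then have "unit_exp (of_nat (Suc s) * \<tau> + - x) = 1"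
      unfolding unit_exp_add unit_exp_of_nat_mult q_def .
    then obtain m where "of_nat (Suc s) * \<tau> + - x = of_int m" unfolding unit_exp_eq_1_iff by (elim Ints_cases)
    then show ?thesis unfolding period_def
      by (intro exI[of _ "- m"] exI[of _ "int (Suc s)"]) (simp add: algebra_simps)
  qed
qed

lemma theta_has_deriv: "(th has_field_derivative deriv th x) (at x)"
  using holomorphic_theta by (simp add: holomorphic_derivI)

text \<open>Quasi-periodicity carries the zero to the origin: theta is the sine factor of x - c
  times a function \<open>P\<close> that is nonzero at c, and the sine factor has derivative 2 \<pi>
  i there.\<close>

lemma theta_deriv_at_zero:
  assumes "th c = 0"
  shows "deriv th c \<noteq> 0"
proof -
  obtain m n :: int where c: "c = lattice m n"
    using assms unfolding theta_eq_0_iff period_def by blast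
  define P where "P = (\<lambda>x. theta_scale * theta_factor m n (x - c) *
    (euler_prod (unit_exp \<tau>) (unit_exp (x - c)) * euler_prod (unit_exp \<tau>) (unit_exp (- (x - c)))))"
  have "P holomorphic_on UNIV"
    unfolding P_def theta_factor_def by (intro holomorphic_intros norm_nome) auto
  then have dP: "(P has_field_derivative deriv P c) (at c)" by (simp add: holomorphic_derivI)
  have eq: "th = (\<lambda>x. (unit_exp ((x - c) / 2) - unit_exp (- (x - c) / 2)) * P x)"
  proof
    fix x
    show "th x = (unit_exp ((x - c) / 2) - unit_exp (- (x - c) / 2)) * P x"
      using theta_add_period[of "x - c" m n] unfolding c[symmetric] theta_eq[of "x - c"] P_def
      by (simp add: mult_ac)
  qed
  have "(th has_field_derivative (2 * of_real pi * \<i>) * P c) (at c)"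
    unfolding eq by (rule derivative_eq_intros dP refl | simp add: unit_exp_def)+
  then have "deriv th c = (2 * of_real pi * \<i>) * P c" by (rule DERIV_imp_deriv)
  moreover have "euler_prod (unit_exp \<tau>) 1 \<noteq> 0"
  proof -
    have "unit_exp \<tau> ^ Suc s * 1 \<noteq> 1" for s
      using norm_nome power_Suc_less_one[of "norm (unit_exp \<tau>)" s]
      by (metis norm_one norm_power less_irrefl mult.right_neutral zero_less_norm_iff unit_exp_nonzero)
    then show ?thesis using euler_prod_eq_0_iff[OF norm_nome] by blast
  qed
  ultimately show ?thesis
    unfolding P_def using theta_scale_nonzero by simp
qed

text \<open>A suitable exponential factor makes the absolute value doubly periodic, so Liouville's
  theorem shows that \<open>k\<close> is a multiple of an exponential; the multipliers of an
  exponential lie in the wrong class.\<close>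

lemma entire_quasi_periodic_eq_0:
  assumes hol: "k holomorphic_on UNIV" and one: "\<And>t. k (t + 1) = k t"
    and tau: "\<And>t. k (t + \<tau>) = unit_exp c * k t" and c: "\<not> period c"
  shows "k t = 0"
proof -
  \<comment> \<open>Real, so that the translation by 1 keeps the absolute value, and of this size
    because |e(c)| and |e(r \<tau>)| are exp(-2 \<pi> Im c) and exp(-2 \<pi> r Im \<tau>).\<close>
  define r where "r = - Im c / Im \<tau>"
  define f where "f = (\<lambda>t. k t * unit_exp (of_real r * t))"
  have hf: "f holomorphic_on UNIV"
    unfolding f_def unit_exp_def using hol by (intro holomorphic_intros)
  have n1: "norm (f (t + 1)) = norm (f t)" for t
    unfolding f_def by (simp add: one norm_mult distrib_left unit_exp_add) (simp add: unit_exp_def)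
  have n2: "norm (f (t + \<tau>)) = norm (f t)" for t
  proof -
    have "norm (unit_exp c) * norm (unit_exp (of_real r * \<tau>)) = 1"
      unfolding norm_mult[symmetric] unit_exp_add[symmetric]
      using Im_pos by (simp add: unit_exp_def r_def)
    then show ?thesis
      unfolding f_def by (simp add: tau norm_mult distrib_left unit_exp_add mult_ac)
  qed
  have i1: "norm (f (t + of_int m)) = norm (f t)" for t m
  proof (induction m rule: int_induct[where k = 0])
    case (step1 i) then show ?case using n1[of "t + of_int i"] by (simp add: add_ac)
  next
    case (step2 i) then show ?case using n1[of "t + of_int (i - 1)"] by (simp add: add_ac)
  qed simp
  have i2: "norm (f (t + of_int n * \<tau>)) = norm (f t)" for t n
  proof (induction n rule: int_induct[where k = 0])
    case (step1 i) then show ?case using n2[of "t + of_int i * \<tau>"] by (simp add: algebra_simps)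
  next
    case (step2 i) then show ?case using n2[of "t + of_int (i - 1) * \<tau>"] by (simp add: algebra_simps)
  qed simp
  define S where "S = cball (0::complex) (1 + norm \<tau>)"
  have "continuous_on S f"
    using hf holomorphic_on_imp_continuous_on holomorphic_on_subset by blast
  then have "bounded (f ` S)"
    by (intro compact_imp_bounded compact_continuous_image) (simp_all add: S_def)
  then obtain B where B: "\<And>t. t \<in> S \<Longrightarrow> norm (f t) \<le> B" by (auto simp: bounded_iff)
  have bd: "norm (f t) \<le> B" for t
  proof -
    define n where "n = \<lfloor>Im t / Im \<tau>\<rfloor>"
    define m where "m = \<lfloor>Re (t - of_int n * \<tau>)\<rfloor>"
    define b where "b = Im t / Im \<tau> - of_int n"
    define a where "a = Re (t - of_int n * \<tau>) - of_int m"
    define s where "s = t - of_int n * \<tau> - of_int m"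
    have ab: "0 \<le> b" "b \<le> 1" "0 \<le> a" "a \<le> 1"
      unfolding a_def b_def m_def n_def by linarith+
    have "s = of_real a + of_real b * of_real (Im \<tau>) * \<i>"
      using Im_pos by (simp add: complex_eq_iff s_def a_def b_def field_simps)
    also have "norm \<dots> \<le> a + b * Im \<tau>"
      using ab Im_pos by (intro order.trans[OF norm_triangle_ineq]) (simp add: norm_mult)
    also have "\<dots> \<le> 1 + norm \<tau>"
      using ab Im_pos abs_Im_le_cmod[of \<tau>] mult_left_le_one_le[of "Im \<tau>" b] by linarith
    finally have "s \<in> S" by (simp add: S_def)
    moreover have "norm (f t) = norm (f s)"
      using i1[of s m] i2[of "s + of_int m" n] by (simp add: s_def)
    ultimately show ?thesis using B by simp
  qed
  have "f constant_on UNIV"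
    by (rule Liouville_theorem[OF hf]) (use bd in \<open>auto simp: bounded_iff\<close>)
  then obtain A where A: "\<And>t. f t = A" by (auto simp: constant_on_def)
  have kA: "k t = A * unit_exp (- (of_real r * t))" for t
    using A[of t] unfolding f_def unit_exp_minus by (auto simp: field_simps)
  \<comment> \<open>If the constant were nonzero, period 1 would force r to be an integer, and
    comparing the multipliers for \<tau> would then place c in the lattice.\<close>
  have "A = 0"
  proof (rule ccontr)
    assume "A \<noteq> 0"
    have "unit_exp (- of_real r) = 1"
      using one[of 0] \<open>A \<noteq> 0\<close> unfolding kA by simp
    then obtain m where m: "of_real r = (of_int m :: complex)"
      unfolding unit_exp_eq_1_iff by (metis Ints_cases Ints_minus minus_minus)
    have "unit_exp (- (of_int m * \<tau>)) = unit_exp c"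
      using tau[of 0] \<open>A \<noteq> 0\<close> unfolding kA m by simp
    then have "unit_exp (c - (- (of_int m * \<tau>))) = 1" by (subst unit_exp_diff) simp
    then obtain n where "c + of_int m * \<tau> = of_int n"
      unfolding unit_exp_eq_1_iff by (auto elim!: Ints_cases)
    then have "c = of_int n + of_int (- m) * \<tau>" by (simp add: algebra_simps eq_diff_eq)
    then show False using c unfolding period_def by blast
  qed
  then show ?thesis using kA by simp
qed

end

section \<open>Root systems and Weyl groups\<close>

lemma pairing_add_left: "pairing (a + b) c = pairing a c + pairing b c"
  by (simp add: pairing_def distrib_right sum.distrib)

lemma pairing_add_right: "pairing a (b + c) = pairing a b + pairing a c"
  by (simp add: pairing_def distrib_left sum.distrib)

lemma pairing_diff_left: "pairing (a - b) c = pairing a c - pairing b c"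
  by (simp add: pairing_def left_diff_distrib sum_subtractf)

lemma pairing_diff_right: "pairing a (b - c) = pairing a b - pairing a c"
  by (simp add: pairing_def right_diff_distrib sum_subtractf)

lemma pairing_minus_left: "pairing (- a) c = - pairing a c"
  by (simp add: pairing_def sum_negf)

lemma pairing_minus_right: "pairing a (- c) = - pairing a c"
  by (simp add: pairing_def sum_negf)

lemma pairing_scale_left: "pairing (k *s a) c = k * pairing a c"
  by (simp add: pairing_def sum_distrib_left mult_ac)

lemma pairing_scale_right: "pairing a (k *s c) = k * pairing a c"
  by (simp add: pairing_def sum_distrib_left mult_ac)

lemma pairing_zero_left [simp]: "pairing 0 c = 0"
  by (simp add: pairing_def)

lemma pairing_zero_right [simp]: "pairing a 0 = 0"
  by (simp add: pairing_def)

lemma pairing_sum_left: "pairing (\<Sum>i\<in>I. f i) c = (\<Sum>i\<in>I. pairing (f i) c)"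
  by (induction I rule: infinite_finite_induct) (auto simp: pairing_add_left)

lemmas pairing_linear = pairing_add_left pairing_add_right pairing_diff_left pairing_diff_right
  pairing_minus_left pairing_minus_right pairing_scale_left pairing_scale_right

lemma pairing_matrix: "pairing (A *v x) y = pairing x (transpose A *v y)"
proof -
  have "pairing (A *v x) y = (\<Sum>i\<in>UNIV. \<Sum>j\<in>UNIV. A $ i $ j * x $ j * y $ i)"
    by (simp add: pairing_def matrix_vector_mult_def sum_distrib_right)
  also have "\<dots> = (\<Sum>j\<in>UNIV. \<Sum>i\<in>UNIV. A $ i $ j * x $ j * y $ i)"
    by (rule sum.swap)
  also have "\<dots> = pairing x (transpose A *v y)"
    by (simp add: pairing_def matrix_vector_mult_def transpose_def sum_distrib_left mult_ac)
  finally show ?thesis .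
qed

lemma pairing_axis_right: "pairing x (axis i 1) = x $ i"
  by (simp add: pairing_def axis_def if_distrib sum.If_cases cong: if_cong)

lemma pairing_commute: "pairing x y = pairing y x"
  by (simp add: pairing_def mult.commute)

lemma pairing_axis_left: "pairing (axis i 1) x = x $ i"
  unfolding pairing_commute[of "axis i 1"] by (rule pairing_axis_right)

lemma matrix_vector_scale:
  fixes A :: "'a::comm_semiring_1^'n^'m"
  shows "A *v (k *s x) = k *s (A *v x)"
  by (simp add: vec_eq_iff matrix_vector_mult_def sum_distrib_left mult_ac)

lemma matrix_vector_minus:
  fixes A :: "'a::comm_ring_1^'n^'m"
  shows "A *v (- x) = - (A *v x)"
  by (simp add: vec_eq_iff matrix_vector_mult_def sum_negf)

lemma matrix_vector_sum:
  fixes A :: "'a::comm_ring_1^'n^'m"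
  shows "A *v (\<Sum>i\<in>I. f i) = (\<Sum>i\<in>I. A *v f i)"
  by (induction I rule: infinite_finite_induct) (auto simp: matrix_vector_right_distrib)

lemma matrix_inv_eqI:
  fixes A :: "'a::comm_ring_1^'n^'n"
  assumes "A ** B = mat 1" "B ** A = mat 1"
  shows "matrix_inv A = B"
proof -
  have inv: "A ** matrix_inv A = mat 1 \<and> matrix_inv A ** A = mat 1"
    unfolding matrix_inv_def
    by (rule someI[where x = B and P = "\<lambda>A'. A ** A' = mat 1 \<and> A' ** A = mat 1"]) (simp add: assms)
  have "matrix_inv A = matrix_inv A ** (A ** B)" unfolding assms(1) by simp
  also have "\<dots> = matrix_inv A ** A ** B" by (rule matrix_mul_assoc)
  finally show ?thesis using inv by simp
qed

text \<open>Serves to exclude nontrivial unipotent maps of the finite sets of roots and coroots: the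
  iterates of such a map trace out an arithmetic progression.\<close>

lemma arithmetic_progression_in_finite:
  fixes a d :: "int^'n"
  assumes "finite S" "\<And>k::nat. a + int k *s d \<in> S"
  shows "d = 0"
proof (rule ccontr)
  assume "d \<noteq> 0"
  then obtain i where i: "d $ i \<noteq> 0" by (auto simp: vec_eq_iff)
  have "inj (\<lambda>k::nat. a + int k *s d)"
    by (rule injI) (use i in \<open>auto simp: vec_eq_iff\<close>)
  moreover have "range (\<lambda>k::nat. a + int k *s d) \<subseteq> S" using assms(2) by blast
  ultimately show False
    using assms(1) by (meson finite_subset finite_imageD infinite_UNIV_nat)
qed

section \<open>Reflections, coroots and the action of the Weyl group on roots\<close>

locale based_root_datum =
  fixes D :: "'n::finite root_datum"
  assumes root_datum: "root_datum D" and is_base: "is_base D"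
begin

abbreviation "R \<equiv> roots D"
abbreviation "B \<equiv> simple_roots D"
abbreviation "P \<equiv> pos_roots D"
abbreviation "W \<equiv> weyl D"
abbreviation "cv \<equiv> coroot D"
abbreviation "s \<equiv> reflection D"

lemma finite_R: "finite R"
  and pairing_self: "\<alpha> \<in> R \<Longrightarrow> pairing \<alpha> (cv \<alpha>) = 2"
  and coroot_reflect_in: "\<alpha> \<in> R \<Longrightarrow> \<beta> \<in> R \<Longrightarrow> cv \<beta> - pairing \<alpha> (cv \<beta>) *s cv \<alpha> \<in> cv ` R"
  and reduced: "\<alpha> \<in> R \<Longrightarrow> 2 *s \<alpha> \<notin> R"
  using root_datum by (auto simp: root_datum_def)

lemma root_reflect_in: "\<alpha> \<in> R \<Longrightarrow> \<beta> \<in> R \<Longrightarrow> \<beta> - pairing \<beta> (cv \<alpha>) *s \<alpha> \<in> R"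
  using root_datum by (auto simp: root_datum_def)

lemma reflection_apply: "s \<alpha> *v \<mu> = \<mu> - pairing \<mu> (cv \<alpha>) *s \<alpha>"
proof -
  have "(s \<alpha> *v \<mu>) $ i = (\<mu> - pairing \<mu> (cv \<alpha>) *s \<alpha>) $ i" for i
  proof -
    have "(s \<alpha> *v \<mu>) $ i = (\<Sum>j\<in>UNIV. (if i = j then \<mu> $ j else 0) - cv \<alpha> $ j * \<mu> $ j * \<alpha> $ i)"
      by (simp add: matrix_vector_mult_def reflection_def matrix_def pairing_axis_left)
        (auto simp: axis_def algebra_simps intro!: sum.cong)
    also have "\<dots> = (\<mu> - pairing \<mu> (cv \<alpha>) *s \<alpha>) $ i"
      by (simp add: sum_subtractf pairing_def sum_distrib_right sum_distrib_left mult_ac)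
    finally show ?thesis .
  qed
  then show ?thesis by (simp add: vec_eq_iff)
qed

lemma reflection_root: "\<alpha> \<in> R \<Longrightarrow> \<beta> \<in> R \<Longrightarrow> s \<alpha> *v \<beta> \<in> R"
  unfolding reflection_apply by (rule root_reflect_in)

lemma reflection_self: "\<alpha> \<in> R \<Longrightarrow> s \<alpha> *v \<alpha> = - \<alpha>"
  by (simp add: reflection_apply pairing_self vec_eq_iff)

lemma root_uminus: "\<alpha> \<in> R \<Longrightarrow> - \<alpha> \<in> R"
  using reflection_root[of \<alpha> \<alpha>] reflection_self by simp

lemma root_nonzero: "\<alpha> \<in> R \<Longrightarrow> \<alpha> \<noteq> 0"
  using pairing_self by force

lemma coroot_nonzero: "\<alpha> \<in> R \<Longrightarrow> cv \<alpha> \<noteq> 0"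
  using pairing_self by force

lemma reflection_twice: "\<alpha> \<in> R \<Longrightarrow> s \<alpha> *v (s \<alpha> *v \<mu>) = \<mu>"
  by (simp add: reflection_apply pairing_linear pairing_self vec_eq_iff algebra_simps)

lemma reflection_involution: "\<alpha> \<in> R \<Longrightarrow> s \<alpha> ** s \<alpha> = mat 1"
  unfolding matrix_eq by (simp add: reflection_twice flip: matrix_vector_mul_assoc)

text \<open>If the two coroots differed, the product of the two dual reflections would be unipotent of infinite
  order on the finite set of coroots.\<close>

lemma coroot_eqI:
  assumes "\<alpha> \<in> R" "\<beta> \<in> R" and eq: "\<And>\<rho>. \<rho> \<in> R \<Longrightarrow> pairing \<rho> (cv \<alpha>) = pairing \<rho> (cv \<beta>)"
  shows "cv \<alpha> = cv \<beta>"
proof -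
  define d where "d = cv \<alpha> - cv \<beta>"
  have d0: "pairing \<alpha> d = 0" "pairing \<beta> d = 0"
    using eq assms by (simp_all add: d_def pairing_linear)
  have ab: "pairing \<alpha> (cv \<beta>) = 2" "pairing \<beta> (cv \<alpha>) = 2"
    using eq pairing_self assms by fastforce+
  \<comment> \<open>The dual reflection in \<beta> followed by the one in \<alpha> adds 2d to c,
    because both roots vanish on d and take the value 2 on either coroot.\<close>
  have "cv \<alpha> + int k *s (2 *s d) \<in> cv ` R" for k
  proof (induction k)
    case 0 then show ?case using assms by simp
  next
    case (Suc k)
    define c where "c = cv \<alpha> + int k *s (2 *s d)"
    obtain \<gamma> where \<gamma>: "\<gamma> \<in> R" "cv \<gamma> = c" using Suc by (auto simp: c_def)
    have "c - pairing \<beta> c *s cv \<beta> \<in> cv ` R"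
      using coroot_reflect_in[OF assms(2) \<gamma>(1)] \<gamma>(2) by simp
    moreover have "pairing \<beta> c = 2" by (simp add: c_def pairing_linear d0 ab)
    ultimately obtain \<delta> where \<delta>: "\<delta> \<in> R" "cv \<delta> = c - 2 *s cv \<beta>" by auto
    have "cv \<delta> - pairing \<alpha> (cv \<delta>) *s cv \<alpha> \<in> cv ` R"
      using coroot_reflect_in[OF assms(1) \<delta>(1)] .
    moreover have "pairing \<alpha> (cv \<delta>) = -2"
      by (simp add: \<delta>(2) c_def pairing_linear d0 ab pairing_self assms)
    moreover have "c - 2 *s cv \<beta> - (-2) *s cv \<alpha> = c - 2 *s cv \<beta> + 2 *s cv \<alpha>"
      by (simp add: vec_eq_iff)
    ultimately have "c - 2 *s cv \<beta> + 2 *s cv \<alpha> \<in> cv ` R" by (metis \<delta>(2))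
    moreover have "c - 2 *s cv \<beta> + 2 *s cv \<alpha> = cv \<alpha> + int (Suc k) *s (2 *s d)"
      by (simp add: c_def d_def vec_eq_iff algebra_simps)
    ultimately show ?case by simp
  qed
  then have "2 *s d = 0" by (rule arithmetic_progression_in_finite[OF finite_imageI[OF finite_R]])
  then show ?thesis by (simp add: d_def vec_eq_iff)
qed

text \<open>Both sides are coroots that define a reflection of the roots with the root \<open>s\<^sub>\<alpha> \<beta>\<close>; two such reflections
  differ by a transvection, which has infinite order unless it is trivial.\<close>

lemma coroot_reflect:
  assumes "\<alpha> \<in> R" "\<beta> \<in> R"
  shows "cv (s \<alpha> *v \<beta>) = cv \<beta> - pairing \<alpha> (cv \<beta>) *s cv \<alpha>"
proof -
  define \<gamma> where "\<gamma> = s \<alpha> *v \<beta>"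
  have \<gamma>: "\<gamma> \<in> R" using assms by (simp add: \<gamma>_def reflection_root)
  obtain \<delta> where \<delta>: "\<delta> \<in> R" "cv \<delta> = cv \<beta> - pairing \<alpha> (cv \<beta>) *s cv \<alpha>"
    using coroot_reflect_in[OF assms] by auto
  have g: "pairing \<rho> (cv \<delta>) = pairing (s \<alpha> *v \<rho>) (cv \<beta>)" for \<rho>
    unfolding \<delta>(2) reflection_apply by (simp add: pairing_linear)
  have g\<gamma>: "pairing \<gamma> (cv \<delta>) = 2"
    unfolding g \<gamma>_def reflection_twice[OF assms(1)] by (rule pairing_self[OF assms(2)])
  have f\<gamma>: "pairing \<gamma> (cv \<gamma>) = 2" by (rule pairing_self[OF \<gamma>])
  have A: "\<rho> - pairing \<rho> (cv \<delta>) *s \<gamma> \<in> R" if "\<rho> \<in> R" for \<rho>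
  proof -
    have "s \<alpha> *v (s \<beta> *v (s \<alpha> *v \<rho>)) \<in> R" using that assms by (simp add: reflection_root)
    moreover have "s \<alpha> *v (s \<beta> *v (s \<alpha> *v \<rho>)) = \<rho> - pairing \<rho> (cv \<delta>) *s \<gamma>"
      unfolding reflection_apply[of \<beta>] matrix_vector_mult_diff_distrib reflection_twice[OF assms(1)]
        matrix_vector_scale g \<gamma>_def ..
    ultimately show ?thesis by simp
  qed
  have "pairing \<rho> (cv \<gamma>) = pairing \<rho> (cv \<delta>)" if \<rho>: "\<rho> \<in> R" for \<rho>
  proof -
    \<comment> \<open>The displacement of \<rho> under one product of the two reflections. It is the
      same at each iteration, since \<open>cv \<delta>\<close> and \<open>cv \<gamma>\<close> take
      equal values on multiples of \<gamma>.\<close>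
    define d where "d = (pairing \<rho> (cv \<delta>) - pairing \<rho> (cv \<gamma>)) *s \<gamma>"
    have d0: "pairing d (cv \<delta>) = 2 * (pairing \<rho> (cv \<delta>) - pairing \<rho> (cv \<gamma>))"
      "pairing d (cv \<gamma>) = 2 * (pairing \<rho> (cv \<delta>) - pairing \<rho> (cv \<gamma>))"
      by (simp_all add: d_def pairing_linear f\<gamma> g\<gamma>)
    have "\<rho> + int k *s d \<in> R" for k
    proof (induction k)
      case 0 then show ?case using \<rho> by simp
    next
      case (Suc k)
      define \<sigma> where "\<sigma> = \<rho> + int k *s d"
      define \<sigma>' where "\<sigma>' = \<sigma> - pairing \<sigma> (cv \<delta>) *s \<gamma>"
      have "\<sigma>' \<in> R" unfolding \<sigma>'_def using A Suc by (simp add: \<sigma>_def)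
      then have "\<sigma>' - pairing \<sigma>' (cv \<gamma>) *s \<gamma> \<in> R" by (rule root_reflect_in[OF \<gamma>])
      moreover have "\<sigma>' - pairing \<sigma>' (cv \<gamma>) *s \<gamma> = \<rho> + int (Suc k) *s d"
        by (simp add: \<sigma>'_def \<sigma>_def pairing_linear f\<gamma> g\<gamma> d0)
          (simp add: d_def vec_eq_iff algebra_simps)
      ultimately show ?case by simp
    qed
    then have "d = 0" by (rule arithmetic_progression_in_finite[OF finite_R])
    then show ?thesis using root_nonzero[OF \<gamma>] by (auto simp: d_def vec_eq_iff)
  qed
  then show ?thesis using coroot_eqI[OF \<gamma> \<delta>(1)] \<delta>(2) by (simp add: \<gamma>_def)
qed

lemma coroot_uminus: "\<alpha> \<in> R \<Longrightarrow> cv (- \<alpha>) = - cv \<alpha>"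
  using coroot_reflect[of \<alpha> \<alpha>] by (simp add: reflection_self pairing_self vec_eq_iff)

lemma reflection_uminus: "\<alpha> \<in> R \<Longrightarrow> s (- \<alpha>) = s \<alpha>"
  unfolding matrix_eq reflection_apply by (simp add: coroot_uminus pairing_linear vec_eq_iff)

lemma one_in_W: "mat 1 \<in> W"
  by (rule weyl.one)

lemma reflection_in_W: "\<alpha> \<in> R \<Longrightarrow> s \<alpha> \<in> W"
  using weyl.step[OF weyl.one] by fastforce

lemma W_root: "w \<in> W \<Longrightarrow> \<beta> \<in> R \<Longrightarrow> w *v \<beta> \<in> R"
  by (induction rule: weyl.induct) (simp_all add: reflection_root flip: matrix_vector_mul_assoc)

lemma W_pairing:
  "w \<in> W \<Longrightarrow> \<beta> \<in> R \<Longrightarrow> pairing (w *v \<mu>) (cv (w *v \<beta>)) = pairing \<mu> (cv \<beta>)"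
proof (induction rule: weyl.induct)
  case (step w \<alpha>)
  have "pairing (s \<alpha> *v \<mu>) (cv (s \<alpha> *v \<gamma>)) = pairing \<mu> (cv \<gamma>)" if "\<gamma> \<in> R" for \<mu> \<gamma>
    by (subst coroot_reflect[OF step.hyps(2) that])
      (simp add: reflection_apply pairing_linear pairing_self step.hyps algebra_simps)
  then show ?case using step W_root by (simp flip: matrix_vector_mul_assoc)
qed simp

lemma W_mult: "w \<in> W \<Longrightarrow> w' \<in> W \<Longrightarrow> w ** w' \<in> W"
  by (induction rule: weyl.induct) (simp_all add: weyl.step flip: matrix_mul_assoc)

lemma W_inverse: "w \<in> W \<Longrightarrow> \<exists>w'\<in>W. w ** w' = mat 1 \<and> w' ** w = mat 1"
proof (induction rule: weyl.induct)
  case one show ?case by (intro bexI[of _ "mat 1"]) (simp_all add: one_in_W)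
next
  case (step w \<alpha>)
  then obtain w' where w': "w' \<in> W" "w ** w' = mat 1" "w' ** w = mat 1" by blast
  show ?case
  proof (intro bexI[of _ "w' ** s \<alpha>"] conjI)
    show "w' ** s \<alpha> \<in> W" using w' step by (simp add: W_mult reflection_in_W)
    have "s \<alpha> ** w ** (w' ** s \<alpha>) = s \<alpha> ** (w ** w') ** s \<alpha>" by (simp add: matrix_mul_assoc)
    then show "s \<alpha> ** w ** (w' ** s \<alpha>) = mat 1" using w' step by (simp add: reflection_involution)
    have "w' ** s \<alpha> ** (s \<alpha> ** w) = w' ** (s \<alpha> ** s \<alpha>) ** w" by (simp add: matrix_mul_assoc)
    then show "w' ** s \<alpha> ** (s \<alpha> ** w) = mat 1" using w' step by (simp add: reflection_involution)
  qed
qed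

lemma W_inv:
  assumes "w \<in> W"
  shows "matrix_inv w \<in> W" "w ** matrix_inv w = mat 1" "matrix_inv w ** w = mat 1"
  using W_inverse[OF assms] by (auto dest: matrix_inv_eqI)

lemma W_inv_apply:
  assumes "w \<in> W"
  shows "w *v (matrix_inv w *v x) = x" "matrix_inv w *v (w *v x) = x"
  using W_inv[OF assms] by (simp_all add: matrix_vector_mul_assoc)

lemma W_inv_inv: "w \<in> W \<Longrightarrow> matrix_inv (matrix_inv w) = w"
  using W_inv by (intro matrix_inv_eqI) auto

lemma W_inv_mult:
  assumes "w \<in> W" "w' \<in> W"
  shows "matrix_inv (w ** w') = matrix_inv w' ** matrix_inv w"
proof (rule matrix_inv_eqI)
  have "w ** w' ** (matrix_inv w' ** matrix_inv w) = w ** (w' ** matrix_inv w') ** matrix_inv w"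
    by (simp add: matrix_mul_assoc)
  then show "w ** w' ** (matrix_inv w' ** matrix_inv w) = mat 1" using assms by (simp add: W_inv)
  have "matrix_inv w' ** matrix_inv w ** (w ** w') = matrix_inv w' ** (matrix_inv w ** w) ** w'"
    by (simp add: matrix_mul_assoc)
  then show "matrix_inv w' ** matrix_inv w ** (w ** w') = mat 1" using assms by (simp add: W_inv)
qed

lemma reflection_inv: "\<alpha> \<in> R \<Longrightarrow> matrix_inv (s \<alpha>) = s \<alpha>"
  by (intro matrix_inv_eqI) (simp_all add: reflection_involution)

lemma W_cancel_right: "w \<in> W \<Longrightarrow> a ** w = b ** w \<longleftrightarrow> a = b"
  by (metis W_inv(2) matrix_mul_assoc matrix_mul_rid)

lemma W_apply_cancel: "w \<in> W \<Longrightarrow> w *v a = w *v b \<longleftrightarrow> a = b"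
  by (metis W_inv_apply(2))

lemma reflection_W_root:
  assumes "w \<in> W" "\<beta> \<in> R"
  shows "s (w *v \<beta>) ** w = w ** s \<beta>"
  unfolding matrix_eq
proof
  fix x
  have "s (w *v \<beta>) *v (w *v x) = w *v (s \<beta> *v x)"
    unfolding reflection_apply W_pairing[OF assms]
    by (simp add: matrix_vector_mult_diff_distrib matrix_vector_scale)
  then show "s (w *v \<beta>) ** w *v x = w ** s \<beta> *v x" by (simp add: matrix_vector_mul_assoc)
qed

text \<open>Pairing the relation with both coroots gives p a = 2 q and 2 p = q b, hence a b = 4. If
  a or b were 1 or -1, one root would be twice a root, against reducedness; so a is 2 or -2.\<close>

lemma proportional_roots:
  assumes "\<beta> \<in> R" "\<gamma> \<in> R" and pq: "p *s \<beta> = q *s \<gamma>" "p \<noteq> 0" "q \<noteq> (0::int)"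
  shows "\<beta> = \<gamma> \<or> \<beta> = - \<gamma>"
proof -
  define a b where "a = pairing \<beta> (cv \<gamma>)" and "b = pairing \<gamma> (cv \<beta>)"
  have 1: "p * a = 2 * q"
    using arg_cong[OF pq(1), of "\<lambda>x. pairing x (cv \<gamma>)"] pairing_self[OF assms(2)]
    unfolding pairing_scale_left a_def by simp
  have 2: "2 * p = q * b"
    using arg_cong[OF pq(1), of "\<lambda>x. pairing x (cv \<beta>)"] pairing_self[OF assms(1)]
    unfolding pairing_scale_left b_def by simp
  have eq: "p * \<beta> $ i = q * \<gamma> $ i" for i using pq(1) by (simp add: vec_eq_iff)
  have "p * (a * b) = p * a * b" by simp
  also have "\<dots> = p * 4" unfolding 1 using 2 by simp
  finally have ab: "a * b = 4" using pq(2) by simp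
  have \<gamma>: "a * \<gamma> $ i = 2 * \<beta> $ i" for i
  proof -
    have "p * (a * \<gamma> $ i) = 2 * (q * \<gamma> $ i)" using 1 by (metis mult.assoc)
    also have "\<dots> = p * (2 * \<beta> $ i)" unfolding eq[symmetric] by simp
    finally show ?thesis using pq(2) by simp
  qed
  have \<beta>': "b * \<beta> $ i = 2 * \<gamma> $ i" for i
  proof -
    have "q * (b * \<beta> $ i) = 2 * (p * \<beta> $ i)" using 2 by (metis mult.assoc)
    also have "\<dots> = q * (2 * \<gamma> $ i)" unfolding eq by simp
    finally show ?thesis using pq(3) by simp
  qed
  have no: "\<gamma> \<noteq> 2 *s \<beta>" "\<gamma> \<noteq> 2 *s (- \<beta>)" "\<beta> \<noteq> 2 *s \<gamma>" "\<beta> \<noteq> 2 *s (- \<gamma>)"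
    using reduced root_uminus assms(1,2) by metis+
  have "a dvd 4" by (metis ab dvd_triv_left)
  then have "\<bar>a\<bar> \<le> 4" by (simp add: zdvd_imp_le dvd_imp_le_int)
  then have "a \<in> {-4,-3,-2,-1,0,1,2,3,4}" by auto
  then consider "a = 1 \<or> a = -1" | "a = 2 \<or> a = -2" | "b = 1 \<or> b = -1"
    using ab by auto
  then show ?thesis
  proof cases
    case 1
    then have "\<gamma> $ i = a * (2 * \<beta> $ i)" for i using \<gamma>[of i] by auto
    then have "\<gamma> = 2 *s \<beta> \<or> \<gamma> = 2 *s (- \<beta>)" using 1 by (auto simp: vec_eq_iff)
    then show ?thesis using no by blast
  next
    case 2
    then show ?thesis
    proof
      assume "a = 2" then show ?thesis using \<gamma> by (auto simp: vec_eq_iff)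
    next
      assume "a = -2"
      then have "\<beta> $ i = - \<gamma> $ i" for i using \<gamma>[of i] by simp
      then show ?thesis by (simp add: vec_eq_iff)
    qed
  next
    case 3
    then have "\<beta> $ i = b * (2 * \<gamma> $ i)" for i using \<beta>'[of i] by auto
    then have "\<beta> = 2 *s \<gamma> \<or> \<beta> = 2 *s (- \<gamma>)" using 3 by (auto simp: vec_eq_iff)
    then show ?thesis using no by blast
  qed
qed

section \<open>Bases and positive roots\<close>

lemma finite_B: "finite B" and B_root: "\<alpha> \<in> B \<Longrightarrow> \<alpha> \<in> R"
  using is_base finite_R by (auto simp: is_base_def intro: finite_subset)

lemma simple_in_W: "\<alpha> \<in> B \<Longrightarrow> s \<alpha> \<in> W"
  by (intro reflection_in_W B_root)

definition comb :: "(int^'n \<Rightarrow> int) \<Rightarrow> int^'n" where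
  "comb c = (\<Sum>\<beta>\<in>B. c \<beta> *s \<beta>)"

abbreviation nonneg :: "(int^'n \<Rightarrow> int) \<Rightarrow> bool" where
  "nonneg c \<equiv> \<forall>\<alpha>\<in>B. c \<alpha> \<ge> 0"

lemma comb_add: "comb (\<lambda>x. c x + c' x) = comb c + comb c'"
  by (simp add: comb_def vec_eq_iff distrib_right sum.distrib)

lemma comb_diff: "comb (\<lambda>x. c x - c' x) = comb c - comb c'"
  by (simp add: comb_def vec_eq_iff left_diff_distrib sum_subtractf)

lemma comb_uminus: "comb (\<lambda>x. - c x) = - comb c"
  by (simp add: comb_def vec_eq_iff sum_negf)

lemma comb_single: "\<alpha> \<in> B \<Longrightarrow> comb (\<lambda>x. if x = \<alpha> then k else 0) = k *s \<alpha>"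
  unfolding comb_def using finite_B
  by (subst sum.remove[of B \<alpha>]) (auto intro!: sum.neutral)

lemma comb_0D: "comb c = 0 \<Longrightarrow> \<alpha> \<in> B \<Longrightarrow> c \<alpha> = 0"
  using is_base by (auto simp: is_base_def comb_def)

lemma comb_eqD: "comb c = comb c' \<Longrightarrow> \<alpha> \<in> B \<Longrightarrow> c \<alpha> = c' \<alpha>"
  using comb_0D[of "\<lambda>x. c x - c' x"] by (simp add: comb_diff)

lemma pos_roots_iff: "\<beta> \<in> P \<longleftrightarrow> \<beta> \<in> R \<and> (\<exists>c. \<beta> = comb c \<and> nonneg c)"
  by (auto simp: pos_roots_def comb_def)

lemma P_root: "\<beta> \<in> P \<Longrightarrow> \<beta> \<in> R"
  by (simp add: pos_roots_iff)

lemma finite_P: "finite P"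
  using finite_R P_root by (meson finite_subset subsetI)

lemma B_pos: "\<alpha> \<in> B \<Longrightarrow> \<alpha> \<in> P"
  using comb_single[of \<alpha> 1] B_root by (auto simp: pos_roots_iff intro!: exI[of _ "\<lambda>x. if x = \<alpha> then 1 else 0"])

lemma pos_or_neg:
  assumes "\<beta> \<in> R"
  shows "\<beta> \<in> P \<or> - \<beta> \<in> P"
proof -
  obtain c where c: "\<beta> = comb c" "nonneg c \<or> (\<forall>\<alpha>\<in>B. c \<alpha> \<le> 0)"
    using is_base assms unfolding is_base_def comb_def by blast
  from c(2) show ?thesis
  proof
    assume "nonneg c"
    then show ?thesis using c(1) assms by (auto simp: pos_roots_iff)
  next
    assume "\<forall>\<alpha>\<in>B. c \<alpha> \<le> 0"
    then have "- \<beta> = comb (\<lambda>x. - c x)" "\<forall>\<alpha>\<in>B. - c \<alpha> \<ge> 0" using c(1) by (auto simp: comb_uminus)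
    then have "- \<beta> \<in> P" unfolding pos_roots_iff using root_uminus[OF assms] by blast
    then show ?thesis ..
  qed
qed

lemma not_pos_and_neg:
  assumes "\<beta> \<in> P" "- \<beta> \<in> P"
  shows False
proof -
  obtain c c' where c: "\<beta> = comb c" "nonneg c" and c': "- \<beta> = comb c'" "nonneg c'"
    using assms by (auto simp: pos_roots_iff)
  have "comb (\<lambda>x. c x + c' x) = 0" unfolding comb_add c(1)[symmetric] c'(1)[symmetric] by simp
  then have "\<forall>\<alpha>\<in>B. c \<alpha> + c' \<alpha> = 0" using comb_0D by blast
  then have "\<forall>\<alpha>\<in>B. c \<alpha> = 0" using c c' by (meson add_nonneg_eq_0_iff)
  then have "\<beta> = 0" unfolding c(1) comb_def by simp
  then show False using assms(1) P_root root_nonzero by blast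
qed

lemma neg_iff: "\<beta> \<in> R \<Longrightarrow> - \<beta> \<in> P \<longleftrightarrow> \<beta> \<notin> P"
  using pos_or_neg not_pos_and_neg by blast

text \<open>If the image were negative, \<beta> minus its image would be a sum of two nonnegative
  combinations and a multiple of \<alpha>. Then \<beta> involves no other simple root, and being
  proportional to \<alpha> and positive it equals \<alpha>.\<close>

lemma simple_reflection_pos:
  assumes "\<alpha> \<in> B" "\<beta> \<in> P" "\<beta> \<noteq> \<alpha>"
  shows "s \<alpha> *v \<beta> \<in> P"
proof (rule ccontr)
  define n where "n = pairing \<beta> (cv \<alpha>)"
  assume neg: "s \<alpha> *v \<beta> \<notin> P"
  have "s \<alpha> *v \<beta> \<in> R" using assms B_root P_root reflection_root by blast
  then have "- (s \<alpha> *v \<beta>) \<in> P" using neg pos_or_neg by blast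
  then obtain c' where c': "- (s \<alpha> *v \<beta>) = comb c'" "nonneg c'"
    by (auto simp: pos_roots_iff)
  obtain c where c: "\<beta> = comb c" "nonneg c" using assms by (auto simp: pos_roots_iff)
  have "comb (\<lambda>x. c x + c' x) = n *s \<alpha>"
    unfolding comb_add c(1)[symmetric] c'(1)[symmetric] reflection_apply n_def by simp
  then have eq: "comb (\<lambda>x. c x + c' x) = comb (\<lambda>x. if x = \<alpha> then n else 0)"
    by (simp add: comb_single assms)
  have z: "c x = 0" if "x \<in> B" "x \<noteq> \<alpha>" for x
    using comb_eqD[OF eq that(1)] that c c' by (simp add: add_nonneg_eq_0_iff)
  have "comb c = comb (\<lambda>x. if x = \<alpha> then c \<alpha> else 0)"
    unfolding comb_def by (rule sum.cong) (auto simp: z)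
  then have b: "\<beta> = c \<alpha> *s \<alpha>" using c(1) assms comb_single by simp
  have "c \<alpha> \<noteq> 0" using b root_nonzero P_root assms by force
  then have "\<beta> = \<alpha> \<or> \<beta> = - \<alpha>"
    using proportional_roots[of \<beta> \<alpha> 1 "c \<alpha>"] b assms P_root B_root by simp
  then show False using assms B_pos not_pos_and_neg by blast
qed

lemma simple_reflection_bij: "\<alpha> \<in> B \<Longrightarrow> bij_betw (\<lambda>\<beta>. s \<alpha> *v \<beta>) (P - {\<alpha>}) (P - {\<alpha>})"
proof (rule bij_betw_byWitness[where f' = "\<lambda>\<beta>. s \<alpha> *v \<beta>"])
  assume a: "\<alpha> \<in> B"
  have "s \<alpha> *v \<beta> \<noteq> \<alpha>" if "\<beta> \<in> P" for \<beta>
  proof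
    assume "s \<alpha> *v \<beta> = \<alpha>"
    then have "\<beta> = - \<alpha>" using reflection_twice[OF B_root[OF a], of \<beta>] reflection_self[OF B_root[OF a]] by simp
    then show False using that B_pos[OF a] not_pos_and_neg by blast
  qed
  then show "(\<lambda>\<beta>. s \<alpha> *v \<beta>) ` (P - {\<alpha>}) \<subseteq> P - {\<alpha>}" "(\<lambda>\<beta>. s \<alpha> *v \<beta>) ` (P - {\<alpha>}) \<subseteq> P - {\<alpha>}"
    using simple_reflection_pos[OF a] by auto
qed (simp_all add: reflection_twice B_root)

section \<open>Words in simple reflections and generation of the Weyl group\<close>

definition wprod :: "(int^'n) list \<Rightarrow> 'n wmat" where
  "wprod ws = foldr (\<lambda>\<alpha> u. s \<alpha> ** u) ws (mat 1)"

lemma wprod_Nil [simp]: "wprod [] = mat 1"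
  and wprod_Cons [simp]: "wprod (\<alpha> # ws) = s \<alpha> ** wprod ws"
  by (simp_all add: wprod_def)

lemma wprod_append: "wprod (us @ vs) = wprod us ** wprod vs"
  by (induction us) (simp_all add: matrix_mul_assoc)

lemma wprod_in_W: "set ws \<subseteq> B \<Longrightarrow> wprod ws \<in> W"
  by (induction ws) (auto simp: one_in_W intro: W_mult simple_in_W)

lemma wprod_rev: "set ws \<subseteq> B \<Longrightarrow> wprod (rev ws) = matrix_inv (wprod ws)"
proof (induction ws)
  case Nil show ?case by (simp add: matrix_inv_eqI)
next
  case (Cons \<alpha> ws)
  then show ?case
    by (simp add: wprod_append W_inv_mult reflection_in_W B_root wprod_in_W reflection_inv)
qed

lemma word_of_iff: "word_of D w ws \<longleftrightarrow> set ws \<subseteq> B \<and> w = wprod ws"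
  by (simp add: word_of_def wprod_def)

text \<open>The Weyl-invariant symmetric form given by the sum over all coroots. It may be
  degenerate on the character lattice, but it is positive at each root \<alpha>, where the term of
  \<alpha> itself contributes 4.\<close>

definition form :: "int^'n \<Rightarrow> int^'n \<Rightarrow> int" where
  "form x y = (\<Sum>\<delta>\<in>R. pairing x (cv \<delta>) * pairing y (cv \<delta>))"

lemma form_reflection:
  assumes "\<alpha> \<in> R"
  shows "form (s \<alpha> *v x) (s \<alpha> *v y) = form x y"
proof -
  have "bij_betw (\<lambda>\<delta>. s \<alpha> *v \<delta>) R R"
    by (rule bij_betw_byWitness[where f' = "\<lambda>\<delta>. s \<alpha> *v \<delta>"])
      (use assms in \<open>auto simp: reflection_twice reflection_root\<close>)
  from sum.reindex_bij_betw[OF this]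
  have "form (s \<alpha> *v x) (s \<alpha> *v y) =
      (\<Sum>\<delta>\<in>R. pairing (s \<alpha> *v x) (cv (s \<alpha> *v \<delta>)) * pairing (s \<alpha> *v y) (cv (s \<alpha> *v \<delta>)))"
    unfolding form_def by (rule sym)
  also have "\<dots> = form x y"
    unfolding form_def by (rule sum.cong) (simp_all add: W_pairing reflection_in_W assms)
  finally show ?thesis .
qed

lemma form_root_pos: "\<alpha> \<in> R \<Longrightarrow> form \<alpha> \<alpha> > 0"
  unfolding form_def by (rule sum_pos2[OF finite_R]) (auto simp: pairing_self)

text \<open>Invariance under s_\<alpha>, which negates \<alpha>. Up to a positive factor this
  identifies the coroot with the form, so that signs of coroot pairings can be read off from a
  positive form.\<close>

lemma form_root:
  assumes "\<alpha> \<in> R"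
  shows "2 * form x \<alpha> = pairing x (cv \<alpha>) * form \<alpha> \<alpha>"
proof -
  have lin: "form (x - k *s y) (- z) = - form x z + k * form y z" for k x y z
    unfolding form_def by (simp add: pairing_linear algebra_simps sum.distrib sum_subtractf sum_negf sum_distrib_left)
  have "form x \<alpha> = form (s \<alpha> *v x) (s \<alpha> *v \<alpha>)" using form_reflection[OF assms] by simp
  also have "\<dots> = - form x \<alpha> + pairing x (cv \<alpha>) * form \<alpha> \<alpha>"
    unfolding reflection_self[OF assms] unfolding reflection_apply lin ..
  finally show ?thesis by simp
qed

text \<open>Otherwise expanding one argument of \<open>form \<beta> \<beta>\<close> in simple roots
  would exhibit it as a sum of nonpositive terms.\<close>

lemma simple_with_positive_pairing:
  assumes "\<beta> \<in> P"
  shows "\<exists>\<alpha>\<in>B. pairing \<beta> (cv \<alpha>) > 0"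
proof (rule ccontr)
  assume "\<not> ?thesis"
  then have np: "pairing \<beta> (cv \<alpha>) \<le> 0" if "\<alpha> \<in> B" for \<alpha> using that by force
  have le: "form \<beta> \<alpha> \<le> 0" if "\<alpha> \<in> B" for \<alpha>
  proof -
    have "2 * form \<beta> \<alpha> \<le> 0"
      unfolding form_root[OF B_root[OF that]]
      using np[OF that] form_root_pos[OF B_root[OF that]] by (simp add: mult_nonpos_nonneg)
    then show ?thesis by simp
  qed
  obtain c where c: "\<beta> = comb c" "nonneg c" using assms by (auto simp: pos_roots_iff)
  have "form \<beta> \<beta> = (\<Sum>\<delta>\<in>R. pairing \<beta> (cv \<delta>) * (\<Sum>\<alpha>\<in>B. c \<alpha> * pairing \<alpha> (cv \<delta>)))"
    unfolding form_def by (subst (2) c(1)) (simp add: comb_def pairing_sum_left pairing_linear)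
  also have "\<dots> = (\<Sum>\<alpha>\<in>B. \<Sum>\<delta>\<in>R. c \<alpha> * (pairing \<beta> (cv \<delta>) * pairing \<alpha> (cv \<delta>)))"
    by (subst sum.swap) (simp add: sum_distrib_left mult_ac)
  also have "\<dots> = (\<Sum>\<alpha>\<in>B. c \<alpha> * form \<beta> \<alpha>)" by (simp add: form_def sum_distrib_left)
  also have "\<dots> \<le> 0" using c le by (intro sum_nonpos mult_nonneg_nonpos) auto
  finally show False using form_root_pos[OF P_root[OF assms]] by simp
qed

text \<open>Induction on the height, the sum of the coefficients: a simple reflection with positive
  pairing lowers it, and the new coefficients are still nonnegative because the reflected root is
  positive and coefficients are unique.\<close>

lemma pos_root_conjugate_simple:
  assumes "\<beta> \<in> P"
  shows "\<exists>ws \<alpha>. set ws \<subseteq> B \<and> \<alpha> \<in> B \<and> \<beta> = wprod ws *v \<alpha>"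
proof -
  have "\<beta> \<in> P \<Longrightarrow> \<beta> = comb c \<Longrightarrow> nonneg c \<Longrightarrow> ?thesis" for c
  proof (induction "nat (sum c B)" arbitrary: c \<beta> rule: less_induct)
    case (less c \<beta>)
    obtain \<alpha> where \<alpha>: "\<alpha> \<in> B" "pairing \<beta> (cv \<alpha>) > 0"
      using simple_with_positive_pairing[OF less.prems(1)] by blast
    show ?case
    proof (cases "\<beta> = \<alpha>")
      case True then show ?thesis using \<alpha> by (intro exI[of _ "[]"] exI[of _ \<alpha>]) simp
    next
      case False
      define n where "n = pairing \<beta> (cv \<alpha>)"
      define c' where "c' = (\<lambda>x. c x - (if x = \<alpha> then n else 0))"
      have pos: "s \<alpha> *v \<beta> \<in> P" by (rule simple_reflection_pos[OF \<alpha>(1) less.prems(1) False])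
      have eq: "s \<alpha> *v \<beta> = comb c'"
        unfolding c'_def comb_diff reflection_apply by (simp add: comb_single \<alpha> less.prems(2)[symmetric] n_def)
      obtain d where d: "s \<alpha> *v \<beta> = comb d" "nonneg d" using pos by (auto simp: pos_roots_iff)
      then have nn: "nonneg c'" using comb_eqD[of d c'] eq by metis
      have "sum c' B = sum c B - n"
        unfolding c'_def sum_subtractf using finite_B \<alpha> by simp
      moreover have "sum c' B \<ge> 0" using nn by (intro sum_nonneg) auto
      ultimately have "nat (sum c' B) < nat (sum c B)" using \<alpha> by (simp add: n_def)
      from less.hyps[OF this pos eq nn] obtain ws \<gamma>
        where ws: "set ws \<subseteq> B" "\<gamma> \<in> B" "s \<alpha> *v \<beta> = wprod ws *v \<gamma>" by blast
      have "\<beta> = s \<alpha> *v (s \<alpha> *v \<beta>)" using \<alpha> by (simp add: reflection_twice B_root)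
      also have "\<dots> = wprod (\<alpha> # ws) *v \<gamma>" by (simp add: ws(3) matrix_vector_mul_assoc)
      finally have "\<beta> = wprod (\<alpha> # ws) *v \<gamma>" .
      then show ?thesis using ws \<alpha> by (intro exI[of _ "\<alpha> # ws"] exI[of _ \<gamma>]) simp
    qed
  qed
  then show ?thesis using assms by (auto simp: pos_roots_iff)
qed

text \<open>The group is defined by the reflections in all roots, whereas words use simple ones.
  Writing \<beta> = w \<alpha> with \<alpha> simple makes the reflection in \<beta> the conjugate w
  s_\<alpha> w^(-1).\<close>

lemma reflection_is_wprod:
  assumes "\<beta> \<in> R"
  shows "\<exists>ws. set ws \<subseteq> B \<and> s \<beta> = wprod ws"
proof -
  have pos: "\<exists>ws. set ws \<subseteq> B \<and> s \<beta> = wprod ws" if "\<beta> \<in> P" for \<beta>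
  proof -
    obtain ws \<alpha> where ws: "set ws \<subseteq> B" "\<alpha> \<in> B" "\<beta> = wprod ws *v \<alpha>"
      using pos_root_conjugate_simple[OF \<open>\<beta> \<in> P\<close>] by blast
    note W = wprod_in_W[OF ws(1)]
    have "s \<beta> = s \<beta> ** wprod ws ** matrix_inv (wprod ws)" by (simp add: W_inv[OF W] flip: matrix_mul_assoc)
    also have "\<dots> = wprod ws ** s \<alpha> ** matrix_inv (wprod ws)"
      unfolding ws(3) reflection_W_root[OF W B_root[OF ws(2)]] ..
    also have "\<dots> = wprod (ws @ [\<alpha>] @ rev ws)" by (simp add: wprod_append wprod_rev[OF ws(1)] matrix_mul_assoc)
    finally show ?thesis using ws by (intro exI[of _ "ws @ [\<alpha>] @ rev ws"]) simp
  qed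
  show ?thesis
  proof (cases "\<beta> \<in> P")
    case False
    then show ?thesis using pos[of "- \<beta>"] pos_or_neg[OF assms] reflection_uminus[OF assms] by auto
  qed (rule pos)
qed

lemma W_is_wprod: "w \<in> W \<Longrightarrow> \<exists>ws. set ws \<subseteq> B \<and> w = wprod ws"
proof (induction rule: weyl.induct)
  case one show ?case by (intro exI[of _ "[]"]) simp
next
  case (step w \<alpha>)
  then obtain us vs where "set us \<subseteq> B" "w = wprod us" "set vs \<subseteq> B" "s \<alpha> = wprod vs"
    using reflection_is_wprod[OF step.hyps(2)] by blast
  then show ?case by (intro exI[of _ "vs @ us"]) (simp add: wprod_append)
qed

section \<open>Inversion sets, exchange and length\<close>

definition inversions :: "'n wmat \<Rightarrow> (int^'n) set" where
  "inversions x = {\<beta>\<in>P. matrix_inv x *v \<beta> \<notin> P}"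

lemma finite_inversions: "finite (inversions x)"
  using finite_P by (simp add: inversions_def)

text \<open>Inversions are defined through the inverse of x, so that multiplication on the right
  changes only one of them: s_\<alpha> permutes the positive roots other than \<alpha>, hence only
  the two roots x \<alpha> and -x \<alpha> can change status.\<close>

lemma inversions_mult_simple:
  assumes x: "x \<in> W" and \<alpha>: "\<alpha> \<in> B"
  shows "x *v \<alpha> \<in> P \<Longrightarrow> inversions (x ** s \<alpha>) = insert (x *v \<alpha>) (inversions x)"
    and "x *v \<alpha> \<in> P \<Longrightarrow> x *v \<alpha> \<notin> inversions x"
    and "x *v \<alpha> \<notin> P \<Longrightarrow> inversions (x ** s \<alpha>) = inversions x - {- (x *v \<alpha>)}"
    and "x *v \<alpha> \<notin> P \<Longrightarrow> - (x *v \<alpha>) \<in> inversions x"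
proof -
  note \<alpha>R = B_root[OF \<alpha>]
  have xs: "matrix_inv (x ** s \<alpha>) *v \<beta> = s \<alpha> *v (matrix_inv x *v \<beta>)" for \<beta>
    using x \<alpha>R by (simp add: W_inv_mult reflection_in_W reflection_inv matrix_vector_mul_assoc)
  have key: "s \<alpha> *v \<gamma> \<in> P \<longleftrightarrow> \<gamma> \<in> P" if "\<gamma> \<in> R" "\<gamma> \<noteq> \<alpha>" "\<gamma> \<noteq> - \<alpha>" for \<gamma>
  proof
    assume "\<gamma> \<in> P" then show "s \<alpha> *v \<gamma> \<in> P" using simple_reflection_pos[OF \<alpha>] that by blast
  next
    assume *: "s \<alpha> *v \<gamma> \<in> P"
    have "s \<alpha> *v \<gamma> \<noteq> \<alpha>"
    proof
      assume "s \<alpha> *v \<gamma> = \<alpha>"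
      then have "\<gamma> = - \<alpha>" using reflection_twice[OF \<alpha>R, of \<gamma>] reflection_self[OF \<alpha>R] by simp
      then show False using that by simp
    qed
    from simple_reflection_pos[OF \<alpha> * this] show "\<gamma> \<in> P" by (simp add: reflection_twice[OF \<alpha>R])
  qed
  have inj: "matrix_inv x *v \<beta> = \<alpha> \<longleftrightarrow> \<beta> = x *v \<alpha>" "matrix_inv x *v \<beta> = - \<alpha> \<longleftrightarrow> \<beta> = - (x *v \<alpha>)" for \<beta>
    using W_inv_apply[OF x] matrix_vector_minus by metis+
  have inR: "matrix_inv x *v \<beta> \<in> R" if "\<beta> \<in> P" for \<beta>
    using that x W_root W_inv(1) P_root by blast
  have na: "- \<alpha> \<notin> P" using not_pos_and_neg B_pos[OF \<alpha>] by blast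
  have s1: "s \<alpha> *v \<alpha> = - \<alpha>" "s \<alpha> *v (- \<alpha>) = \<alpha>"
    using reflection_self[OF \<alpha>R] by (simp_all add: matrix_vector_minus)
  have i1: "matrix_inv x *v (x *v \<alpha>) = \<alpha>" "matrix_inv x *v (- (x *v \<alpha>)) = - \<alpha>"
    using W_inv_apply[OF x] by (simp_all add: matrix_vector_minus)
  have mem: "\<beta> \<in> inversions (x ** s \<alpha>) \<longleftrightarrow> \<beta> \<in> inversions x" if "\<beta> \<noteq> x *v \<alpha>" "\<beta> \<noteq> - (x *v \<alpha>)" for \<beta>
    unfolding inversions_def xs using key[of "matrix_inv x *v \<beta>"] inR that inj by auto
  have a: "x *v \<alpha> \<in> inversions (x ** s \<alpha>) \<longleftrightarrow> x *v \<alpha> \<in> P" "x *v \<alpha> \<notin> inversions x"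
    "- (x *v \<alpha>) \<notin> inversions (x ** s \<alpha>)" "- (x *v \<alpha>) \<in> inversions x \<longleftrightarrow> - (x *v \<alpha>) \<in> P"
    unfolding inversions_def xs by (auto simp: i1 s1 na B_pos[OF \<alpha>])
  have xR: "x *v \<alpha> \<in> R" using W_root[OF x \<alpha>R] .
  show "x *v \<alpha> \<in> P \<Longrightarrow> inversions (x ** s \<alpha>) = insert (x *v \<alpha>) (inversions x)"
    using mem a neg_iff[OF xR] by (intro set_eqI) (metis insert_iff)
  show "x *v \<alpha> \<in> P \<Longrightarrow> x *v \<alpha> \<notin> inversions x" using a by blast
  show "x *v \<alpha> \<notin> P \<Longrightarrow> inversions (x ** s \<alpha>) = inversions x - {- (x *v \<alpha>)}"
    using mem a neg_iff[OF xR] by (intro set_eqI) (metis Diff_iff singletonD singletonI)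
  show "x *v \<alpha> \<notin> P \<Longrightarrow> - (x *v \<alpha>) \<in> inversions x"
    using a neg_iff[OF xR] by blast
qed

lemma card_inversions_pos:
  assumes "x \<in> W" "\<alpha> \<in> B" "x *v \<alpha> \<in> P"
  shows "card (inversions (x ** s \<alpha>)) = Suc (card (inversions x))"
  using inversions_mult_simple(1,2)[OF assms(1,2)] assms(3) by (simp add: finite_inversions)

lemma card_inversions_neg:
  assumes "x \<in> W" "\<alpha> \<in> B" "x *v \<alpha> \<notin> P"
  shows "Suc (card (inversions (x ** s \<alpha>))) = card (inversions x)"
  using inversions_mult_simple(3,4)[OF assms(1,2) assms(3)] card_Suc_Diff1[OF finite_inversions]
  by metis

lemma card_inversions_mult_le:
  assumes "x \<in> W" "\<alpha> \<in> B"
  shows "card (inversions (x ** s \<alpha>)) \<le> Suc (card (inversions x))"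
  using card_inversions_pos[OF assms] card_inversions_neg[OF assms] by linarith

lemma inversions_one [simp]: "inversions (mat 1) = {}"
proof -
  have "matrix_inv (mat 1 :: 'n wmat) = mat 1" by (rule matrix_inv_eqI) simp_all
  then show ?thesis by (simp add: inversions_def)
qed

text \<open>Follow \<alpha> through the word from the right. At the letter where it turns negative
  it must equal that letter \<beta>, and the conjugation rule for reflections then cancels this
  letter against s_\<alpha>.\<close>

lemma exchange:
  assumes "set ws \<subseteq> B" "\<alpha> \<in> B" "wprod ws *v \<alpha> \<notin> P"
  shows "\<exists>vs. set vs \<subseteq> B \<and> wprod vs = wprod ws ** s \<alpha> \<and> Suc (length vs) = length ws"
  using assms
proof (induction ws)
  case Nil then show ?case using B_pos by simp
next
  case (Cons \<beta> ws)
  show ?case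
  proof (cases "wprod ws *v \<alpha> \<in> P")
    case False
    then obtain vs where "set vs \<subseteq> B" "wprod vs = wprod ws ** s \<alpha>" "Suc (length vs) = length ws"
      using Cons by auto
    then show ?thesis using Cons.prems
      by (intro exI[of _ "\<beta> # vs"]) (simp add: matrix_mul_assoc)
  next
    case True
    have neg: "s \<beta> *v (wprod ws *v \<alpha>) \<notin> P" using Cons.prems by (simp add: matrix_vector_mul_assoc)
    have \<beta>: "\<beta> \<in> B" using Cons.prems by simp
    have "wprod ws *v \<alpha> = \<beta>" using simple_reflection_pos[OF \<beta> True] neg by blast
    then have "s \<beta> ** wprod ws = wprod ws ** s \<alpha>"
      using reflection_W_root[of "wprod ws" \<alpha>] Cons.prems wprod_in_W B_root by auto
    then have "wprod (\<beta> # ws) ** s \<alpha> = wprod ws ** (s \<alpha> ** s \<alpha>)" by (simp add: matrix_mul_assoc)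
    then have "wprod (\<beta> # ws) ** s \<alpha> = wprod ws" using Cons.prems by (simp add: reflection_involution B_root)
    then show ?thesis using Cons.prems by (intro exI[of _ ws]) simp
  qed
qed

text \<open>In a word of minimal length no letter \<alpha> is sent to a negative root by the letters
  before it, since exchange would shorten the word; so every letter creates one new
  inversion.\<close>

lemma card_inversions_minimal_word:
  assumes "set ws \<subseteq> B" "\<And>vs. set vs \<subseteq> B \<Longrightarrow> wprod vs = wprod ws \<Longrightarrow> length ws \<le> length vs"
  shows "card (inversions (wprod ws)) = length ws"
  using assms
proof (induction ws rule: rev_induct)
  case (snoc \<alpha> ws)
  have ws: "set ws \<subseteq> B" "\<alpha> \<in> B" using snoc.prems by auto
  have "length ws \<le> length vs" if "set vs \<subseteq> B" "wprod vs = wprod ws" for vs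
    using snoc.prems(2)[of "vs @ [\<alpha>]"] that ws by (simp add: wprod_append)
  then have IH: "card (inversions (wprod ws)) = length ws" using snoc.IH ws by blast
  have "wprod ws *v \<alpha> \<in> P"
  proof (rule ccontr)
    assume "wprod ws *v \<alpha> \<notin> P"
    from exchange[OF ws this] obtain vs
      where "set vs \<subseteq> B" "wprod vs = wprod ws ** s \<alpha>" "Suc (length vs) = length ws" by blast
    then show False using snoc.prems(2)[of vs] by (simp add: wprod_append)
  qed
  then show ?case using card_inversions_pos[OF wprod_in_W[OF ws(1)] ws(2)] IH by (simp add: wprod_append)
qed simp

lemma
  assumes "w \<in> W"
  shows reduced_word_exists: "\<exists>ws. reduced_word D w ws"
    and len_eq: "len D w = card (inversions w)"
proof -
  obtain us where us: "word_of D w us" using W_is_wprod[OF assms] by (auto simp: word_of_iff)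
  then have ex: "\<exists>ws. word_of D w ws \<and> length ws = length us" by blast
  have "\<exists>ws. word_of D w ws \<and> length ws = len D w"
    unfolding len_def by (rule LeastI[of "\<lambda>k. \<exists>ws. word_of D w ws \<and> length ws = k", OF ex])
  then obtain ws where ws: "word_of D w ws" "length ws = len D w" by blast
  then show "\<exists>ws. reduced_word D w ws" by (auto simp: reduced_word_def)
  have "length ws \<le> length vs" if "set vs \<subseteq> B" "wprod vs = wprod ws" for vs
    unfolding ws(2) len_def using that ws(1) by (intro Least_le) (auto simp: word_of_iff)
  then show "len D w = card (inversions w)"
    using card_inversions_minimal_word[of ws] ws by (auto simp: word_of_iff)
qed

text \<open>Every element has a reduced word whose length is its number of inversions, hence at most
  the number of positive roots, and there are finitely many such words.\<close>

lemma finite_W: "finite W"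
proof -
  have "w \<in> wprod ` {ws. set ws \<subseteq> B \<and> length ws \<le> card P}" if w: "w \<in> W" for w
  proof -
    obtain ws where ws: "reduced_word D w ws" using reduced_word_exists[OF w] by blast
    have "card (inversions w) \<le> card P" by (intro card_mono finite_P) (auto simp: inversions_def)
    then show ?thesis using ws len_eq[OF w] by (auto simp: reduced_word_def word_of_iff)
  qed
  then show ?thesis
    using finite_lists_length_le[OF finite_B] by (meson finite_imageI finite_subset subsetI)
qed

text \<open>Extends the statement that w_0 makes the simple roots negative to all positive
  roots.\<close>

lemma nonneg_cone_sum:
  assumes "\<And>i. i \<in> I \<Longrightarrow> \<exists>c. f i = comb c \<and> nonneg c"
    and "\<And>i. i \<in> I \<Longrightarrow> k i \<ge> (0::int)"
  shows "\<exists>c. (\<Sum>i\<in>I. k i *s f i) = comb c \<and> nonneg c"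
proof -
  obtain c where c: "\<And>i. i \<in> I \<Longrightarrow> f i = comb (c i)" "\<And>i \<alpha>. i \<in> I \<Longrightarrow> \<alpha> \<in> B \<Longrightarrow> c i \<alpha> \<ge> 0"
    using assms(1) by metis
  have "(\<Sum>i\<in>I. k i *s f i) = (\<Sum>i\<in>I. \<Sum>\<alpha>\<in>B. (k i * c i \<alpha>) *s \<alpha>)"
    by (rule sum.cong) (auto simp: c(1) comb_def vec_eq_iff sum_distrib_left mult_ac)
  also have "\<dots> = comb (\<lambda>\<alpha>. \<Sum>i\<in>I. k i * c i \<alpha>)"
    by (subst sum.swap) (simp add: comb_def vec_eq_iff sum_distrib_right)
  finally show ?thesis using c(2) assms(2)
    by (intro exI[of _ "\<lambda>\<alpha>. \<Sum>i\<in>I. k i * c i \<alpha>"]) (auto intro!: sum_nonneg)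
qed

section \<open>The longest element and the sum of the positive roots\<close>

abbreviation "w0 \<equiv> longest D"

text \<open>A maximiser exists because lengths are bounded by the number of positive roots. If w_0
  \<alpha> were positive for a simple \<alpha>, then w_0 s_\<alpha> would be longer; so w_0 makes
  all simple, hence all positive roots negative.\<close>

lemma longest_in_W: "w0 \<in> W" and inversions_longest: "inversions w0 = P"
proof -
  have bd: "\<forall>y. y \<in> W \<longrightarrow> len D y < Suc (card P)"
    using len_eq card_mono[OF finite_P] by (auto simp: inversions_def less_Suc_eq_le)
  have lm: "w0 \<in> W \<and> (\<forall>y. y \<in> W \<longrightarrow> len D y \<le> len D w0)"
    unfolding longest_def by (rule arg_max_nat_lemma[OF one_in_W bd])
  then show w0_W: "w0 \<in> W" ..
  have simple: "- (w0 *v \<alpha>) \<in> P" if "\<alpha> \<in> B" for \<alpha>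
  proof (rule ccontr)
    assume "\<not> ?thesis"
    then have "w0 *v \<alpha> \<in> P" using neg_iff W_root[OF w0_W B_root[OF that]] by blast
    from card_inversions_pos[OF w0_W that this] have "len D (w0 ** s \<alpha>) = Suc (len D w0)"
      using len_eq w0_W W_mult simple_in_W that by simp
    moreover have "w0 ** s \<alpha> \<in> W" using w0_W W_mult simple_in_W that by blast
    ultimately show False using lm by fastforce
  qed
  have neg: "- (w0 *v \<beta>) \<in> P" if \<beta>: "\<beta> \<in> P" for \<beta>
  proof -
    obtain c where c: "\<beta> = comb c" "nonneg c" using \<beta> by (auto simp: pos_roots_iff)
    have "- (w0 *v \<beta>) = (\<Sum>\<alpha>\<in>B. c \<alpha> *s (- (w0 *v \<alpha>)))"
      unfolding c(1) comb_def by (simp add: matrix_vector_sum matrix_vector_scale vec_eq_iff sum_negf)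
    moreover have "\<exists>d. (\<Sum>\<alpha>\<in>B. c \<alpha> *s (- (w0 *v \<alpha>))) = comb d \<and> nonneg d"
      by (rule nonneg_cone_sum) (use simple c in \<open>auto simp: pos_roots_iff\<close>)
    moreover have "- (w0 *v \<beta>) \<in> R" using that W_root[OF w0_W] root_uminus P_root by blast
    ultimately show ?thesis by (auto simp: pos_roots_iff)
  qed
  show "inversions w0 = P"
  proof -
    have "matrix_inv w0 *v \<beta> \<notin> P" if "\<beta> \<in> P" for \<beta>
      using neg[of "matrix_inv w0 *v \<beta>"] that not_pos_and_neg by (auto simp: W_inv_apply[OF w0_W])
    then show ?thesis by (auto simp: inversions_def)
  qed
qed

lemma longest_pos: "\<beta> \<in> P \<Longrightarrow> - (w0 *v \<beta>) \<in> P"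
proof -
  assume "\<beta> \<in> P"
  then have "w0 *v \<beta> \<in> R" using W_root longest_in_W P_root by blast
  moreover have "w0 *v \<beta> \<notin> P"
  proof
    assume "w0 *v \<beta> \<in> P"
    then have "w0 *v \<beta> \<in> inversions w0" by (simp add: inversions_longest)
    then show False using \<open>\<beta> \<in> P\<close> by (simp add: inversions_def W_inv_apply[OF longest_in_W])
  qed
  ultimately show ?thesis using neg_iff by blast
qed

lemma longest_bij: "bij_betw (\<lambda>\<beta>. - (w0 *v \<beta>)) P P"
proof -
  have inj: "inj_on (\<lambda>\<beta>. - (w0 *v \<beta>)) P"
    by (rule inj_onI) (simp add: W_apply_cancel[OF longest_in_W])
  moreover have sub: "(\<lambda>\<beta>. - (w0 *v \<beta>)) ` P \<subseteq> P" using longest_pos by auto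
  ultimately show ?thesis unfolding bij_betw_def using endo_inj_surj[OF finite_P sub inj] by blast
qed

text \<open>Twice \<rho>, because \<rho> itself need not lie in the character lattice; the half sum
  is formed later over the complex numbers.\<close>

definition two_rho :: "int^'n" where
  "two_rho = \<Sum>P"

lemma simple_reflection_two_rho: "\<alpha> \<in> B \<Longrightarrow> s \<alpha> *v two_rho = two_rho - 2 *s \<alpha>"
proof -
  assume \<alpha>: "\<alpha> \<in> B"
  define \<rho>' where "\<rho>' = \<Sum>(P - {\<alpha>})"
  have eq: "two_rho = \<alpha> + \<rho>'"
    unfolding two_rho_def \<rho>'_def using B_pos[OF \<alpha>] finite_P by (simp add: sum.remove)
  have "s \<alpha> *v \<rho>' = (\<Sum>\<beta>\<in>P - {\<alpha>}. s \<alpha> *v \<beta>)" by (simp add: \<rho>'_def matrix_vector_sum)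
  also have "\<dots> = \<rho>'"
    unfolding \<rho>'_def using sum.reindex_bij_betw[OF simple_reflection_bij[OF \<alpha>], of "\<lambda>x. x"] by simp
  finally show ?thesis
    by (simp add: eq matrix_vector_right_distrib reflection_self B_root \<alpha> vec_eq_iff)
qed

lemma longest_two_rho: "w0 *v two_rho = - two_rho"
proof -
  have "- (w0 *v two_rho) = (\<Sum>\<beta>\<in>P. - (w0 *v \<beta>))"
    by (simp add: two_rho_def matrix_vector_sum sum_negf)
  also have "\<dots> = two_rho"
    unfolding two_rho_def using sum.reindex_bij_betw[OF longest_bij, of "\<lambda>x. x"] by simp
  finally show ?thesis by (metis minus_minus)
qed

end

section \<open>Meromorphic functions and linear substitutions\<close>

lemma mero_rel_refl_iff: "mero_rel f f \<longleftrightarrow> is_mero f"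
  by (simp add: mero_rel_def agree_refl)

lemma is_mero_rep: "is_mero (rep_mero a)"
  using Quotient_rep_reflp[OF Quotient_mero] by (simp add: mero_rel_refl_iff)

lemma abs_rep_mero: "abs_mero (rep_mero a) = a"
  by (rule Quotient_abs_rep[OF Quotient_mero])

lemma abs_mero_eqI: "is_mero f \<Longrightarrow> is_mero g \<Longrightarrow> agree f g \<Longrightarrow> abs_mero f = abs_mero g"
  by (rule Quotient_rel_abs[OF Quotient_mero]) (simp add: mero_rel_def)

lemma agree_rep_abs: "is_mero f \<Longrightarrow> agree (rep_mero (abs_mero f)) f"
  using Quotient_rep_abs[OF Quotient_mero, of f] by (simp add: mero_rel_refl_iff) (simp add: mero_rel_def)

lemma mero_cases: obtains f where "is_mero f" "a = abs_mero f"
  using is_mero_rep abs_rep_mero by metis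

lemma abs_mero_add: "is_mero f \<Longrightarrow> is_mero g \<Longrightarrow> abs_mero (\<lambda>x. f x + g x) = abs_mero f + abs_mero g"
  by (simp add: plus_mero.abs_eq mero_rel_refl_iff)

lemma abs_mero_mult: "is_mero f \<Longrightarrow> is_mero g \<Longrightarrow> abs_mero (\<lambda>x. f x * g x) = abs_mero f * abs_mero g"
  by (simp add: times_mero.abs_eq mero_rel_refl_iff)

lemma abs_mero_divide: "is_mero f \<Longrightarrow> is_mero g \<Longrightarrow> abs_mero (\<lambda>x. f x / g x) = abs_mero f / abs_mero g"
  by (simp add: divide_mero.abs_eq mero_rel_refl_iff)

lemma abs_mero_uminus: "is_mero f \<Longrightarrow> abs_mero (\<lambda>x. - f x) = - abs_mero f"
  by (simp add: uminus_mero.abs_eq mero_rel_refl_iff)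

lemma abs_mero_0: "abs_mero (\<lambda>x. 0) = 0"
  by (simp add: zero_mero_def)

lemma abs_mero_1: "abs_mero (\<lambda>x. 1) = 1"
  by (simp add: one_mero_def)

lemma is_mero_prod: "(\<And>i. i \<in> I \<Longrightarrow> is_mero (f i)) \<Longrightarrow> is_mero (\<lambda>x. \<Prod>i\<in>I. f i x)"
  by (induction I rule: infinite_finite_induct) (simp_all add: is_mero_const is_mero_mult)

lemma abs_mero_prod:
  "(\<And>i. i \<in> I \<Longrightarrow> is_mero (f i)) \<Longrightarrow> abs_mero (\<lambda>x. \<Prod>i\<in>I. f i x) = (\<Prod>i\<in>I. abs_mero (f i))"
  by (induction I rule: infinite_finite_induct)
    (simp_all add: abs_mero_1 abs_mero_mult is_mero_prod)

lemma holo_on_UNIV_is_mero: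
  fixes f :: "'n::finite pt \<Rightarrow> complex"
  assumes "holo_on UNIV f"
  shows "is_mero f"
proof (rule is_meroI)
  fix p :: "'n pt"
  show "\<exists>r>0. \<exists>g h. holo_on (ball p r) g \<and> holo_on (ball p r) h \<and>
        (\<exists>x\<in>ball p r. h x \<noteq> 0) \<and> (\<forall>x\<in>ball p r. h x \<noteq> 0 \<longrightarrow> f x = g x / h x)"
  proof (rule local_quotientI[OF zero_less_one holo_on_subset[OF assms] holo_on_const[of _ 1]])
    show "\<exists>x\<in>ball p 1. (1::complex) \<noteq> 0" by (rule bexI[of _ p]) simp_all
  qed simp_all
qed

text \<open>By continuity \<open>f\<close> is nonzero on a nonempty open set, which meets every
  dense set on which it could agree with 0.\<close>

lemma abs_mero_nonzeroI:
  assumes hol: "holo_on UNIV f" and nz: "f p \<noteq> 0"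
  shows "abs_mero f \<noteq> 0"
proof
  assume "abs_mero f = 0"
  then have "abs_mero f = abs_mero (\<lambda>x. 0)" by (simp add: abs_mero_0)
  then have "mero_rel f (\<lambda>x. 0)"
    using Quotient_rel[OF Quotient_mero, of f "\<lambda>x. 0"] holo_on_UNIV_is_mero[OF hol] is_mero_const
    by (auto simp: mero_rel_refl_iff)
  then obtain S where S: "open S" "closure S = UNIV" "\<forall>x\<in>S. f x = 0"
    by (auto simp: mero_rel_def agree_def)
  have "open (f -` (- {0}))"
    by (intro open_vimage) (use holo_on_continuous_on[OF hol] in auto)
  moreover have "f -` (- {0}) \<inter> closure S \<noteq> {}" using nz S(2) by auto
  ultimately have "f -` (- {0}) \<inter> S \<noteq> {}" by (simp add: open_Int_closure_eq_empty)
  then show False using S(3) by auto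
qed

lemma abs_mero_nonzeroD:
  assumes "abs_mero f \<noteq> 0"
  shows "\<exists>p. f p \<noteq> 0"
proof (rule ccontr)
  assume "\<not> ?thesis"
  then have "f = (\<lambda>x. 0)" by auto
  then have "abs_mero f = 0" by (simp add: abs_mero_0)
  then show False using assms by simp
qed

subsection \<open>Linear substitutions\<close>

text \<open>Both Weyl group actions are substitutions of this form, \<open>act\<close> with
  \<open>C = mat 1\<close> and \<open>dyn_act\<close> with \<open>A = mat 1\<close>; that the
  actions commute is then visible.\<close>

definition block :: "complex^'n^'n \<Rightarrow> complex^'n^'n \<Rightarrow> 'n::finite pt \<Rightarrow> 'n pt" where
  "block A C p = (A *v fst p, C *v snd p)"

lemma block_compose: "block A C (block A' C' p) = block (A ** A') (C ** C') p"
  by (simp add: block_def matrix_vector_mul_assoc)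

lemma bounded_linear_block: "bounded_linear (block A C)"
proof -
  have "linear (block A C)"
    by (rule linearI)
      (auto simp: block_def matrix_vector_right_distrib vec_eq_iff matrix_vector_mult_def
        scaleR_sum_right sum.distrib algebra_simps)
  then show ?thesis by (simp add: linear_conv_bounded_linear)
qed

lemma block_cscale: "block A C (cscale c p) = cscale c (block A C p)"
  by (simp add: block_def cscale_def matrix_vector_scale)

lemma continuous_block: "continuous_on S (block A C)"
  by (rule bounded_linear.continuous_on[OF bounded_linear_block continuous_on_id])

lemma holo_on_block:
  assumes f: "holo_on U f" and V: "\<And>p. p \<in> V \<Longrightarrow> block A C p \<in> U"
  shows "holo_on V (\<lambda>p. f (block A C p))"
  unfolding holo_on_def
proof
  fix p assume "p \<in> V"
  then obtain f' where f': "(f has_derivative f') (at (block A C p))" "\<forall>c v. f' (cscale c v) = c * f' v"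
    using f V unfolding holo_on_def by blast
  have "(block A C has_derivative block A C) (at p)"
    by (rule bounded_linear_imp_has_derivative[OF bounded_linear_block])
  from diff_chain_at[OF this f'(1)]
  show "\<exists>k. ((\<lambda>p. f (block A C p)) has_derivative k) (at p) \<and> (\<forall>c v. k (cscale c v) = c * k v)"
    using f'(2) by (intro exI[of _ "f' \<circ> block A C"]) (simp add: o_def block_cscale del: split_paired_All)
qed

text \<open>Local quotients are pulled back. A denominator does not become identically zero, because
  an invertible linear map sends a ball to an open set and the identity theorem would make the
  original denominator vanish.\<close>

lemma is_mero_block:
  assumes f: "is_mero f" and inv: "A ** A' = mat 1" "C ** C' = mat 1"
  shows "is_mero (\<lambda>p. f (block A C p))"
proof (rule is_meroI)
  fix p
  let ?L = "block A C" and ?M = "block A' C'"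
  have L_of_M: "?L (?M x) = x" for x unfolding block_compose by (simp add: inv) (simp add: block_def)
  have M_of_L: "?M (?L x) = x" for x
  proof -
    have "A' ** A = mat 1" "C' ** C = mat 1" using inv matrix_left_right_inverse by blast+
    then show ?thesis unfolding block_compose by simp (simp add: block_def)
  qed
  obtain r g h where *: "r > 0" "holo_on (ball (?L p) r) g" "holo_on (ball (?L p) r) h"
    "\<exists>x\<in>ball (?L p) r. h x \<noteq> 0" "\<forall>x\<in>ball (?L p) r. h x \<noteq> 0 \<longrightarrow> f x = g x / h x"
    by (rule is_meroE[OF f, of "?L p"])
  have "open (?L -` ball (?L p) r)" by (intro open_vimage continuous_block) simp
  moreover have "p \<in> ?L -` ball (?L p) r" using *(1) by simp
  ultimately obtain e where e: "e > 0" "ball p e \<subseteq> ?L -` ball (?L p) r"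
    using open_contains_ball by blast
  have sub: "?L x \<in> ball (?L p) r" if "x \<in> ball p e" for x using e(2) that by blast
  show "\<exists>r>0. \<exists>g h. holo_on (ball p r) g \<and> holo_on (ball p r) h \<and>
        (\<exists>x\<in>ball p r. h x \<noteq> 0) \<and> (\<forall>x\<in>ball p r. h x \<noteq> 0 \<longrightarrow> f (?L x) = g x / h x)"
  proof (rule local_quotientI[OF e(1) holo_on_block[OF *(2) sub] holo_on_block[OF *(3) sub]])
    show "\<exists>x\<in>ball p e. h (?L x) \<noteq> 0"
    proof (rule ccontr)
      assume A: "\<not> ?thesis"
      let ?V = "?M -` ball p e"
      have "h x = 0" if "x \<in> ball (?L p) r" for x
      proof (rule holo_on_identity[OF *(3) _ _ _ _ that])
        show "open ?V" by (intro open_vimage continuous_block) simp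
        show "?V \<subseteq> ball (?L p) r" using sub L_of_M by (metis subsetI vimageE)
        show "?V \<noteq> {}" using e(1) M_of_L[of p] by (metis centre_in_ball empty_iff vimageI)
        show "h x = 0" if "x \<in> ?V" for x using A that L_of_M by (metis vimageE)
      qed
      then show False using *(4) by blast
    qed
  qed (use *(5) sub in auto)
qed

lemma agree_block:
  assumes "agree f g" and inv: "A ** A' = mat 1" "C ** C' = mat 1"
  shows "agree (\<lambda>p. f (block A C p)) (\<lambda>p. g (block A C p))"
proof -
  let ?L = "block A C" and ?M = "block A' C'"
  have M_of_L: "?M (?L x) = x" for x
  proof -
    have "A' ** A = mat 1" "C' ** C = mat 1" using inv matrix_left_right_inverse by blast+
    then show ?thesis unfolding block_compose by simp (simp add: block_def)
  qed
  obtain S where S: "open S" "closure S = UNIV" "\<forall>x\<in>S. f x = g x" using assms(1) by (auto simp: agree_def)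
  have "open (?L -` S)" by (intro open_vimage continuous_block S)
  moreover have "closure (?L -` S) = UNIV"
  proof -
    have "x \<in> closure (?L -` S)" for x
    proof (rule ccontr)
      assume x: "x \<notin> closure (?L -` S)"
      let ?V = "?M -` (- closure (?L -` S))"
      have "open ?V" by (intro open_vimage continuous_block) auto
      moreover have "?L x \<in> ?V" using x M_of_L by simp
      ultimately have "?V \<inter> S \<noteq> {}" using S(2) open_Int_closure_eq_empty[of ?V S] by auto
      then obtain y where y: "y \<in> S" "?M y \<notin> closure (?L -` S)" by blast
      have L_of_M: "?L (?M y) = y" unfolding block_compose by (simp add: inv) (simp add: block_def)
      then have "?M y \<in> ?L -` S" using y by simp
      then show False using y(2) closure_subset[of "?L -` S"] by blast
    qed
    then show ?thesis by blast
  qed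
  ultimately show ?thesis using S(3) unfolding agree_def by (intro exI[of _ "?L -` S"]) auto
qed

lemma cmat_mult: "cmat (A ** B) = cmat A ** cmat B"
  by (simp add: cmat_def vec_eq_iff matrix_matrix_mult_def)

lemma cmat_one: "cmat (mat 1) = mat 1"
  by (simp add: cmat_def vec_eq_iff mat_def)

lemma cmat_cvec: "cmat A *v cvec \<mu> = cvec (A *v \<mu>)"
  by (simp add: cmat_def cvec_def vec_eq_iff matrix_vector_mult_def)

lemma cmat_transpose: "cmat (transpose A) = transpose (cmat A)"
  by (simp add: cmat_def transpose_def)

lemma cvec_diff: "cvec (a - b) = cvec a - cvec b"
  and cvec_minus: "cvec (- a) = - cvec a"
  and cvec_scale: "cvec (k *s a) = of_int k *s cvec a"
  by (simp_all add: cvec_def vec_eq_iff)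

lemma pairing_cvec: "pairing (cvec a) (cvec b) = of_int (pairing a b)"
  by (simp add: pairing_def cvec_def)

lemma cvec_eq_0_iff: "cvec a = 0 \<longleftrightarrow> a = 0"
  by (simp add: cvec_def vec_eq_iff)

text \<open>Invertibility makes the substitutions homeomorphisms, so preimages of dense open sets
  are dense open and the actions, although defined through chosen representatives, are computed by
  any representative.\<close>

locale invertible_wmat =
  fixes w w' :: "'n::finite wmat"
  assumes inv: "w ** w' = mat 1" "w' ** w = mat 1"
begin

lemma inv_eq: "matrix_inv w = w'"
  using inv by (rule matrix_inv_eqI)

lemma cmat_inv: "cmat w ** cmat w' = mat 1" "cmat w' ** cmat w = mat 1"
  by (simp_all add: inv cmat_one flip: cmat_mult)

lemma cmat_inv_transpose: "transpose (cmat w) ** transpose (cmat w') = mat 1"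
  using cmat_inv(2) by (metis matrix_transpose_mul transpose_mat)

lemma act_abs: "is_mero f \<Longrightarrow> act w (abs_mero f) = abs_mero (\<lambda>p. f (block (transpose (cmat w)) (mat 1) p))"
  and is_mero_act: "is_mero f \<Longrightarrow> is_mero (\<lambda>p. f (block (transpose (cmat w)) (mat 1) p))"
proof -
  show m: "is_mero (\<lambda>p. f (block (transpose (cmat w)) (mat 1) p))" if "is_mero f" for f :: "'n pt \<Rightarrow> complex"
    by (rule is_mero_block[OF that cmat_inv_transpose matrix_mul_lid])
  assume f: "is_mero f"
  have "agree (\<lambda>p. rep_mero (abs_mero f) (block (transpose (cmat w)) (mat 1) p))
      (\<lambda>p. f (block (transpose (cmat w)) (mat 1) p))"
    by (rule agree_block[OF agree_rep_abs[OF f] cmat_inv_transpose matrix_mul_lid])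
  then show "act w (abs_mero f) = abs_mero (\<lambda>p. f (block (transpose (cmat w)) (mat 1) p))"
    unfolding act_def using abs_mero_eqI[OF m[OF is_mero_rep] m[OF f]]
    by (simp add: block_def)
qed

lemma dyn_act_abs: "is_mero f \<Longrightarrow> dyn_act w (abs_mero f) = abs_mero (\<lambda>p. f (block (mat 1) (cmat w') p))"
  and is_mero_dyn_act: "is_mero f \<Longrightarrow> is_mero (\<lambda>p. f (block (mat 1) (cmat w') p))"
proof -
  show m: "is_mero (\<lambda>p. f (block (mat 1) (cmat w') p))" if "is_mero f" for f :: "'n pt \<Rightarrow> complex"
    by (rule is_mero_block[OF that matrix_mul_lid cmat_inv(2)])
  assume f: "is_mero f"
  have "agree (\<lambda>p. rep_mero (abs_mero f) (block (mat 1) (cmat w') p)) (\<lambda>p. f (block (mat 1) (cmat w') p))"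
    by (rule agree_block[OF agree_rep_abs[OF f] matrix_mul_lid cmat_inv(2)])
  then show "dyn_act w (abs_mero f) = abs_mero (\<lambda>p. f (block (mat 1) (cmat w') p))"
    unfolding dyn_act_def inv_eq using abs_mero_eqI[OF m[OF is_mero_rep] m[OF f]]
    by (simp add: block_def)
qed

lemma act_add: "act w (a + b) = act w a + act w b"
  by (cases a rule: mero_cases; cases b rule: mero_cases)
    (simp add: act_abs is_mero_act is_mero_add flip: abs_mero_add)

lemma act_mult: "act w (a * b) = act w a * act w b"
  by (cases a rule: mero_cases; cases b rule: mero_cases)
    (simp add: act_abs is_mero_act is_mero_mult flip: abs_mero_mult)

lemma act_divide: "act w (a / b) = act w a / act w b"
  by (cases a rule: mero_cases; cases b rule: mero_cases)
    (simp add: act_abs is_mero_act is_mero_divide flip: abs_mero_divide)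

lemma act_0 [simp]: "act w 0 = 0"
  using act_abs[OF is_mero_const[of 0]] by (simp add: abs_mero_0)

lemma act_1 [simp]: "act w 1 = 1"
  using act_abs[OF is_mero_const[of 1]] by (simp add: abs_mero_1)

lemma act_prod: "act w (prod f I) = (\<Prod>i\<in>I. act w (f i))"
  by (induction I rule: infinite_finite_induct) (simp_all add: act_mult)

lemma dyn_act_add: "dyn_act w (a + b) = dyn_act w a + dyn_act w b"
  by (cases a rule: mero_cases; cases b rule: mero_cases)
    (simp add: dyn_act_abs is_mero_dyn_act is_mero_add flip: abs_mero_add)

lemma dyn_act_mult: "dyn_act w (a * b) = dyn_act w a * dyn_act w b"
  by (cases a rule: mero_cases; cases b rule: mero_cases)
    (simp add: dyn_act_abs is_mero_dyn_act is_mero_mult flip: abs_mero_mult)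

lemma dyn_act_divide: "dyn_act w (a / b) = dyn_act w a / dyn_act w b"
  by (cases a rule: mero_cases; cases b rule: mero_cases)
    (simp add: dyn_act_abs is_mero_dyn_act is_mero_divide flip: abs_mero_divide)

lemma dyn_act_uminus: "dyn_act w (- a) = - dyn_act w a"
  by (cases a rule: mero_cases)
    (simp add: dyn_act_abs is_mero_dyn_act is_mero_uminus flip: abs_mero_uminus)

lemma dyn_act_0 [simp]: "dyn_act w 0 = 0"
  using dyn_act_abs[OF is_mero_const[of 0]] by (simp add: abs_mero_0)

lemma dyn_act_1 [simp]: "dyn_act w 1 = 1"
  using dyn_act_abs[OF is_mero_const[of 1]] by (simp add: abs_mero_1)

lemma dyn_act_sum: "dyn_act w (sum f I) = (\<Sum>i\<in>I. dyn_act w (f i))"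
  by (induction I rule: infinite_finite_induct) (simp_all add: dyn_act_add)

lemma dyn_act_prod: "dyn_act w (prod f I) = (\<Prod>i\<in>I. dyn_act w (f i))"
  by (induction I rule: infinite_finite_induct) (simp_all add: dyn_act_mult)

end

lemma act_mat_1 [simp]: "act (mat 1) a = a"
proof -
  interpret invertible_wmat "mat 1" "mat 1" by unfold_locales simp_all
  show ?thesis
    by (cases a rule: mero_cases) (simp add: act_abs block_def cmat_one transpose_mat)
qed

lemma dyn_act_mat_1 [simp]: "dyn_act (mat 1) a = a"
proof -
  interpret invertible_wmat "mat 1" "mat 1" by unfold_locales simp_all
  show ?thesis
    by (cases a rule: mero_cases) (simp add: dyn_act_abs block_def cmat_one)
qed

lemma act_act:
  assumes "invertible_wmat w w'" "invertible_wmat v v'"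
  shows "act w (act v a) = act (w ** v) a"
proof -
  interpret w: invertible_wmat w w' by fact
  interpret v: invertible_wmat v v' by fact
  have "w ** v ** (v' ** w') = w ** (v ** v') ** w'" "v' ** w' ** (w ** v) = v' ** (w' ** w) ** v"
    by (simp_all only: matrix_mul_assoc)
  then interpret wv: invertible_wmat "w ** v" "v' ** w'" by unfold_locales (simp_all add: w.inv v.inv)
  show ?thesis
    by (cases a rule: mero_cases)
      (simp add: wv.act_abs w.act_abs v.act_abs v.is_mero_act block_compose cmat_mult matrix_transpose_mul)
qed

lemma dyn_act_dyn_act:
  assumes "invertible_wmat w w'" "invertible_wmat v v'"
  shows "dyn_act w (dyn_act v a) = dyn_act (w ** v) a"
proof -
  interpret w: invertible_wmat w w' by fact
  interpret v: invertible_wmat v v' by fact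
  have "w ** v ** (v' ** w') = w ** (v ** v') ** w'" "v' ** w' ** (w ** v) = v' ** (w' ** w) ** v"
    by (simp_all only: matrix_mul_assoc)
  then interpret wv: invertible_wmat "w ** v" "v' ** w'" by unfold_locales (simp_all add: w.inv v.inv)
  show ?thesis
    by (cases a rule: mero_cases)
      (simp add: wv.dyn_act_abs w.dyn_act_abs v.dyn_act_abs v.is_mero_dyn_act block_compose cmat_mult)
qed

lemma act_dyn_act:
  assumes "invertible_wmat w w'" "invertible_wmat v v'"
  shows "act w (dyn_act v a) = dyn_act v (act w a)"
proof -
  interpret w: invertible_wmat w w' by fact
  interpret v: invertible_wmat v v' by fact
  show ?thesis
    by (cases a rule: mero_cases)
      (simp add: w.act_abs v.dyn_act_abs w.is_mero_act v.is_mero_dyn_act block_compose)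
qed

section \<open>Theta functions of affine forms as elements of the function field\<close>

definition affine_form :: "('n::finite pt \<Rightarrow> complex) \<Rightarrow> bool" where
  "affine_form F \<longleftrightarrow> (\<exists>a b c. F = (\<lambda>p. pairing a (fst p) + pairing b (snd p) + c))"

lemma holo_on_affine_form:
  assumes "affine_form F"
  shows "\<exists>F'. (F has_derivative F') (at p) \<and> (\<forall>c v. F' (cscale c v) = c * F' v)"
proof -
  obtain a b c where F: "F = (\<lambda>p. pairing a (fst p) + pairing b (snd p) + c)"
    using assms by (auto simp: affine_form_def)
  let ?F' = "\<lambda>p. pairing a (fst p) + pairing b (snd p)"
  have "linear ?F'"
    by (rule linearI) (auto simp: pairing_def distrib_left sum.distrib scaleR_sum_right scaleR_add_right)
  then have "bounded_linear ?F'" by (simp add: linear_conv_bounded_linear)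
  then have "(?F' has_derivative ?F') (at p)" by (rule bounded_linear_imp_has_derivative)
  then have "(F has_derivative ?F') (at p)"
    unfolding F using has_derivative_add[OF _ has_derivative_const[of c], of ?F' ?F' "at p"] by simp
  then show ?thesis
    by (intro exI[of _ ?F']) (simp add: cscale_def pairing_scale_right distrib_left)
qed

context elliptic_curve
begin

lemma holo_on_theta:
  assumes "affine_form F"
  shows "holo_on UNIV (\<lambda>p. th (F p))"
  unfolding holo_on_def
proof
  fix p
  obtain F' where F': "(F has_derivative F') (at p)" "\<forall>c v. F' (cscale c v) = c * F' v"
    using holo_on_affine_form[OF assms] by blast
  have "(th has_derivative (*) (deriv th (F p))) (at (F p))"
    using theta_has_deriv by (simp add: has_field_derivative_def)
  from diff_chain_at[OF F'(1) this]
  show "\<exists>f'. ((\<lambda>p. th (F p)) has_derivative f') (at p) \<and> (\<forall>c v. f' (cscale c v) = c * f' v)"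
    using F'(2) by (intro exI[of _ "(*) (deriv th (F p)) \<circ> F'"]) (simp add: o_def del: split_paired_All)
qed

lemma is_mero_theta: "affine_form F \<Longrightarrow> is_mero (\<lambda>p. th (F p))"
  by (rule holo_on_UNIV_is_mero[OF holo_on_theta])

lemma theta_at_nonzero_const:
  assumes "affine_form F" "th (F p) \<noteq> 0"
  shows "theta_at \<tau> F \<noteq> 0"
  unfolding theta_at_def by (rule abs_mero_nonzeroI[OF holo_on_theta[OF assms(1)] assms(2)])

text \<open>An affine function of nonzero slope takes the value 1/2, which is not a period: its
  imaginary part excludes n \<noteq> 0, and 1/2 is not an integer.\<close>

lemma ex_theta_nonzero:
  assumes "b \<noteq> 0"
  shows "\<exists>k. th (k * b + c) \<noteq> 0"
proof -
  have "\<not> period (1 / 2 :: complex)"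
  proof
    assume "period (1 / 2)"
    then obtain m n where mn: "1 / 2 = lattice m n" by (auto simp: period_def)
    then have "Im (of_int n * \<tau>) = 0" by (metis Im_complex_of_real add_0 complex_Im_of_int of_real_divide of_real_numeral of_real_1 plus_complex.simps(2))
    then have "n = 0" using Im_pos by simp
    then have "(1 / 2 :: complex) = of_int m" using mn by simp
    then have "of_int (2 * m) = (of_int 1 :: complex)" by (simp add: mult.commute)
    then have "2 * m = 1" by (simp only: of_int_eq_iff)
    then show False by presburger
  qed
  then have "th ((1 / 2 - c) / b * b + c) \<noteq> 0" using assms by (simp add: theta_eq_0_iff)
  then show ?thesis by blast
qed

lemma theta_at_nonzero:
  assumes "a \<noteq> 0 \<or> b \<noteq> 0"
  shows "theta_at \<tau> (\<lambda>p::'n::finite pt. pairing a (fst p) + pairing b (snd p) + c) \<noteq> 0"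
proof -
  have "\<exists>p::'n pt. pairing a (fst p) + pairing b (snd p) = 1"
  proof (cases "a = 0")
    case True
    then obtain i where "b $ i \<noteq> 0" using assms by (auto simp: vec_eq_iff)
    then show ?thesis using True
      by (intro exI[of _ "(0, (1 / b $ i) *s axis i 1)"]) (simp add: pairing_scale_right pairing_axis_right)
  next
    case False
    then obtain i where "a $ i \<noteq> 0" by (auto simp: vec_eq_iff)
    then show ?thesis
      by (intro exI[of _ "((1 / a $ i) *s axis i 1, 0)"]) (simp add: pairing_scale_right pairing_axis_right)
  qed
  then obtain p :: "'n pt" where p: "pairing a (fst p) + pairing b (snd p) = 1" by blast
  obtain k where k: "th (k * 1 + c) \<noteq> 0" using ex_theta_nonzero[of 1 c] by auto
  have "pairing a (fst (cscale k p)) + pairing b (snd (cscale k p)) + c = k * 1 + c"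
    unfolding p[symmetric] by (simp add: cscale_def pairing_scale_right distrib_left)
  then have "th (pairing a (fst (cscale k p)) + pairing b (snd (cscale k p)) + c) \<noteq> 0"
    using k by simp
  then show ?thesis
    by (intro theta_at_nonzero_const[where p = "cscale k p"]) (auto simp: affine_form_def)
qed

end

section \<open>The twisted group algebra and the Poincare pairing\<close>

context based_root_datum
begin

lemma W_invertible: "w \<in> W \<Longrightarrow> invertible_wmat w (matrix_inv w)"
  by unfold_locales (simp_all add: W_inv)

lemmas act_W_add = invertible_wmat.act_add[OF W_invertible]
  and act_W_mult = invertible_wmat.act_mult[OF W_invertible]
  and act_W_divide = invertible_wmat.act_divide[OF W_invertible]
  and act_W_0 = invertible_wmat.act_0[OF W_invertible]
  and act_W_1 = invertible_wmat.act_1[OF W_invertible]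
  and act_W_prod = invertible_wmat.act_prod[OF W_invertible]
  and dyn_act_W_add = invertible_wmat.dyn_act_add[OF W_invertible]
  and dyn_act_W_mult = invertible_wmat.dyn_act_mult[OF W_invertible]
  and dyn_act_W_divide = invertible_wmat.dyn_act_divide[OF W_invertible]
  and dyn_act_W_uminus = invertible_wmat.dyn_act_uminus[OF W_invertible]
  and dyn_act_W_0 = invertible_wmat.dyn_act_0[OF W_invertible]
  and dyn_act_W_sum = invertible_wmat.dyn_act_sum[OF W_invertible]
  and dyn_act_W_prod = invertible_wmat.dyn_act_prod[OF W_invertible]
  and act_W_act = act_act[OF W_invertible W_invertible]
  and dyn_act_W_dyn_act = dyn_act_dyn_act[OF W_invertible W_invertible]
  and act_W_dyn_act = act_dyn_act[OF W_invertible W_invertible]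

abbreviation "keyset \<equiv> Poly_Mapping.keys"
abbreviation "coef \<equiv> Poly_Mapping.lookup"

text \<open>The algebra is indexed by pairs of arbitrary integer matrices; on this support the
  indices lie in the group, where inverses and actions obey the expected rules.\<close>

definition supported :: "'n twisted \<Rightarrow> bool" where
  "supported A \<longleftrightarrow> keyset A \<subseteq> W \<times> W"

lemma supported_elt: "w \<in> W \<Longrightarrow> v \<in> W \<Longrightarrow> supported (elt a w v)"
  by (simp add: supported_def elt_def)

lemma supported_0: "supported 0"
  by (simp add: supported_def)

lemma supported_add: "supported A \<Longrightarrow> supported A' \<Longrightarrow> supported (A + A')"
  using keys_add[of A A'] by (auto simp: supported_def)

lemma supported_sum: "(\<And>i. i \<in> I \<Longrightarrow> supported (A i)) \<Longrightarrow> supported (sum A I)"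
  by (induction I rule: infinite_finite_induct) (simp_all add: supported_0 supported_add)

lemma supported_tmult: "supported A \<Longrightarrow> supported A' \<Longrightarrow> supported (A \<odot> A')"
  unfolding tmult_def
  by (auto simp: supported_def[of A] supported_def[of A'] intro!: supported_sum supported_elt W_mult)

text \<open>At x only the summand u = x v of the definition survives. The sum is extended from the
  keys to the whole group, absent coefficients contributing 0, which makes additivity in
  \<open>A\<close> evident.\<close>

lemma bullet_supported:
  assumes A: "supported A"
  shows "bullet D A f x = (if x \<in> W then
    \<Sum>k\<in>W \<times> W. act x (coef A k) * dyn_act (fst k) (f (x ** snd k)) else 0)"
proof (cases "x \<in> W")
  case True
  have inner: "(\<Sum>u\<in>W. fbasis (u ** matrix_inv v) x *
       (act (u ** matrix_inv v) a * dyn_act w (f u))) = act x a * dyn_act w (f (x ** v))"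
    if v: "v \<in> W" for v w a
  proof -
    have eq: "x = u ** matrix_inv v \<longleftrightarrow> u = x ** v" if "u \<in> W" for u
      using W_inv[OF v] by (metis matrix_mul_assoc matrix_mul_rid)
    have "(\<Sum>u\<in>W. fbasis (u ** matrix_inv v) x * (act (u ** matrix_inv v) a * dyn_act w (f u)))
        = (\<Sum>u\<in>W. if u = x ** v then act x a * dyn_act w (f (x ** v)) else 0)"
    proof (rule sum.cong)
      fix u assume u: "u \<in> W"
      show "fbasis (u ** matrix_inv v) x * (act (u ** matrix_inv v) a * dyn_act w (f u))
        = (if u = x ** v then act x a * dyn_act w (f (x ** v)) else 0)"
      proof (cases "u = x ** v")
        case True
        then have "u ** matrix_inv v = x" using eq[OF u] by simp
        then show ?thesis using True by (simp add: fbasis_def)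
      next
        case False
        then show ?thesis using eq[OF u] by (simp add: fbasis_def)
      qed
    qed simp
    also have "\<dots> = act x a * dyn_act w (f (x ** v))"
      using W_mult[OF True v] by (simp add: finite_W)
    finally show ?thesis .
  qed
  have "bullet D A f x = (\<Sum>k\<in>keyset A.
      act x (coef A k) * dyn_act (fst k) (f (x ** snd k)))"
    unfolding bullet_def
  proof (rule sum.cong)
    fix k assume "k \<in> keyset A"
    moreover obtain w v where k: "k = (w, v)" by (cases k)
    ultimately have v: "v \<in> W" using A by (auto simp: supported_def)
    show "(case k of (w, v) \<Rightarrow> \<Sum>u\<in>W. fbasis (u ** matrix_inv v) x *
         (act (u ** matrix_inv v) (coef A (w, v)) * dyn_act w (f u))) =
        act x (coef A k) * dyn_act (fst k) (f (x ** snd k))"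
      unfolding k prod.case fst_conv snd_conv by (rule inner[OF v])
  qed simp
  also have "\<dots> = (\<Sum>k\<in>W \<times> W. act x (coef A k) * dyn_act (fst k) (f (x ** snd k)))"
    using A finite_W
    by (intro sum.mono_neutral_left) (auto simp: supported_def in_keys_iff act_W_0[OF True])
  finally show ?thesis using True by simp
next
  case False
  have "fbasis (u ** matrix_inv v) x = 0" if "v \<in> W" "u \<in> W" for u v
    using False that W_mult W_inv by (auto simp: fbasis_def)
  then have "bullet D A f x = 0"
    using A unfolding bullet_def supported_def
    by (intro sum.neutral) (force intro!: sum.neutral)
  then show ?thesis using False by simp
qed

lemma bullet_elt:
  assumes "w \<in> W" "v \<in> W"
  shows "bullet D (elt a w v) f x = (if x \<in> W then act x a * dyn_act w (f (x ** v)) else 0)"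
proof (cases "x \<in> W")
  case True
  have "(\<Sum>k\<in>W \<times> W. act x (coef (elt a w v) k) * dyn_act (fst k) (f (x ** snd k)))
    = (\<Sum>k\<in>W \<times> W. if k = (w, v) then act x a * dyn_act w (f (x ** v)) else 0)"
    by (rule sum.cong) (auto simp: elt_def lookup_single when_def act_W_0[OF True])
  then show ?thesis
    using True assms finite_W by (subst bullet_supported[OF supported_elt[OF assms]]) simp
qed (simp add: bullet_supported[OF supported_elt[OF assms]])

lemma bullet_0: "bullet D 0 f x = 0"
  by (simp add: bullet_def)

lemma bullet_add:
  "supported A \<Longrightarrow> supported A' \<Longrightarrow> bullet D (A + A') f x = bullet D A f x + bullet D A' f x"
  by (simp add: bullet_supported supported_add lookup_add act_W_add distrib_right sum.distrib)

lemma bullet_sum: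
  "(\<And>i. i \<in> I \<Longrightarrow> supported (A i)) \<Longrightarrow> bullet D (sum A I) f x = (\<Sum>i\<in>I. bullet D (A i) f x)"
  by (induction I rule: infinite_finite_induct) (simp_all add: bullet_0 bullet_add supported_sum)

lemma elt_sum_keys: "A = (\<Sum>k\<in>keyset A. elt (coef A k) (fst k) (snd k))"
proof (rule poly_mapping_eqI)
  fix k
  show "coef A k =
      coef (\<Sum>k\<in>keyset A. elt (coef A k) (fst k) (snd k)) k"
    by (simp add: elt_def lookup_sum lookup_single when_def in_keys_iff)
qed

lemma bullet_keys:
  assumes "supported A"
  shows "bullet D A f x = (\<Sum>k\<in>keyset A. bullet D (elt (coef A k) (fst k) (snd k)) f x)"
  by (subst elt_sum_keys, rule bullet_sum, rule supported_elt) (use assms in \<open>auto simp: supported_def\<close>)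

text \<open>Both sides are additive in the two algebra elements, so basis elements suffice; there
  the claim is that each action is multiplicative in the group and that the two commute.\<close>

lemma bullet_tmult:
  assumes A: "supported A" and A': "supported A'"
  shows "bullet D (A \<odot> A') f = bullet D A (bullet D A' f)"
proof
  fix x
  define T where "T = (\<lambda>k k'. elt (coef A k *
      act (snd k) (dyn_act (fst k) (coef A' k'))) (fst k ** fst k') (snd k ** snd k'))"
  have T: "A \<odot> A' = (\<Sum>k\<in>keyset A. \<Sum>k'\<in>keyset A'. T k k')"
    unfolding tmult_def T_def by (simp add: case_prod_unfold)
  have W: "fst k \<in> W" "snd k \<in> W" "fst k' \<in> W" "snd k' \<in> W"
    if "k \<in> keyset A" "k' \<in> keyset A'" for k k'
    using that A A' by (auto simp: supported_def)
  have W1: "fst k \<in> W" "snd k \<in> W" if "k \<in> keyset A" for k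
    using that A by (auto simp: supported_def)
  have sT: "supported (T k k')" if "k \<in> keyset A" "k' \<in> keyset A'" for k k'
    unfolding T_def using W[OF that] by (intro supported_elt W_mult)
  show "bullet D (A \<odot> A') f x = bullet D A (bullet D A' f) x"
  proof (cases "x \<in> W")
    case x: True
    have "bullet D (A \<odot> A') f x =
        (\<Sum>k\<in>keyset A. \<Sum>k'\<in>keyset A'. bullet D (T k k') f x)"
      unfolding T by (subst bullet_sum, rule supported_sum, rule sT) (auto intro!: sum.cong bullet_sum sT)
    also have "\<dots> = (\<Sum>k\<in>keyset A.
        bullet D (elt (coef A k) (fst k) (snd k)) (bullet D A' f) x)"
    proof (rule sum.cong)
      fix k assume k: "k \<in> keyset A"
      note Wk = W1[OF k]
      have "bullet D (elt (coef A k) (fst k) (snd k)) (bullet D A' f) x =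
          (\<Sum>k'\<in>keyset A'. act x (coef A k) *
            dyn_act (fst k) (bullet D (elt (coef A' k') (fst k') (snd k')) f (x ** snd k)))"
        using x Wk by (simp add: bullet_elt bullet_keys[OF A'] dyn_act_W_sum sum_distrib_left)
      also have "\<dots> = (\<Sum>k'\<in>keyset A'. bullet D (T k k') f x)"
      proof (rule sum.cong)
        fix k' assume k': "k' \<in> keyset A'"
        note Wk' = W[OF k k']
        show "act x (coef A k) *
            dyn_act (fst k) (bullet D (elt (coef A' k') (fst k') (snd k')) f (x ** snd k)) =
          bullet D (T k k') f x"
          unfolding T_def using x Wk'
          by (simp add: bullet_elt W_mult act_W_mult dyn_act_W_mult act_W_act act_W_dyn_act
              dyn_act_W_dyn_act matrix_mul_assoc mult.assoc)
      qed simp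
      finally show "(\<Sum>k'\<in>keyset A'. bullet D (T k k') f x) =
          bullet D (elt (coef A k) (fst k) (snd k)) (bullet D A' f) x" ..
    qed simp
    also have "\<dots> = bullet D A (bullet D A' f) x" by (rule bullet_keys[OF A, symmetric])
    finally show ?thesis .
  next
    case False
    then show ?thesis using A supported_tmult[OF A A'] by (simp add: bullet_supported)
  qed
qed

lemma dual_one_eq: "dual_one D x = (if x \<in> W then 1 else 0)"
  unfolding dual_one_def fbasis_def using finite_W by simp

end

section \<open>The operators, their adjoints and the Poincare pairing\<close>

locale elliptic_root_datum = based_root_datum D + elliptic_curve \<tau>
  for D :: "'n::finite root_datum" and \<tau> :: complex +
  fixes h :: complex
begin

lemma affine_z: "affine_form (\<lambda>p. c * z_lin \<mu> p + k)"
  unfolding affine_form_def z_lin_def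
  by (intro exI[of _ "c *s cvec \<mu>"] exI[of _ 0] exI[of _ k]) (simp add: pairing_scale_left)

lemma affine_l: "affine_form (\<lambda>p. c * l_lin \<nu> p + k)"
  unfolding affine_form_def l_lin_def
  by (intro exI[of _ 0] exI[of _ "c *s cvec \<nu>"] exI[of _ k])
    (simp add: pairing_scale_left pairing_commute[of "cvec \<nu>"])

lemma affine_zl: "affine_form (\<lambda>p. z_lin \<mu> p + c * l_lin \<nu> p)"
  unfolding affine_form_def l_lin_def z_lin_def
  by (intro exI[of _ "cvec \<mu>"] exI[of _ "c *s cvec \<nu>"] exI[of _ 0])
    (simp add: pairing_scale_left pairing_commute[of "cvec \<nu>"])

lemma affine_const [simp]: "affine_form (\<lambda>p. k)"
  unfolding affine_form_def by (intro exI[of _ 0] exI[of _ k]) simp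

lemma affine_forms [simp]:
  "affine_form (z_lin \<mu>)" "affine_form (\<lambda>p. h - z_lin \<mu> p)" "affine_form (l_lin \<nu>)"
  "affine_form (\<lambda>p. h - l_lin \<nu> p)" "affine_form (\<lambda>p. h + l_lin \<nu> p)"
  "affine_form (\<lambda>p. z_lin \<mu> p - l_lin \<nu> p)" "affine_form (\<lambda>p. z_lin \<mu> p + l_lin \<nu> p)"
  "affine_form (\<lambda>p. - l_lin \<nu> p)"
  using affine_z[of 1 \<mu> 0] affine_z[of "-1" \<mu> h] affine_l[of 1 \<nu> 0] affine_l[of "-1" \<nu> h]
    affine_l[of 1 \<nu> h] affine_zl[of \<mu> "-1" \<nu>] affine_zl[of \<mu> 1 \<nu>]
    affine_l[of "-1" \<nu> 0]
  by (simp_all add: add.commute)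

lemma theta_at_z_nonzero: "\<mu> \<noteq> 0 \<Longrightarrow> theta_at \<tau> (z_lin \<mu>) \<noteq> (0 :: 'n mero)"
  and theta_at_hz_nonzero: "\<mu> \<noteq> 0 \<Longrightarrow> theta_at \<tau> (\<lambda>p. h - z_lin \<mu> p) \<noteq> (0 :: 'n mero)"
  using theta_at_nonzero[of "cvec \<mu>" 0 0] theta_at_nonzero[of "- cvec \<mu>" 0 h]
  by (simp_all add: z_lin_def[abs_def] cvec_eq_0_iff pairing_minus_left)

lemma z_lin_block:
  "z_lin \<mu> (block (transpose (cmat x)) C p) = z_lin (x *v \<mu>) p"
  unfolding z_lin_def block_def fst_conv pairing_matrix[symmetric] cmat_cvec ..

lemma l_lin_block_1 [simp]: "l_lin \<nu> (block A (mat 1) p) = l_lin \<nu> p"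
  and z_lin_block_1 [simp]: "z_lin \<nu> (block (mat 1) C p) = z_lin \<nu> p"
  by (simp_all add: l_lin_def z_lin_def block_def)

lemma pairing_coroot_W:
  assumes "w \<in> W" "\<beta> \<in> R"
  shows "pairing (cmat w *v l) (cvec (cv (w *v \<beta>))) = pairing l (cvec (cv \<beta>))"
proof -
  have "transpose w *v cv (w *v \<beta>) = cv \<beta>"
  proof (rule vec_eq_iff[THEN iffD2], rule allI)
    fix i
    have "(transpose w *v cv (w *v \<beta>)) $ i = pairing (w *v axis i 1) (cv (w *v \<beta>))"
      unfolding pairing_matrix by (simp add: pairing_axis_left)
    also have "\<dots> = cv \<beta> $ i" unfolding W_pairing[OF assms] by (rule pairing_axis_left)
    finally show "(transpose w *v cv (w *v \<beta>)) $ i = cv \<beta> $ i" .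
  qed
  then show ?thesis by (simp add: pairing_matrix cmat_cvec flip: cmat_transpose)
qed

lemma l_lin_block:
  assumes "w \<in> W" "\<beta> \<in> R"
  shows "l_lin (cv \<beta>) (block A (cmat (matrix_inv w)) p) = l_lin (cv (w *v \<beta>)) p"
  using pairing_coroot_W[of "matrix_inv w" "w *v \<beta>"] assms
  by (simp add: l_lin_def block_def W_inv W_inv_apply W_root)

lemma l_lin_uminus: "\<beta> \<in> R \<Longrightarrow> l_lin (cv (- \<beta>)) p = - l_lin (cv \<beta>) p"
  by (simp add: coroot_uminus l_lin_def cvec_minus pairing_minus_right)

lemma act_theta_at:
  assumes "w \<in> W" "affine_form F"
  shows "act w (theta_at \<tau> F) = theta_at \<tau> (\<lambda>p. F (block (transpose (cmat w)) (mat 1) p))"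
  unfolding theta_at_def by (rule invertible_wmat.act_abs[OF W_invertible is_mero_theta]) (use assms in auto)

lemma dyn_act_theta_at:
  assumes "w \<in> W" "affine_form F"
  shows "dyn_act w (theta_at \<tau> F) = theta_at \<tau> (\<lambda>p. F (block (mat 1) (cmat (matrix_inv w)) p))"
  unfolding theta_at_def by (rule invertible_wmat.dyn_act_abs[OF W_invertible is_mero_theta]) (use assms in auto)

lemma theta_at_uminus:
  assumes "affine_form F"
  shows "theta_at \<tau> (\<lambda>p. - F p) = - theta_at \<tau> F"
  unfolding theta_at_def theta_minus by (rule abs_mero_uminus[OF is_mero_theta[OF assms]])

definition a_plus :: "int^'n \<Rightarrow> 'n mero" where
  "a_plus \<alpha> = theta_at \<tau> (\<lambda>p. h - z_lin \<alpha> p) * theta_at \<tau> (l_lin (cv \<alpha>)) /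
    (theta_at \<tau> (z_lin \<alpha>) * theta_at \<tau> (\<lambda>p. h - l_lin (cv \<alpha>) p))"

definition b_plus :: "int^'n \<Rightarrow> 'n mero" where
  "b_plus \<alpha> = theta_at \<tau> (\<lambda>p. h) * theta_at \<tau> (\<lambda>p. z_lin \<alpha> p - l_lin (cv \<alpha>) p) /
    (theta_at \<tau> (z_lin \<alpha>) * theta_at \<tau> (\<lambda>p. h - l_lin (cv \<alpha>) p))"

definition a_minus :: "int^'n \<Rightarrow> 'n mero" where
  "a_minus \<alpha> = - (theta_at \<tau> (\<lambda>p. h - z_lin \<alpha> p) * theta_at \<tau> (l_lin (cv \<alpha>)) /
    (theta_at \<tau> (z_lin \<alpha>) * theta_at \<tau> (\<lambda>p. h + l_lin (cv \<alpha>) p)))"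

definition b_minus :: "int^'n \<Rightarrow> 'n mero" where
  "b_minus \<alpha> = theta_at \<tau> (\<lambda>p. h) * theta_at \<tau> (\<lambda>p. z_lin \<alpha> p + l_lin (cv \<alpha>) p) /
    (theta_at \<tau> (z_lin \<alpha>) * theta_at \<tau> (\<lambda>p. h + l_lin (cv \<alpha>) p))"

abbreviation "Tplus \<equiv> T_plus D \<tau> h"
abbreviation "Tminus \<equiv> T_minus D \<tau> h"

lemma T_plus_eq: "Tplus \<alpha> = elt (a_plus \<alpha>) (s \<alpha>) (s \<alpha>) + elt (b_plus \<alpha>) (s \<alpha>) (mat 1)"
  by (simp add: T_plus_def a_plus_def b_plus_def Let_def)

lemma T_minus_eq: "Tminus \<alpha> = elt (a_minus \<alpha>) (s \<alpha>) (s \<alpha>) + elt (b_minus \<alpha>) (s \<alpha>) (mat 1)"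
  by (simp add: T_minus_def a_minus_def b_minus_def Let_def)

lemma supported_T:
  assumes "\<alpha> \<in> B"
  shows "supported (Tplus \<alpha>)" "supported (Tminus \<alpha>)"
  unfolding T_plus_eq T_minus_eq using assms
  by (auto intro!: supported_add supported_elt reflection_in_W B_root one_in_W)

lemma bullet_T:
  assumes "\<alpha> \<in> B" "x \<in> W"
  shows "bullet D (Tplus \<alpha>) f x =
      act x (a_plus \<alpha>) * dyn_act (s \<alpha>) (f (x ** s \<alpha>)) + act x (b_plus \<alpha>) * dyn_act (s \<alpha>) (f x)"
    and "bullet D (Tminus \<alpha>) f x =
      act x (a_minus \<alpha>) * dyn_act (s \<alpha>) (f (x ** s \<alpha>)) + act x (b_minus \<alpha>) * dyn_act (s \<alpha>) (f x)"
  unfolding T_plus_eq T_minus_eq using assms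
  by (simp_all add: bullet_add bullet_elt supported_elt reflection_in_W B_root one_in_W)

definition word_act :: "(int^'n \<Rightarrow> 'n twisted) \<Rightarrow> (int^'n) list \<Rightarrow> 'n dual \<Rightarrow> 'n dual" where
  "word_act T ws f = foldr (\<lambda>\<alpha>. bullet D (T \<alpha>)) ws f"

lemma word_act_Nil [simp]: "word_act T [] f = f"
  and word_act_Cons [simp]: "word_act T (\<alpha> # ws) f = bullet D (T \<alpha>) (word_act T ws f)"
  by (simp_all add: word_act_def)

lemma word_act_append: "word_act T (us @ vs) f = word_act T us (word_act T vs f)"
  by (induction us) simp_all

text \<open>Replaces a product in the algebra by successive operators. The reduced word is an
  arbitrary choice, so only its letters, its product and its length are passed on.\<close>

lemma bullet_along_word:
  assumes w: "w \<in> W" and T: "\<And>\<alpha>. \<alpha> \<in> B \<Longrightarrow> supported (T \<alpha>)" and f: "\<And>x. x \<notin> W \<Longrightarrow> f x = 0"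
  obtains ws where "set ws \<subseteq> B" "wprod ws = w" "length ws = card (inversions w)"
    "bullet D (along_word D T w) f = word_act T ws f"
proof -
  define ws where "ws = (SOME ws. reduced_word D w ws)"
  have "reduced_word D w ws" unfolding ws_def by (rule someI_ex[OF reduced_word_exists[OF w]])
  then have ws: "set ws \<subseteq> B" "wprod ws = w" "length ws = card (inversions w)"
    using len_eq[OF w] by (auto simp: reduced_word_def word_of_iff)
  have "supported (foldr (\<lambda>\<alpha> A. T \<alpha> \<odot> A) us (elt 1 (mat 1) (mat 1))) \<and>
    bullet D (foldr (\<lambda>\<alpha> A. T \<alpha> \<odot> A) us (elt 1 (mat 1) (mat 1))) f = word_act T us f"
    if "set us \<subseteq> B" for us
    using that
  proof (induction us)
    case Nil
    have "bullet D (elt 1 (mat 1) (mat 1)) f x = f x" for x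
      by (cases "x \<in> W") (simp_all add: bullet_elt one_in_W f act_W_1)
    then show ?case by (auto simp: supported_elt one_in_W)
  next
    case (Cons \<alpha> us)
    then show ?case by (simp add: supported_tmult T bullet_tmult)
  qed
  from this[OF ws(1)] show thesis
    using that[OF ws] unfolding along_word_def ws_def[symmetric] by blast
qed

definition g_inv :: "'n mero" where
  "g_inv = 1 / g_elt D \<tau> h"

lemma g_inv_eq: "g_inv = (\<Prod>\<beta>\<in>P. theta_at \<tau> (z_lin \<beta>) / theta_at \<tau> (\<lambda>p. h - z_lin \<beta> p))"
  unfolding g_inv_def g_elt_def by (simp flip: prod_inversef add: divide_inverse mult.commute)

text \<open>The factor of g at \<alpha> is exactly the z-dependent part of \<open>a_plus\<close>.
  What is left in z is a product over the positive roots other than \<alpha>, which s_\<alpha>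
  permutes; this symmetry is why 1/g is the right weight for adjointness.\<close>

lemma a_plus_g_inv:
  assumes \<alpha>: "\<alpha> \<in> B"
  shows "g_inv * a_plus \<alpha> = theta_at \<tau> (l_lin (cv \<alpha>)) / theta_at \<tau> (\<lambda>p. h - l_lin (cv \<alpha>) p) *
    (\<Prod>\<beta>\<in>P - {\<alpha>}. theta_at \<tau> (z_lin \<beta>) / theta_at \<tau> (\<lambda>p. h - z_lin \<beta> p))"
proof -
  have "\<alpha> \<noteq> 0" using root_nonzero B_root \<alpha> by blast
  then have nz: "theta_at \<tau> (z_lin \<alpha>) \<noteq> 0" "theta_at \<tau> (\<lambda>p. h - z_lin \<alpha> p) \<noteq> 0"
    by (simp_all add: theta_at_z_nonzero theta_at_hz_nonzero)
  have "g_inv = theta_at \<tau> (z_lin \<alpha>) / theta_at \<tau> (\<lambda>p. h - z_lin \<alpha> p) *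
      (\<Prod>\<beta>\<in>P - {\<alpha>}. theta_at \<tau> (z_lin \<beta>) / theta_at \<tau> (\<lambda>p. h - z_lin \<beta> p))"
    unfolding g_inv_eq using B_pos[OF \<alpha>] finite_P by (rule prod.remove[rotated])
  then show ?thesis using nz by (simp add: a_plus_def)
qed

lemma act_a_plus_g_inv:
  assumes \<alpha>: "\<alpha> \<in> B"
  shows "act (s \<alpha>) (g_inv * a_plus \<alpha>) = g_inv * a_plus \<alpha>"
proof -
  note sW = simple_in_W[OF \<alpha>]
  have "(\<Prod>\<beta>\<in>P - {\<alpha>}. theta_at \<tau> (z_lin (s \<alpha> *v \<beta>)) / theta_at \<tau> (\<lambda>p. h - z_lin (s \<alpha> *v \<beta>) p)) =
      (\<Prod>\<beta>\<in>P - {\<alpha>}. theta_at \<tau> (z_lin \<beta>) / theta_at \<tau> (\<lambda>p. h - z_lin \<beta> p) :: 'n mero)"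
    by (rule prod.reindex_bij_betw[OF simple_reflection_bij[OF \<alpha>]])
  then show ?thesis
    unfolding a_plus_g_inv[OF \<alpha>]
    by (simp add: act_W_mult act_W_divide act_W_prod sW act_theta_at z_lin_block)
qed

lemma dyn_act_g_inv: "w \<in> W \<Longrightarrow> dyn_act w g_inv = g_inv"
  unfolding g_inv_eq by (simp add: dyn_act_W_divide dyn_act_W_prod dyn_act_theta_at)

text \<open>The dynamical reflection negates \<lambda> on the coroot of \<alpha>, so h + \<lambda>
  becomes h - \<lambda> and the oddness of theta absorbs the minus sign in
  \<open>a_minus\<close>.\<close>

lemma dyn_act_a_minus: "\<alpha> \<in> B \<Longrightarrow> dyn_act (s \<alpha>) (a_minus \<alpha>) = a_plus \<alpha>"
  and dyn_act_b_minus: "\<alpha> \<in> B \<Longrightarrow> dyn_act (s \<alpha>) (b_minus \<alpha>) = b_plus \<alpha>"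
  unfolding a_minus_def b_minus_def a_plus_def b_plus_def
  by (simp_all add: dyn_act_W_uminus dyn_act_W_divide dyn_act_W_mult dyn_act_theta_at reflection_in_W
      B_root l_lin_block reflection_self l_lin_uminus theta_at_uminus)

text \<open>The part of the Poincare pairing that comes from the elements
  \<open>\<delta>\<^sub>w\<close>; the sum over the dynamical elements is still to be
  applied.\<close>

definition pair :: "'n dual \<Rightarrow> 'n dual \<Rightarrow> 'n mero" where
  "pair f f' = (\<Sum>u\<in>W. act u g_inv * (f u * f' u))"

text \<open>The dynamical reflection exchanges the coefficients for \<lambda> and -\<lambda> and
  moves from one argument to the other. The term without \<open>\<delta>\<close> is then already
  diagonal; the crossing term needs the substitution u to u s_\<alpha>.\<close>

lemma pair_adjoint:
  assumes \<alpha>: "\<alpha> \<in> B"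
  shows "pair (bullet D (Tplus \<alpha>) f) f' = dyn_act (s \<alpha>) (pair f (bullet D (Tminus \<alpha>) f'))"
proof -
  define d where "d = (dyn_act (s \<alpha>) :: 'n mero \<Rightarrow> 'n mero)"
  note \<alpha>R = B_root[OF \<alpha>]
  note sW = reflection_in_W[OF \<alpha>R]
  have bij: "bij_betw (\<lambda>u. u ** s \<alpha>) W W"
    by (rule bij_betw_byWitness[where f' = "\<lambda>u. u ** s \<alpha>"])
      (auto simp: W_mult sW reflection_involution \<alpha>R simp flip: matrix_mul_assoc)
  \<comment> \<open>Re-indexing transfers s_\<alpha> from the argument of \<open>f'\<close> to that
    of \<open>f\<close>; the coefficient is unchanged because \<open>g_inv * a_plus \<alpha>\<close>
    is fixed by s_\<alpha>.\<close>
  have "(\<Sum>u\<in>W. act u (g_inv * a_plus \<alpha>) * d (f u) * f' (u ** s \<alpha>)) =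
      (\<Sum>u\<in>W. act (u ** s \<alpha>) (g_inv * a_plus \<alpha>) * d (f (u ** s \<alpha>)) * f' (u ** s \<alpha> ** s \<alpha>))"
    by (rule sum.reindex_bij_betw[OF bij, symmetric])
  also have "\<dots> = (\<Sum>u\<in>W. act u (g_inv * a_plus \<alpha>) * d (f (u ** s \<alpha>)) * f' u)"
    by (rule sum.cong)
      (simp_all add: act_a_plus_g_inv[OF \<alpha>] reflection_involution \<alpha>R sW
        flip: act_W_act matrix_mul_assoc)
  finally have a: "(\<Sum>u\<in>W. act u (g_inv * a_plus \<alpha>) * d (f u) * f' (u ** s \<alpha>)) =
      (\<Sum>u\<in>W. act u (g_inv * a_plus \<alpha>) * d (f (u ** s \<alpha>)) * f' u)" .
  have dd: "d (d a) = a" for a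
    by (simp add: d_def dyn_act_W_dyn_act sW reflection_involution \<alpha>R)
  have da: "d (act u g_inv) = act u g_inv" "d (act u (a_minus \<alpha>)) = act u (a_plus \<alpha>)"
    "d (act u (b_minus \<alpha>)) = act u (b_plus \<alpha>)" if "u \<in> W" for u
    unfolding d_def using that sW \<alpha>
    by (simp_all add: dyn_act_g_inv dyn_act_a_minus dyn_act_b_minus flip: act_W_dyn_act)
  have dm: "d (a * b) = d a * d b" "d (a + b) = d a + d b" for a b
    by (simp_all add: d_def sW dyn_act_W_mult dyn_act_W_add)
  have "d (pair f (bullet D (Tminus \<alpha>) f')) =
      (\<Sum>u\<in>W. d (act u g_inv * (f u * bullet D (Tminus \<alpha>) f' u)))"
    unfolding pair_def d_def by (rule dyn_act_W_sum[OF sW])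
  also have "\<dots> = (\<Sum>u\<in>W. act u (g_inv * a_plus \<alpha>) * d (f u) * f' (u ** s \<alpha>) +
      act u g_inv * act u (b_plus \<alpha>) * d (f u) * f' u)"
  proof (rule sum.cong)
    fix u assume u: "u \<in> W"
    show "d (act u g_inv * (f u * bullet D (Tminus \<alpha>) f' u)) =
        act u (g_inv * a_plus \<alpha>) * d (f u) * f' (u ** s \<alpha>) +
        act u g_inv * act u (b_plus \<alpha>) * d (f u) * f' u"
      unfolding bullet_T(2)[OF \<alpha> u] dm d_def[symmetric] da[OF u] dd act_W_mult[OF u]
      by (simp add: algebra_simps)
  qed simp
  also have "\<dots> = (\<Sum>u\<in>W. act u (g_inv * a_plus \<alpha>) * d (f (u ** s \<alpha>)) * f' u +
      act u g_inv * act u (b_plus \<alpha>) * d (f u) * f' u)"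
    unfolding sum.distrib a ..
  also have "\<dots> = pair (bullet D (Tplus \<alpha>) f) f'"
    unfolding pair_def
  proof (rule sum.cong)
    fix u assume u: "u \<in> W"
    show "act u (g_inv * a_plus \<alpha>) * d (f (u ** s \<alpha>)) * f' u +
        act u g_inv * act u (b_plus \<alpha>) * d (f u) * f' u =
        act u g_inv * (bullet D (Tplus \<alpha>) f u * f' u)"
      unfolding bullet_T(1)[OF \<alpha> u] d_def[symmetric] act_W_mult[OF u] by (simp add: algebra_simps)
  qed simp
  finally show ?thesis by (simp add: d_def)
qed

lemma sum_dyn_act_invariant: "c \<in> W \<Longrightarrow> (\<Sum>u\<in>W. dyn_act u (dyn_act c a)) = (\<Sum>u\<in>W. dyn_act u a)"
proof -
  assume c: "c \<in> W"
  have bij: "bij_betw (\<lambda>u. u ** c) W W"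
    by (rule bij_betw_byWitness[where f' = "\<lambda>u. u ** matrix_inv c"])
      (auto simp: W_mult c W_inv simp flip: matrix_mul_assoc)
  have "(\<Sum>u\<in>W. dyn_act u (dyn_act c a)) = (\<Sum>u\<in>W. dyn_act (u ** c) a)"
    by (rule sum.cong) (simp_all add: dyn_act_W_dyn_act c)
  also have "\<dots> = (\<Sum>u\<in>W. dyn_act u a)" by (rule sum.reindex_bij_betw[OF bij])
  finally show ?thesis .
qed

text \<open>Letters leave the left operator from the outside and act first on the other argument,
  hence the reversal; each dynamical reflection that appears is absorbed by translating the sum over
  the group.\<close>

lemma sum_dyn_act_pair_word:
  assumes "set ws \<subseteq> B"
  shows "(\<Sum>u\<in>W. dyn_act u (pair (word_act Tplus ws f) f')) =
    (\<Sum>u\<in>W. dyn_act u (pair f (word_act Tminus (rev ws) f')))"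
  using assms
proof (induction ws arbitrary: f')
  case (Cons \<alpha> ws)
  then show ?case
    by (simp add: pair_adjoint sum_dyn_act_invariant reflection_in_W B_root word_act_append)
qed simp

text \<open>At x the inner sum runs over x w; re-indexing removes x, so the result is constant on
  the group, that is, a multiple of the identity.\<close>

lemma bullet_Y_Pi:
  "bullet D (Y_Pi D \<tau> h) (\<lambda>x. f x * f' x) x = dual_one D x * (\<Sum>u\<in>W. dyn_act u (pair f f'))"
proof -
  define Y where "Y = (\<lambda>v w. elt 1 v w \<odot> elt (1 / g_elt D \<tau> h) (mat 1) (mat 1) :: 'n twisted)"
  have sY: "supported (Y v w)" if "v \<in> W" "w \<in> W" for v w
    unfolding Y_def using that by (intro supported_tmult supported_elt one_in_W)
  have Y: "bullet D (Y v w) f x = (if x \<in> W then dyn_act v (act (x ** w) g_inv * f (x ** w)) else 0)"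
    if "v \<in> W" "w \<in> W" for v w f
    unfolding Y_def g_inv_def[symmetric] using that
    by (simp add: bullet_tmult supported_elt one_in_W bullet_elt W_mult act_W_1)
  have YPi: "Y_Pi D \<tau> h = (\<Sum>v\<in>W. \<Sum>w\<in>W. Y v w)" by (simp add: Y_Pi_def Y_def)
  have "bullet D (Y_Pi D \<tau> h) f x = (\<Sum>v\<in>W. \<Sum>w\<in>W. bullet D (Y v w) f x)" for f
    unfolding YPi
    by (subst bullet_sum, rule supported_sum, rule sY) (auto intro!: sum.cong bullet_sum sY)
  also have "(\<Sum>v\<in>W. \<Sum>w\<in>W. bullet D (Y v w) (\<lambda>x. f x * f' x) x) =
      dual_one D x * (\<Sum>v\<in>W. dyn_act v (pair f f'))"
  proof (cases "x \<in> W")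
    case True
    have bij: "bij_betw (\<lambda>w. x ** w) W W"
      by (rule bij_betw_byWitness[where f' = "\<lambda>u. matrix_inv x ** u"])
        (auto simp: W_mult True W_inv matrix_mul_assoc)
    have "(\<Sum>v\<in>W. \<Sum>w\<in>W. bullet D (Y v w) (\<lambda>x. f x * f' x) x) =
        (\<Sum>v\<in>W. dyn_act v (\<Sum>w\<in>W. act (x ** w) g_inv * (f (x ** w) * f' (x ** w))))"
      by (simp add: Y True dyn_act_W_sum)
    also have "(\<Sum>w\<in>W. act (x ** w) g_inv * (f (x ** w) * f' (x ** w))) = pair f f'"
      unfolding pair_def by (rule sum.reindex_bij_betw[OF bij])
    finally show ?thesis using True by (simp add: dual_one_eq)
  qed (simp add: Y dual_one_eq)
  finally show ?thesis .
qed

section \<open>From classes of meromorphic functions to functions of complex variables\<close>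

definition am :: "complex \<Rightarrow> complex \<Rightarrow> complex" where
  "am z l = - (th (h - z) * th l / (th z * th (h + l)))"

definition bm :: "complex \<Rightarrow> complex \<Rightarrow> complex" where
  "bm z l = th h * th (z + l) / (th z * th (h + l))"

abbreviation zv :: "int^'n \<Rightarrow> complex^'n \<Rightarrow> complex" where
  "zv \<mu> z \<equiv> pairing (cvec \<mu>) z"

abbreviation lv :: "complex^'n \<Rightarrow> int^'n \<Rightarrow> complex" where
  "lv l \<beta> \<equiv> pairing l (cvec (cv \<beta>))"

text \<open>\<open>phi ws x z l\<close> is the value at \<open>x\<close> of \<open>T\<^sup>-\<^sup>\<lambda>\<close> along the word \<open>ws\<close> applied to \<open>f\<close> at \<open>w\<^sub>0\<close>. The
  operators move \<open>x\<close> and \<open>l\<close>, but never \<open>z\<close>.\<close>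

fun phi :: "(int^'n) list \<Rightarrow> 'n wmat \<Rightarrow> complex^'n \<Rightarrow> complex^'n \<Rightarrow> complex" where
  "phi [] x z l = (if x = w0 then 1 else 0)"
| "phi (\<alpha> # ws) x z l =
    am (zv (x *v \<alpha>) z) (lv l \<alpha>) * phi ws (x ** s \<alpha>) z (cmat (s \<alpha>) *v l) +
    bm (zv (x *v \<alpha>) z) (lv l \<alpha>) * phi ws x z (cmat (s \<alpha>) *v l)"

lemma is_mero_am: "is_mero (\<lambda>p. am (z_lin \<mu> p) (l_lin \<nu> p))"
  and is_mero_bm: "is_mero (\<lambda>p. bm (z_lin \<mu> p) (l_lin \<nu> p))"
  unfolding am_def bm_def
  by (auto intro!: is_mero_uminus is_mero_divide is_mero_mult is_mero_theta)

lemma a_minus_abs: "a_minus \<alpha> = abs_mero (\<lambda>p. am (z_lin \<alpha> p) (l_lin (cv \<alpha>) p))"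
  and b_minus_abs: "b_minus \<alpha> = abs_mero (\<lambda>p. bm (z_lin \<alpha> p) (l_lin (cv \<alpha>) p))"
  unfolding a_minus_def b_minus_def am_def bm_def theta_at_def
  by (simp_all add: abs_mero_uminus abs_mero_divide abs_mero_mult is_mero_divide is_mero_mult is_mero_theta)

text \<open>At x the action on z only turns \<alpha> into x \<alpha> in a coefficient, and the
  dynamical reflection substitutes its matrix for \<open>l\<close>; this is the recursion of
  \<open>phi\<close>.\<close>

lemma word_act_phi:
  assumes "set ws \<subseteq> B" "x \<in> W"
  shows "is_mero (\<lambda>p. phi ws x (fst p) (snd p)) \<and>
    word_act Tminus ws (fbasis w0) x = abs_mero (\<lambda>p. phi ws x (fst p) (snd p))"
  using assms
proof (induction ws arbitrary: x)
  case Nil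
  then show ?case by (simp add: fbasis_def abs_mero_0 abs_mero_1 is_mero_const)
next
  case (Cons \<alpha> ws)
  have \<alpha>: "\<alpha> \<in> B" and ws: "set ws \<subseteq> B" and x: "x \<in> W" using Cons.prems by auto
  note \<alpha>R = B_root[OF \<alpha>]
  note sW = reflection_in_W[OF \<alpha>R]
  interpret s: invertible_wmat "s \<alpha>" "s \<alpha>" by unfold_locales (simp_all add: reflection_involution \<alpha>R)
  interpret x: invertible_wmat x "matrix_inv x" by (rule W_invertible[OF x])
  note IH = Cons.IH[OF ws]
  have d: "dyn_act (s \<alpha>) (word_act Tminus ws (fbasis w0) y) =
      abs_mero (\<lambda>p. phi ws y (fst p) (cmat (s \<alpha>) *v snd p))"
    and dm: "is_mero (\<lambda>p. phi ws y (fst p) (cmat (s \<alpha>) *v snd p))" if "y \<in> W" for y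
    using IH[OF that] s.dyn_act_abs[of "\<lambda>p. phi ws y (fst p) (snd p)"]
      s.is_mero_dyn_act[of "\<lambda>p. phi ws y (fst p) (snd p)"]
    by (simp_all add: block_def)
  have a: "act x (a_minus \<alpha>) = abs_mero (\<lambda>p. am (z_lin (x *v \<alpha>) p) (l_lin (cv \<alpha>) p))"
    and b: "act x (b_minus \<alpha>) = abs_mero (\<lambda>p. bm (z_lin (x *v \<alpha>) p) (l_lin (cv \<alpha>) p))"
    unfolding a_minus_abs b_minus_abs
    by (simp_all add: x.act_abs is_mero_am is_mero_bm z_lin_block)
  note xs = W_mult[OF x sW]
  have "is_mero (\<lambda>p. phi (\<alpha> # ws) x (fst p) (snd p))"
    unfolding phi.simps z_lin_def[symmetric] l_lin_def[symmetric]
    by (intro is_mero_add is_mero_mult is_mero_am is_mero_bm dm xs x)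
  moreover have "word_act Tminus (\<alpha> # ws) (fbasis w0) x =
      abs_mero (\<lambda>p. phi (\<alpha> # ws) x (fst p) (snd p))"
    unfolding phi.simps z_lin_def[symmetric] l_lin_def[symmetric]
    by (simp add: bullet_T \<alpha> x d[OF xs] d[OF x] a b abs_mero_add abs_mero_mult is_mero_mult
        is_mero_am is_mero_bm dm xs)
  ultimately show ?case ..
qed

end

section \<open>Matrix coefficients of the operators\<close>

text \<open>The value of \<open>f\<close> at \<open>t\<close> itself is irrelevant: at a removable singularity it is a junk value.\<close>

definition extends_to :: "(complex \<Rightarrow> complex) \<Rightarrow> complex \<Rightarrow> complex \<Rightarrow> bool" where
  "extends_to f t c \<longleftrightarrow> (\<exists>k. k analytic_on {t} \<and> k t = c \<and> (\<forall>\<^sub>F u in at t. f u = k u))"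

lemma extends_to_analytic: "f analytic_on {t} \<Longrightarrow> extends_to f t (f t)"
  unfolding extends_to_def by (intro exI[of _ f]) simp

lemma extends_to_add:
  assumes "extends_to f t a" "extends_to g t b"
  shows "extends_to (\<lambda>u. f u + g u) t (a + b)"
proof -
  obtain k l where "k analytic_on {t}" "k t = a" "\<forall>\<^sub>F u in at t. f u = k u"
    "l analytic_on {t}" "l t = b" "\<forall>\<^sub>F u in at t. g u = l u"
    using assms unfolding extends_to_def by blast
  then show ?thesis unfolding extends_to_def
    by (intro exI[of _ "\<lambda>u. k u + l u"]) (auto intro: analytic_on_add elim: eventually_elim2)
qed

lemma extends_to_mult:
  assumes "extends_to f t a" "extends_to g t b"
  shows "extends_to (\<lambda>u. f u * g u) t (a * b)"
proof -
  obtain k l where "k analytic_on {t}" "k t = a" "\<forall>\<^sub>F u in at t. f u = k u"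
    "l analytic_on {t}" "l t = b" "\<forall>\<^sub>F u in at t. g u = l u"
    using assms unfolding extends_to_def by blast
  then show ?thesis unfolding extends_to_def
    by (intro exI[of _ "\<lambda>u. k u * l u"]) (auto intro: analytic_on_mult elim: eventually_elim2)
qed

lemma extends_to_const: "extends_to (\<lambda>u. c) t c"
  using extends_to_analytic[of "\<lambda>u. c" t] by simp

lemma extends_to_cmult: "extends_to f t a \<Longrightarrow> extends_to (\<lambda>u. c * f u) t (c * a)"
  by (rule extends_to_mult[OF extends_to_const])

lemma extends_to_tendsto:
  assumes "extends_to f t c"
  shows "f \<midarrow>t\<rightarrow> c"
proof -
  obtain k where k: "k analytic_on {t}" "k t = c" "\<forall>\<^sub>F u in at t. f u = k u"
    using assms unfolding extends_to_def by blast
  then have "k \<midarrow>t\<rightarrow> c" using analytic_at_imp_isCont[OF k(1)] by (simp add: isCont_def)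
  then show ?thesis using k(3) tendsto_cong by blast
qed

lemma extends_to_unique: "extends_to f t a \<Longrightarrow> extends_to f t b \<Longrightarrow> a = b"
  using extends_to_tendsto LIM_unique by blast

lemma analytic_slope:
  assumes "k analytic_on {t}"
  shows "(\<lambda>u. if u = t then deriv k t else (k u - k t) / (u - t)) analytic_on {t}"
proof -
  obtain S where S: "open S" "t \<in> S" "k holomorphic_on S" using assms analytic_at by blast
  from pole_lemma_open[OF S(3,1), of t] show ?thesis using S analytic_at by blast
qed

text \<open>Numerator and denominator are both divided by u - t. The quotient of the two slopes is
  analytic, since the slope of \<open>d\<close> at t is its nonzero derivative.\<close>

lemma extends_to_divide_simple_zero:
  assumes f: "extends_to f t 0" and d: "d analytic_on {t}" "d t = 0" "deriv d t \<noteq> 0"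
  shows "\<exists>c. extends_to (\<lambda>u. f u / d u) t c"
proof -
  obtain k where k: "k analytic_on {t}" "k t = 0" "\<forall>\<^sub>F u in at t. f u = k u"
    using f unfolding extends_to_def by blast
  define sl where "sl = (\<lambda>k u. if u = t then deriv k t else (k u - k t) / (u - t))"
  have a: "sl k analytic_on {t}" "sl d analytic_on {t}"
    unfolding sl_def using analytic_slope k(1) d(1) by blast+
  have "(\<lambda>u. sl k u / sl d u) analytic_on {t}"
    using a by (rule analytic_on_divide) (simp add: sl_def d)
  moreover have "\<forall>\<^sub>F u in at t. f u / d u = sl k u / sl d u"
    using k(3) eventually_neq_at_within[of t t UNIV]
    by eventually_elim (simp add: sl_def k d)
  ultimately show ?thesis unfolding extends_to_def by blast
qed

lemma extends_to_compose_affine: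
  assumes f: "extends_to f s c" and b: "b \<noteq> 0" and s: "s = a + b * t"
  shows "extends_to (\<lambda>u. f (a + b * u)) t c"
proof -
  obtain k where k: "k analytic_on {s}" "k s = c" "\<forall>\<^sub>F u in at s. f u = k u"
    using f unfolding extends_to_def by blast
  have lim: "filterlim (\<lambda>u. a + b * u) (at s) (at t)"
    unfolding s filterlim_at
  proof
    show "((\<lambda>u. a + b * u) \<longlongrightarrow> a + b * t) (at t)" by (intro tendsto_intros)
    show "\<forall>\<^sub>F u in at t. a + b * u \<in> UNIV \<and> a + b * u \<noteq> a + b * t"
      using eventually_neq_at_within[of t t UNIV] by eventually_elim (use b in simp)
  qed
  have "(k \<circ> (\<lambda>u. a + b * u)) analytic_on {t}"
    by (rule analytic_on_compose) (auto intro!: analytic_intros simp: k s[symmetric])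
  then show ?thesis
    unfolding extends_to_def using k lim
    by (intro exI[of _ "\<lambda>u. k (a + b * u)"]) (auto simp: o_def s[symmetric] filterlim_iff)
qed

text \<open>Extension values are unique, so they glue: the analytic function that extends
  \<open>f\<close> at t also extends it at every nearby point, hence agrees there with
  \<open>K\<close>.\<close>

lemma extends_to_everywhere_entire:
  assumes "\<And>t. \<exists>c. extends_to f t c"
  obtains K where "K holomorphic_on UNIV" "\<And>t. extends_to f t (K t)"
proof -
  obtain K where K: "\<And>t. extends_to f t (K t)" using assms by metis
  have "K analytic_on {t}" for t
  proof -
    obtain k where k: "k analytic_on {t}" "k t = K t" "\<forall>\<^sub>F u in at t. f u = k u"
      using K[of t] unfolding extends_to_def by blast
    obtain S where S: "open S" "t \<in> S" "k holomorphic_on S" using k(1) analytic_at by blast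
    obtain U where U: "open U" "t \<in> U" "\<And>u. u \<in> U \<Longrightarrow> u \<noteq> t \<Longrightarrow> f u = k u"
      using k(3) unfolding eventually_at_topological by blast
    have "K u = k u" if u: "u \<in> S \<inter> U" for u
    proof (cases "u = t")
      case False
      have "\<forall>\<^sub>F w in at u. w \<in> U - {t}"
        using u U(1) False by (intro eventually_at_in_open') auto
      then have ev: "\<forall>\<^sub>F w in at u. f w = k w" by eventually_elim (use U(3) in auto)
      have "k analytic_on {u}" using u S analytic_at by blast
      then have "extends_to f u (k u)" using ev unfolding extends_to_def by blast
      then show ?thesis using K extends_to_unique by blast
    qed (simp add: k)
    then have "K holomorphic_on S \<inter> U \<longleftrightarrow> k holomorphic_on S \<inter> U"
      by (intro holomorphic_cong) auto
    moreover have "k holomorphic_on S \<inter> U" using S(3) by (rule holomorphic_on_subset) auto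
    ultimately show ?thesis using S U analytic_at by (metis IntI open_Int)
  qed
  then have "K analytic_on UNIV" using analytic_on_analytic_at by blast
  then show thesis using that K analytic_imp_holomorphic by blast
qed

section \<open>Translation behaviour, zeros and reduced words\<close>

context elliptic_root_datum
begin

lemma cmat_reflection: "cmat (s \<alpha>) *v l = l - lv l \<alpha> *s cvec \<alpha>"
proof -
  have "(cmat (s \<alpha>) *v l) $ i = (l - lv l \<alpha> *s cvec \<alpha>) $ i" for i
  proof -
    have entry: "s \<alpha> $ i $ j = (if i = j then 1 else 0) - cv \<alpha> $ j * \<alpha> $ i" for j
      by (simp add: reflection_def matrix_def pairing_axis_left) (simp add: axis_def)
    have "(cmat (s \<alpha>) *v l) $ i =
        (\<Sum>j\<in>UNIV. (if i = j then l $ j else 0) - l $ j * of_int (cv \<alpha> $ j) * of_int (\<alpha> $ i))"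
      by (auto simp: matrix_vector_mult_def cmat_def entry left_diff_distrib intro!: sum.cong)
    then show ?thesis
      by (simp add: sum_subtractf pairing_def cvec_def sum_distrib_right)
  qed
  then show ?thesis by (simp add: vec_eq_iff)
qed

lemma cmat_reflection_twice: "\<alpha> \<in> R \<Longrightarrow> cmat (s \<alpha>) *v (cmat (s \<alpha>) *v l) = l"
  by (simp add: matrix_vector_mul_assoc reflection_involution cmat_one flip: cmat_mult)

definition rhoc :: "complex^'n" where
  "rhoc = (1 / 2) *s cvec two_rho"

lemma reflection_rhoc: "\<alpha> \<in> B \<Longrightarrow> cmat (s \<alpha>) *v rhoc = rhoc - cvec \<alpha>"
  by (simp add: rhoc_def matrix_vector_scale cmat_cvec simple_reflection_two_rho cvec_diff cvec_scale vec_eq_iff)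

lemma lv_rhoc: "\<alpha> \<in> B \<Longrightarrow> lv rhoc \<alpha> = 1"
proof -
  assume \<alpha>: "\<alpha> \<in> B"
  have "lv rhoc \<alpha> *s cvec \<alpha> = 1 *s cvec \<alpha>"
    using reflection_rhoc[OF \<alpha>] unfolding cmat_reflection by (simp add: vec_eq_iff)
  moreover have "cvec \<alpha> \<noteq> 0" using root_nonzero B_root \<alpha> cvec_eq_0_iff by blast
  ultimately show ?thesis by (auto simp: vec_eq_iff)
qed

lemma longest_rhoc: "cmat w0 *v rhoc = - rhoc"
  by (simp add: rhoc_def matrix_vector_scale cmat_cvec longest_two_rho cvec_minus vec_eq_iff)

text \<open>The exponent that governs translations by \<eta>. The shift of \<open>l\<close> by h
  \<rho> is what makes the change along a crossing edge proportional to h and that along a staying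
  edge proportional to l_\<alpha>, matching the multipliers of the two coefficients.\<close>

definition weight :: "'n wmat \<Rightarrow> complex^'n \<Rightarrow> int^'n \<Rightarrow> complex" where
  "weight x l \<eta> = pairing (cmat x *v (h *s rhoc - l)) (cvec \<eta>)"

lemma weight_cross:
  assumes "\<alpha> \<in> B"
  shows "weight (x ** s \<alpha>) (cmat (s \<alpha>) *v l) \<eta> = weight x l \<eta> - h * of_int (pairing (x *v \<alpha>) \<eta>)"
proof -
  have "cmat (x ** s \<alpha>) *v (h *s rhoc - cmat (s \<alpha>) *v l) =
      cmat x *v (cmat (s \<alpha>) *v (h *s rhoc - cmat (s \<alpha>) *v l))"
    by (simp add: cmat_mult matrix_vector_mul_assoc)
  also have "cmat (s \<alpha>) *v (h *s rhoc - cmat (s \<alpha>) *v l) = (h *s rhoc - l) - h *s cvec \<alpha>"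
    using assms by (simp add: matrix_vector_mult_diff_distrib matrix_vector_scale cmat_reflection_twice
        B_root reflection_rhoc vec_eq_iff algebra_simps)
  finally show ?thesis
    unfolding weight_def matrix_vector_mult_diff_distrib[of _ "h *s rhoc - l"]
    by (simp add: pairing_diff_left matrix_vector_scale cmat_cvec pairing_scale_left pairing_cvec)
qed

lemma weight_stay:
  "weight x (cmat (s \<alpha>) *v l) \<eta> = weight x l \<eta> + lv l \<alpha> * of_int (pairing (x *v \<alpha>) \<eta>)"
proof -
  have "h *s rhoc - cmat (s \<alpha>) *v l = (h *s rhoc - l) + lv l \<alpha> *s cvec \<alpha>"
    by (simp add: cmat_reflection vec_eq_iff)
  then show ?thesis
    unfolding weight_def by (simp only: matrix_vector_right_distrib pairing_add_left
        matrix_vector_scale cmat_cvec pairing_scale_left pairing_cvec)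
qed

text \<open>Numerator and denominator have the same quadratic part in n, which cancels; up to an
  integer in the exponent only the term linear in h remains.\<close>

lemma am_shift: "am (z + lattice m n) l = unit_exp (of_int n * h) * am z l"
proof -
  have "theta_factor (- m) (- n) (h - z) = unit_exp (- of_int (m + n)) * (unit_exp (of_int n * h) * theta_factor m n z)"
    unfolding theta_factor_def unit_exp_add[symmetric]
    by (rule arg_cong[where f = unit_exp]) (simp add: field_simps)
  moreover have "unit_exp (- of_int (m + n)) = 1"
    using unit_exp_of_int[of "- (m + n)"] by simp
  moreover have "th (h - (z + lattice m n)) = theta_factor (- m) (- n) (h - z) * th (h - z)"
    using theta_add_period[of "h - z" "- m" "- n"] by (simp add: algebra_simps)
  ultimately show ?thesis
    unfolding am_def theta_add_period by (simp add: field_simps)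
qed

lemma bm_shift: "bm (z + lattice m n) l = unit_exp (- of_int n * l) * bm z l"
proof -
  have "theta_factor m n (z + l) = unit_exp (- of_int n * l) * theta_factor m n z"
    unfolding theta_factor_def unit_exp_add[symmetric]
    by (rule arg_cong[where f = unit_exp]) (simp add: field_simps)
  moreover have "th ((z + lattice m n) + l) = theta_factor m n (z + l) * th (z + l)"
    using theta_add_period[of "z + l" m n] by (simp add: algebra_simps)
  ultimately show ?thesis
    unfolding bm_def theta_add_period by (simp add: field_simps)
qed

lemma zv_shift:
  "zv \<mu> (z + c *s cvec \<nu>) = zv \<mu> z + of_int (pairing \<mu> \<nu>) * c"
  by (simp add: pairing_add_right pairing_scale_right pairing_cvec mult.commute)

text \<open>The multiplier of each coefficient is the change of \<open>weight\<close> along its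
  branch, so both branches acquire the same factor. The exponents telescope to the weight at the
  start minus the weight at w_0, where \<open>l\<close> has passed through all letters.\<close>

lemma phi_shift:
  assumes "set ws \<subseteq> B"
  shows "phi ws x (z + lattice m n *s cvec \<nu>) l =
    unit_exp (of_int n * (weight x l \<nu> - weight w0 (cmat (wprod (rev ws)) *v l) \<nu>)) * phi ws x z l"
  using assms
proof (induction ws arbitrary: x l)
  case Nil then show ?case by (simp add: cmat_one)
next
  case (Cons \<alpha> ws)
  then have \<alpha>: "\<alpha> \<in> B" and ws: "set ws \<subseteq> B" by auto
  define k where "k = pairing (x *v \<alpha>) \<nu>"
  define l' where "l' = cmat (s \<alpha>) *v l"
  define Q where "Q = weight w0 (cmat (wprod (rev (\<alpha> # ws))) *v l) \<nu>"
  have Q: "weight w0 (cmat (wprod (rev ws)) *v l') \<nu> = Q"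
    unfolding Q_def l'_def by (simp add: wprod_append cmat_mult matrix_vector_mul_assoc)
  have zs: "zv (x *v \<alpha>) (z + lattice m n *s cvec \<nu>) =
      zv (x *v \<alpha>) z + (of_int (k * m) + of_int (k * n) * \<tau>)"
    unfolding zv_shift k_def by (simp add: algebra_simps)
  have a: "unit_exp (of_int (k * n) * h) * unit_exp (of_int n * (weight (x ** s \<alpha>) l' \<nu> - Q)) =
      unit_exp (of_int n * (weight x l \<nu> - Q))"
    unfolding l'_def weight_cross[OF \<alpha>] k_def[symmetric] unit_exp_add[symmetric]
    by (rule arg_cong[where f = unit_exp]) (simp add: algebra_simps)
  have b: "unit_exp (- of_int (k * n) * lv l \<alpha>) * unit_exp (of_int n * (weight x l' \<nu> - Q)) =
      unit_exp (of_int n * (weight x l \<nu> - Q))"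
    unfolding l'_def weight_stay k_def[symmetric] unit_exp_add[symmetric]
    by (rule arg_cong[where f = unit_exp]) (simp add: algebra_simps)
  have "phi (\<alpha> # ws) x (z + lattice m n *s cvec \<nu>) l =
      unit_exp (of_int (k * n) * h) * unit_exp (of_int n * (weight (x ** s \<alpha>) l' \<nu> - Q)) *
        (am (zv (x *v \<alpha>) z) (lv l \<alpha>) * phi ws (x ** s \<alpha>) z l') +
      unit_exp (- of_int (k * n) * lv l \<alpha>) * unit_exp (of_int n * (weight x l' \<nu> - Q)) *
        (bm (zv (x *v \<alpha>) z) (lv l \<alpha>) * phi ws x z l')"
    unfolding phi.simps zs am_shift bm_shift l'_def[symmetric] Cons.IH[OF ws] Q by (simp only: mult_ac)
  also have "\<dots> = unit_exp (of_int n * (weight x l \<nu> - Q)) * phi (\<alpha> # ws) x z l"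
    unfolding a b phi.simps l'_def[symmetric] by (simp only: distrib_left)
  finally show ?case unfolding Q_def .
qed

text \<open>The sign of \<open>x\<inverse> \<beta>\<close> changes only along the edge from \<open>x\<close> to \<open>x s\<^sub>\<alpha>\<close> with \<open>x \<alpha> = \<beta>\<close>, whose coefficient
  vanishes where \<open>z\<^sub>\<beta> = h\<close>.\<close>

lemma phi_eq_0_at_theta_zero:
  assumes "set ws \<subseteq> B" "x \<in> W" "\<beta> \<in> P" "matrix_inv x *v \<beta> \<in> P" "th (h - zv \<beta> z) = 0"
  shows "phi ws x z l = 0"
  using assms
proof (induction ws arbitrary: x l)
  case Nil
  then have "x \<noteq> w0" using inversions_longest by (auto simp: inversions_def)
  then show ?case by simp
next
  case (Cons \<alpha> ws)
  then have \<alpha>: "\<alpha> \<in> B" and ws: "set ws \<subseteq> B" and x: "x \<in> W" by auto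
  have 1: "phi ws x z (cmat (s \<alpha>) *v l) = 0" using Cons by auto
  have 2: "am (zv (x *v \<alpha>) z) (lv l \<alpha>) * phi ws (x ** s \<alpha>) z (cmat (s \<alpha>) *v l) = 0"
  proof (cases "matrix_inv x *v \<beta> = \<alpha>")
    case True
    then have "x *v \<alpha> = \<beta>" using W_inv_apply[OF x] by auto
    then show ?thesis using Cons.prems by (simp add: am_def)
  next
    case False
    then have "s \<alpha> *v (matrix_inv x *v \<beta>) \<in> P" using simple_reflection_pos[OF \<alpha>] Cons.prems by blast
    moreover have "matrix_inv (x ** s \<alpha>) = s \<alpha> ** matrix_inv x"
      by (simp add: W_inv_mult x reflection_in_W B_root \<alpha> reflection_inv)
    moreover have "x ** s \<alpha> \<in> W" using x \<alpha> by (simp add: W_mult simple_in_W)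
    ultimately show ?thesis using Cons.IH[OF ws] Cons.prems by (simp add: matrix_vector_mul_assoc)
  qed
  show ?case unfolding phi.simps 1 2 by simp
qed

text \<open>The staying coefficient contains \<theta>(h), so only the path that crosses at every
  letter is left, and it does not end at w_0.\<close>

lemma phi_eq_0_of_theta_h:
  assumes "th h = 0" "x ** wprod ws \<noteq> w0"
  shows "phi ws x z l = 0"
  using assms(2)
proof (induction ws arbitrary: x l)
  case (Cons \<alpha> ws)
  have "bm z l = 0" for z l by (simp add: bm_def assms(1))
  moreover have "x ** s \<alpha> ** wprod ws \<noteq> w0" using Cons.prems by (simp add: matrix_mul_assoc)
  ultimately show ?case using Cons.IH by simp
qed simp

lemma card_inversions_mult_wprod:
  assumes "set ws \<subseteq> B" "x \<in> W"
  shows "card (inversions (x ** wprod ws)) \<le> card (inversions x) + length ws"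
  using assms
proof (induction ws arbitrary: x)
  case (Cons \<alpha> ws)
  then have "x ** s \<alpha> \<in> W" by (simp add: W_mult simple_in_W)
  then have "card (inversions (x ** s \<alpha> ** wprod ws)) \<le> card (inversions (x ** s \<alpha>)) + length ws"
    using Cons by simp
  then show ?case using card_inversions_mult_le[of x \<alpha>] Cons.prems by (simp add: matrix_mul_assoc)
qed simp

text \<open>Each letter adds at most one inversion, whether it crosses or stays, and w_0 requires
  all positive roots.\<close>

lemma phi_short_word:
  assumes "set ws \<subseteq> B" "x \<in> W" "card (inversions x) + length ws < card P"
  shows "phi ws x z l = 0"
  using assms
proof (induction ws arbitrary: x l)
  case Nil
  then show ?case using inversions_longest by auto
next
  case (Cons \<alpha> ws)
  then have \<alpha>: "\<alpha> \<in> B" and ws: "set ws \<subseteq> B" and x: "x \<in> W" by auto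
  have "x ** s \<alpha> \<in> W" using x \<alpha> by (simp add: W_mult simple_in_W)
  moreover have "card (inversions (x ** s \<alpha>)) + length ws < card P"
    using card_inversions_mult_le[OF x \<alpha>] Cons.prems by simp
  ultimately show ?case using Cons.IH[OF ws] Cons.prems by simp
qed

text \<open>Staying wastes a letter, and so does crossing to fewer inversions; both leave too few
  letters to reach w_0. On the remaining path each crossing contributes its new inversion x
  \<alpha>.\<close>

lemma phi_reduced_word:
  assumes "set ws \<subseteq> B" "x \<in> W" "card (inversions x) + length ws = card P" "x ** wprod ws = w0"
  shows "phi ws x z l = (\<Prod>\<beta>\<in>P - inversions x. am (zv \<beta> z) (lv (cmat x *v l) \<beta>))"
  using assms
proof (induction ws arbitrary: x l)
  case Nil
  then have "inversions x = P" using inversions_longest by simp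
  then show ?case using Nil by simp
next
  case (Cons \<alpha> ws)
  then have \<alpha>: "\<alpha> \<in> B" and ws: "set ws \<subseteq> B" and x: "x \<in> W" by auto
  define \<gamma> where "\<gamma> = x *v \<alpha>"
  have xs: "x ** s \<alpha> \<in> W" using x \<alpha> by (simp add: W_mult simple_in_W)
  have prod: "x ** s \<alpha> ** wprod ws = w0" using Cons.prems by (simp add: matrix_mul_assoc)
  have pos: "x *v \<alpha> \<in> P"
  proof (rule ccontr)
    assume "x *v \<alpha> \<notin> P"
    from card_inversions_neg[OF x \<alpha> this] have "card (inversions (x ** s \<alpha>)) + length ws < card P"
      using Cons.prems by simp
    then show False
      using card_inversions_mult_wprod[OF ws xs] unfolding prod inversions_longest by simp
  qed
  have card: "card (inversions (x ** s \<alpha>)) + length ws = card P"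
    using card_inversions_pos[OF x \<alpha> pos] Cons.prems by simp
  have 0: "phi ws x z (cmat (s \<alpha>) *v l) = 0"
    by (rule phi_short_word[OF ws x]) (use Cons.prems in simp)
  \<comment> \<open>The vector x l is constant along the path, so all factors can be expressed by
    the initial one.\<close>
  have l: "cmat (x ** s \<alpha>) *v (cmat (s \<alpha>) *v l) = cmat x *v l"
    using \<alpha> by (simp add: cmat_mult cmat_reflection_twice B_root flip: matrix_vector_mul_assoc)
  have set: "P - inversions x = insert \<gamma> (P - inversions (x ** s \<alpha>))" "\<gamma> \<notin> P - inversions (x ** s \<alpha>)"
    using inversions_mult_simple(1,2)[OF x \<alpha> pos] pos unfolding \<gamma>_def by auto
  have "lv (cmat x *v l) \<gamma> = lv l \<alpha>"
    unfolding \<gamma>_def by (rule pairing_coroot_W[OF x B_root[OF \<alpha>]])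
  then show ?case
    unfolding phi.simps 0 Cons.IH[OF ws xs card prod] l set(1)
    using set(2) finite_P by (simp add: \<gamma>_def)
qed

section \<open>Restriction to lines in a cocharacter direction\<close>

lemma analytic_theta [analytic_intros]:
  "f analytic_on S \<Longrightarrow> (\<lambda>t. th (f t)) analytic_on S"
  using analytic_on_compose_gen[of f S th UNIV] holomorphic_theta
  by (simp add: o_def analytic_on_open)

definition line :: "complex^'n \<Rightarrow> int^'n \<Rightarrow> complex \<Rightarrow> complex^'n" where
  "line z \<nu> t = z + t *s cvec \<nu>"

lemma zv_line: "zv \<mu> (line z \<nu> t) = zv \<mu> z + of_int (pairing \<mu> \<nu>) * t"
  unfolding line_def by (rule zv_shift)

lemma analytic_zv_line [analytic_intros]: "(\<lambda>t. zv \<mu> (line z \<nu> t)) analytic_on S"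
  unfolding zv_line by (intro analytic_intros)

text \<open>Keeps the denominators in \<open>l\<close> away from zero. All roots are included, not
  only simple ones, so that the condition passes to the reflected \<open>l\<close> in the
  recursion.\<close>

definition generic :: "complex^'n \<Rightarrow> bool" where
  "generic l \<longleftrightarrow> (\<forall>\<gamma>\<in>R. th (h + lv l \<gamma>) \<noteq> 0)"

lemma lv_reflection: "\<beta> \<in> R \<Longrightarrow> \<gamma> \<in> R \<Longrightarrow> lv (cmat (s \<beta>) *v l) \<gamma> = lv l (s \<beta> *v \<gamma>)"
  using pairing_coroot_W[of "s \<beta>" "s \<beta> *v \<gamma>" l]
  by (simp add: reflection_in_W reflection_root reflection_twice)

lemma generic_reflection: "\<alpha> \<in> B \<Longrightarrow> generic l \<Longrightarrow> generic (cmat (s \<alpha>) *v l)"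
  unfolding generic_def by (simp add: lv_reflection B_root reflection_root)

lemma am_eq: "am e a = - (th (h - e) * th a / th (h + a)) / th e"
  and bm_eq: "bm e a = th h * th (e + a) / th (h + a) / th e"
  by (simp_all add: am_def bm_def mult.commute)

lemma analytic_am:
  assumes "f analytic_on {t}" "th (f t) \<noteq> 0" "th (h + a) \<noteq> 0"
  shows "(\<lambda>u. am (f u) a) analytic_on {t}" "(\<lambda>u. bm (f u) a) analytic_on {t}"
  unfolding am_def bm_def using assms by (auto intro!: analytic_intros)

text \<open>The denominators are theta at roots of z, nonzero near t, and theta at h + l_\<gamma>,
  constant on the line and nonzero by genericity.\<close>

lemma phi_analytic:
  assumes "set ws \<subseteq> B" "x \<in> W" "generic l" "\<And>\<gamma>. \<gamma> \<in> R \<Longrightarrow> th (zv \<gamma> (line z \<nu> t)) \<noteq> 0"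
  shows "(\<lambda>u. phi ws x (line z \<nu> u) l) analytic_on {t}"
  using assms
proof (induction ws arbitrary: x l)
  case (Cons \<alpha> ws)
  then have \<alpha>: "\<alpha> \<in> B" and ws: "set ws \<subseteq> B" and x: "x \<in> W" by auto
  have "x *v \<alpha> \<in> R" using x \<alpha> W_root B_root by blast
  then have nz: "th (zv (x *v \<alpha>) (line z \<nu> t)) \<noteq> 0" "th (h + lv l \<alpha>) \<noteq> 0"
    using Cons.prems B_root[OF \<alpha>] by (auto simp: generic_def)
  have xs: "x ** s \<alpha> \<in> W" using x \<alpha> by (simp add: W_mult simple_in_W)
  note IH = Cons.IH[OF ws _ generic_reflection[OF \<alpha> Cons.prems(3)] Cons.prems(4)]
  show ?case unfolding phi.simps
    by (intro analytic_on_add analytic_on_mult analytic_am IH x xs analytic_intros nz)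
qed simp

text \<open>The two coefficients have the same residue at 0: over the common denominator the
  numerator is \<theta>(h) \<theta>(a - e) - \<theta>(h - e) \<theta>(a), which vanishes at e =
  0.\<close>

lemma residue_difference_extends:
  assumes "th (h + a) \<noteq> 0"
  shows "\<exists>k. extends_to (\<lambda>e. am e a - bm (- e) a) 0 k"
proof -
  define N where "N = (\<lambda>e. (th h * th (a - e) - th (h - e) * th a) / th (h + a))"
  have "N analytic_on {0}" unfolding N_def using assms by (auto intro!: analytic_intros)
  then have "extends_to N 0 0" using extends_to_analytic[of N 0] by (simp add: N_def)
  from extends_to_divide_simple_zero[OF this, of th]
  have "\<exists>k. extends_to (\<lambda>e. N e / th e) 0 k"
    using analytic_theta[of "\<lambda>e. e" "{0}"] theta_deriv_at_zero[of 0] by simp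
  moreover have "N e / th e = am e a - bm (- e) a" for e
    unfolding N_def am_eq bm_eq by (simp add: theta_minus diff_divide_distrib)
  ultimately show ?thesis by simp
qed

lemma weight_reflection: "\<beta> \<in> R \<Longrightarrow> weight (s \<beta> ** x) l (cv \<beta>) = - weight x l (cv \<beta>)"
  unfolding weight_def cmat_mult matrix_vector_mul_assoc[symmetric]
  by (simp add: lv_reflection reflection_self coroot_uminus cvec_minus pairing_minus_right)

text \<open>Provides the exponents across the edge between x and x s_\<alpha>: it is h - l_\<alpha>
  for \<open>l\<close>, and h + l_\<alpha> once \<open>l\<close> has been reflected.\<close>

lemma weight_simple:
  assumes "x \<in> W" "\<alpha> \<in> B"
  shows "weight x l (cv (x *v \<alpha>)) = h - lv l \<alpha>"
  unfolding weight_def pairing_coroot_W[OF assms(1) B_root[OF assms(2)]]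
  by (simp add: pairing_diff_left pairing_scale_left lv_rhoc assms(2))

text \<open>Here \<open>f\<close> and \<open>g\<close> stand for the values at x and x s_\<alpha>,
  already multiplied by theta at z_\<beta> with \<beta> = x \<alpha>. The relation between u and v
  kills the pole added by the coefficients, and the equality of residues yields the new relation
  between the two combinations.\<close>

lemma simple_pole_cancellation:
  fixes n :: int and f g :: "complex \<Rightarrow> complex"
  assumes a: "th (h + a) \<noteq> 0" and b: "b \<noteq> 0" and t: "z0 + b * t = lattice m n"
    and f: "extends_to f t u" and g: "extends_to g t v" and uv: "u = unit_exp (of_int n * (h + a)) * v"
  shows "\<exists>c. extends_to (\<lambda>t. am (z0 + b * t) a * g t + bm (z0 + b * t) a * f t) t c \<and>
    extends_to (\<lambda>t. am (- (z0 + b * t)) a * f t + bm (- (z0 + b * t)) a * g t) t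
      (c / unit_exp (of_int n * (h - a)))"
proof -
  define c0 :: complex where "c0 = lattice m n"
  define F where "F = (\<lambda>t. am (z0 + b * t) a * g t + bm (z0 + b * t) a * f t)"
  define G where "G = (\<lambda>t. am (- (z0 + b * t)) a * f t + bm (- (z0 + b * t)) a * g t)"
  define K where "K = unit_exp (of_int n * (h - a))"
  define A where "A = (\<lambda>e. - (th (h - e) * th a / th (h + a)))"
  define A' where "A' = (\<lambda>e. th h * th (e + a) / th (h + a))"
  note t' = t[folded c0_def]
  \<comment> \<open>The residue of the first combination up to a nonzero factor. Moving the period
    out of both theta functions gives multipliers whose ratio is exactly the factor in
    \<open>uv\<close>.\<close>
  have "A c0 * v + A' c0 * u = 0"
  proof -
    have 1: "th (h - c0) = theta_factor (- m) (- n) h * th h"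
      using theta_add_period[of h "- m" "- n"] by (simp add: c0_def algebra_simps)
    have 2: "th (c0 + a) = theta_factor m n a * th a"
      using theta_add_period[of a m n] by (simp add: c0_def algebra_simps)
    have "theta_factor m n a * unit_exp (of_int n * (h + a)) =
        unit_exp (of_int (m + n)) * theta_factor (- m) (- n) h"
      unfolding theta_factor_def unit_exp_add[symmetric]
      by (rule arg_cong[where f = unit_exp]) (simp add: field_simps)
    then have "theta_factor m n a * unit_exp (of_int n * (h + a)) = theta_factor (- m) (- n) h"
      by (simp only: unit_exp_of_int mult_1)
    then have 3: "theta_factor m n a * u = theta_factor (- m) (- n) h * v"
      unfolding uv by (simp add: mult.assoc[symmetric])
    have "A c0 * v + A' c0 * u = th h * th a / th (h + a) *
        (theta_factor m n a * u - theta_factor (- m) (- n) h * v)"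
      unfolding A_def A'_def 1 2 by (simp add: algebra_simps diff_divide_distrib)
    then show ?thesis unfolding 3 by simp
  qed
  moreover have "extends_to (\<lambda>t. A (z0 + b * t) * g t + A' (z0 + b * t) * f t) t
      (A (z0 + b * t) * v + A' (z0 + b * t) * u)"
    by (intro extends_to_add extends_to_mult f g extends_to_analytic)
      (use a in \<open>auto simp: A_def A'_def intro!: analytic_intros\<close>)
  ultimately have num: "extends_to (\<lambda>t. A (z0 + b * t) * g t + A' (z0 + b * t) * f t) t 0"
    unfolding t' by simp
  have zero: "th (z0 + b * t) = 0"
    unfolding theta_eq_0_iff period_def t by blast
  have "((\<lambda>t. th (z0 + b * t)) has_field_derivative deriv th (z0 + b * t) * b) (at t)"
    by (rule DERIV_chain2[OF theta_has_deriv]) (auto intro!: derivative_eq_intros)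
  then have d: "deriv (\<lambda>t. th (z0 + b * t)) t \<noteq> 0"
    using DERIV_imp_deriv theta_deriv_at_zero[OF zero] b by force
  have "(\<lambda>t. th (z0 + b * t)) analytic_on {t}" by (intro analytic_intros)
  then obtain c where c: "extends_to F t c"
    using extends_to_divide_simple_zero[OF num _ zero d]
    by (auto simp: F_def A_def A'_def am_eq bm_eq add_divide_distrib diff_divide_distrib)
  obtain k where k: "extends_to (\<lambda>e. am e a - bm (- e) a) 0 k"
    using residue_difference_extends[OF a] by blast
  have F: "am (e + c0) a = unit_exp (of_int n * h) * am e a"
    "bm (- (e + c0)) a = unit_exp (of_int n * a) * bm (- e) a"
    "bm (e + c0) a = unit_exp (- of_int n * a) * bm e a"
    "am (- (e + c0)) a = unit_exp (- of_int n * h) * am (- e) a" for e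
    using am_shift[of e m n a] bm_shift[of e m n a] am_shift[of "- e" "- m" "- n" a]
      bm_shift[of "- e" "- m" "- n" a]
    by (simp_all add: c0_def algebra_simps)
  have e0: "0 = (z0 - c0) + b * t" "0 = - (z0 - c0) + - b * t" unfolding t'[symmetric] by simp_all
  define e where "e = (\<lambda>t. (z0 - c0) + b * t)"
  define e' where "e' = (\<lambda>t. - (z0 - c0) + - b * t)"
  have ec: "z0 + b * t = e t + c0" "e' t = - e t" for t by (simp_all add: e_def e'_def)
  have K: "K * unit_exp (of_int n * a) = unit_exp (of_int n * h)"
    "K * unit_exp (- of_int n * h) = unit_exp (- of_int n * a)"
    unfolding K_def unit_exp_add[symmetric] by (simp_all add: algebra_simps)
  \<comment> \<open>With this \<open>K\<close> the difference involves the coefficients only through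
    am - bm(-), which extends over 0; its value at t is a multiple of the relation \<open>uv\<close>
    and vanishes.\<close>
  have diff: "F t - K * G t = unit_exp (of_int n * h) * (am (e t) a - bm (- e t) a) * g t +
      - unit_exp (- of_int n * a) * (am (e' t) a - bm (- e' t) a) * f t" for t
  proof -
    have G: "G t = unit_exp (- of_int n * h) * am (- e t) a * f t + unit_exp (of_int n * a) * bm (- e t) a * g t"
      unfolding G_def ec(1) F ..
    have "K * G t = unit_exp (- of_int n * a) * am (- e t) a * f t + unit_exp (of_int n * h) * bm (- e t) a * g t"
      unfolding G K(1)[symmetric] K(2)[symmetric] by (simp only: distrib_left mult.assoc)
    moreover have "F t = unit_exp (of_int n * h) * am (e t) a * g t + unit_exp (- of_int n * a) * bm (e t) a * f t"
      unfolding F_def ec(1) F ..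
    ultimately show ?thesis
      unfolding ec(2) minus_minus by (simp only:) (simp add: algebra_simps)
  qed
  have "extends_to (\<lambda>t. F t - K * G t) t (unit_exp (of_int n * h) * k * v + - unit_exp (- of_int n * a) * k * u)"
    unfolding diff
  proof (intro extends_to_add extends_to_mult f g extends_to_const)
    show "extends_to (\<lambda>t. am (e t) a - bm (- e t) a) t k"
      unfolding e_def by (rule extends_to_compose_affine[OF k b e0(1)])
    show "extends_to (\<lambda>t. am (e' t) a - bm (- e' t) a) t k"
      unfolding e'_def by (rule extends_to_compose_affine[OF k _ e0(2)]) (simp add: b)
  qed
  moreover have "unit_exp (- of_int n * a) * unit_exp (of_int n * (h + a)) = unit_exp (of_int n * h)"
    unfolding unit_exp_add[symmetric] by (simp add: algebra_simps)
  then have "unit_exp (of_int n * h) * k * v =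
      unit_exp (- of_int n * a) * unit_exp (of_int n * (h + a)) * k * v" by simp
  then have "unit_exp (of_int n * h) * k * v + - unit_exp (- of_int n * a) * k * u = 0"
    unfolding uv by (simp add: mult_ac)
  ultimately have 0: "extends_to (\<lambda>t. F t - K * G t) t 0" by (simp only:)
  have "extends_to (\<lambda>t. inverse K * F t + - inverse K * (F t - K * G t)) t (inverse K * c + - inverse K * 0)"
    by (intro extends_to_add extends_to_cmult c 0)
  moreover have "inverse K * F t + - inverse K * (F t - K * G t) = G t" for t
    by (simp add: K_def field_simps)
  ultimately have "extends_to G t (c / K)" by (simp add: field_simps)
  then show ?thesis using c unfolding F_def G_def K_def by blast
qed

text \<open>The exponential factor is 1 if \<open>z\<^sub>\<beta> = 0\<close>; it accounts for the periods \<open>m + n \<tau>\<close> with \<open>n \<noteq> 0\<close>, to which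
  a translation by a cocharacter need not reduce.\<close>

lemma phi_simple_pole:
  assumes ws: "set ws \<subseteq> B" and l: "generic l" and \<beta>: "\<beta> \<in> R" "pairing \<beta> \<nu> \<noteq> 0"
    and t: "zv \<beta> (line z \<nu> t) = lattice m n"
    and others: "\<And>\<gamma>. \<gamma> \<in> R \<Longrightarrow> \<gamma> \<noteq> \<beta> \<Longrightarrow> \<gamma> \<noteq> - \<beta> \<Longrightarrow> th (zv \<gamma> (line z \<nu> t)) \<noteq> 0"
  shows "\<exists>C. \<forall>x\<in>W. extends_to (\<lambda>u. th (zv \<beta> (line z \<nu> u)) * phi ws x (line z \<nu> u) l) t (C x) \<and>
    C x = unit_exp (of_int n * weight x l (cv \<beta>)) * C (s \<beta> ** x)"
  using ws l
proof (induction ws arbitrary: l)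
  case Nil
  have "th (zv \<beta> (line z \<nu> t)) = 0" unfolding theta_eq_0_iff period_def t by blast
  then have "extends_to (\<lambda>u. th (zv \<beta> (line z \<nu> u))) t 0"
    using extends_to_analytic[of "\<lambda>u. th (zv \<beta> (line z \<nu> u))" t]
    by (simp add: analytic_theta analytic_zv_line)
  then have "extends_to (\<lambda>u. th (zv \<beta> (line z \<nu> u)) * c) t 0" for c
    using extends_to_mult[OF _ extends_to_const, of _ t 0 c] by simp
  then show ?case by (intro exI[of _ "\<lambda>_. 0"]) simp
next
  case (Cons \<alpha> ws)
  have \<alpha>: "\<alpha> \<in> B" and ws: "set ws \<subseteq> B" using Cons.prems by auto
  note \<alpha>R = B_root[OF \<alpha>]
  define Z where "Z = line z \<nu>"
  define l' where "l' = cmat (s \<alpha>) *v l"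
  define a where "a = lv l \<alpha>"
  define \<Phi> where "\<Phi> = (\<lambda>x u. th (zv \<beta> (Z u)) * phi ws x (Z u) l')"
  define \<Psi> where "\<Psi> = (\<lambda>x u. th (zv \<beta> (Z u)) * phi (\<alpha> # ws) x (Z u) l)"
  define K where "K = (\<lambda>x l. unit_exp (of_int n * weight x l (cv \<beta>)))"
  have a_nz: "th (h + a) \<noteq> 0" using Cons.prems \<alpha>R by (simp add: generic_def a_def)
  obtain C where C: "\<And>x. x \<in> W \<Longrightarrow> extends_to (\<Phi> x) t (C x)"
    "\<And>x. x \<in> W \<Longrightarrow> C x = K x l' * C (s \<beta> ** x)"
    using Cons.IH[OF ws generic_reflection[OF \<alpha> Cons.prems(2)]]
    unfolding \<Phi>_def Z_def l'_def K_def by meson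
  have xs: "x ** s \<alpha> \<in> W" "s \<beta> ** x \<in> W" if "x \<in> W" for x
    using that \<alpha>R \<beta> by (simp_all add: W_mult reflection_in_W)
  have \<Psi>: "\<Psi> x = (\<lambda>u. am (zv (x *v \<alpha>) (Z u)) a * \<Phi> (x ** s \<alpha>) u + bm (zv (x *v \<alpha>) (Z u)) a * \<Phi> x u)" for x
    unfolding \<Psi>_def \<Phi>_def phi.simps a_def l'_def by (simp add: algebra_simps)
  have KK: "K x l * K (s \<beta> ** x) l = 1" for x
    unfolding K_def by (simp add: weight_reflection \<beta> unit_exp_minus)
  have \<beta>\<beta>: "s \<beta> *v (s \<beta> *v \<gamma>) = \<gamma>" for \<gamma> using \<beta> by (simp add: reflection_twice)
  have ss: "s \<beta> ** (s \<beta> ** x) = x" for x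
    using \<beta> by (simp add: matrix_mul_assoc reflection_involution)
  have regular: "extends_to (\<Psi> x) t (am (zv (x *v \<alpha>) (Z t)) a * C (x ** s \<alpha>) + bm (zv (x *v \<alpha>) (Z t)) a * C x)"
    if x: "x \<in> W" "x *v \<alpha> \<noteq> \<beta>" "x *v \<alpha> \<noteq> - \<beta>" for x
  proof -
    have "th (zv (x *v \<alpha>) (Z t)) \<noteq> 0" unfolding Z_def using x W_root \<alpha>R by (intro others) auto
    then show ?thesis
      unfolding \<Psi> using a_nz
      by (intro extends_to_add extends_to_mult C xs x extends_to_analytic analytic_am)
        (simp_all add: Z_def analytic_zv_line)
  qed
  \<comment> \<open>The edge coincides with the reflection: s_\<beta> x = x s_\<alpha>, so the
    operator mixes just the two values tied by the induction hypothesis. The case x \<alpha> =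
    -\<beta> is this one seen from s_\<beta> x.\<close>
  have singular: "\<exists>c. extends_to (\<Psi> x) t c \<and> extends_to (\<Psi> (s \<beta> ** x)) t (c / K x l)"
    if x: "x \<in> W" "x *v \<alpha> = \<beta>" for x
  proof -
    have y: "s \<beta> ** x = x ** s \<alpha>" using reflection_W_root[OF x(1) \<alpha>R] x(2) by simp
    have ys: "s \<beta> ** x ** s \<alpha> = x"
      unfolding y using \<alpha>R by (simp add: reflection_involution flip: matrix_mul_assoc)
    have y\<alpha>: "s \<beta> ** x *v \<alpha> = - \<beta>"
      using x(2) reflection_self[OF \<beta>(1)] by (simp flip: matrix_vector_mul_assoc)
    have w: "weight x l (cv \<beta>) = h - a" using weight_simple[OF x(1) \<alpha>, of l] by (simp add: x(2) a_def)
    have "weight x l' (cv \<beta>) = h + a"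
      unfolding l'_def weight_stay w x(2) using pairing_self[OF \<beta>(1)] by (simp add: a_def)
    then have "C x = unit_exp (of_int n * (h + a)) * C (s \<beta> ** x)" using C(2)[OF x(1)] by (simp add: K_def)
    from simple_pole_cancellation[OF a_nz _ t[unfolded zv_line] C(1)[OF x(1)] C(1)[OF xs(2)[OF x(1)]] this]
    show ?thesis
      unfolding \<Psi> ys y\<alpha> x(2) y[symmetric] K_def w
      by (simp add: \<beta> Z_def zv_line cvec_minus pairing_minus_left)
  qed
  have "\<exists>c. extends_to (\<Psi> x) t c" if x: "x \<in> W" for x
  proof -
    consider "x *v \<alpha> = \<beta>" | "x *v \<alpha> = - \<beta>" | "x *v \<alpha> \<noteq> \<beta>" "x *v \<alpha> \<noteq> - \<beta>" by blast
    then show ?thesis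
    proof cases
      case 2
      then have "s \<beta> ** x *v \<alpha> = \<beta>"
        using reflection_self[OF \<beta>(1)] by (simp add: matrix_vector_minus flip: matrix_vector_mul_assoc)
      from singular[OF xs(2)[OF x] this] show ?thesis by (auto simp: ss)
    qed (use singular regular x in blast)+
  qed
  then obtain C' where C': "\<And>x. x \<in> W \<Longrightarrow> extends_to (\<Psi> x) t (C' x)" by metis
  have "C' x = K x l * C' (s \<beta> ** x)" if x: "x \<in> W" for x
  proof -
    consider "x *v \<alpha> = \<beta>" | "x *v \<alpha> = - \<beta>" | "x *v \<alpha> \<noteq> \<beta>" "x *v \<alpha> \<noteq> - \<beta>" by blast
    then show ?thesis
    proof cases
      case 1
      then obtain c where "extends_to (\<Psi> x) t c" "extends_to (\<Psi> (s \<beta> ** x)) t (c / K x l)"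
        using singular[OF x] by blast
      then have "C' x = c" "C' (s \<beta> ** x) = c / K x l"
        using C' x xs extends_to_unique by blast+
      then show ?thesis by (simp add: K_def)
    next
      case 2
      then have "s \<beta> ** x *v \<alpha> = \<beta>"
        using reflection_self[OF \<beta>(1)] by (simp add: matrix_vector_minus flip: matrix_vector_mul_assoc)
      then obtain c where "extends_to (\<Psi> (s \<beta> ** x)) t c" "extends_to (\<Psi> x) t (c / K (s \<beta> ** x) l)"
        using singular[OF xs(2)[OF x]] by (auto simp: ss)
      then have "C' (s \<beta> ** x) = c" "C' x = c / K (s \<beta> ** x) l"
        using C' x xs extends_to_unique by blast+
      moreover have "inverse (K (s \<beta> ** x) l) = K x l"
        using KK[of x] by (intro inverse_unique) (simp add: mult.commute)
      ultimately show ?thesis by (simp add: divide_inverse mult.commute)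
    next
      case 3
      define \<gamma> where "\<gamma> = x *v \<alpha>"
      define N where "N = pairing \<gamma> (cv \<beta>)"
      have y\<alpha>: "s \<beta> ** x *v \<alpha> = s \<beta> *v \<gamma>" by (simp add: \<gamma>_def flip: matrix_vector_mul_assoc)
      have ne: "s \<beta> *v \<gamma> \<noteq> \<beta>" "s \<beta> *v \<gamma> \<noteq> - \<beta>"
        using 3 \<beta>\<beta>[of \<gamma>] reflection_self[OF \<beta>(1)] by (auto simp: \<gamma>_def[symmetric] matrix_vector_minus)
      have "C' x = am (zv \<gamma> (Z t)) a * C (x ** s \<alpha>) + bm (zv \<gamma> (Z t)) a * C x"
        unfolding \<gamma>_def using regular[OF x 3] C'[OF x] extends_to_unique by blast
      also have "C (x ** s \<alpha>) = K (x ** s \<alpha>) l' * C (s \<beta> ** x ** s \<alpha>)"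
        using C(2)[OF xs(1)[OF x]] by (simp add: matrix_mul_assoc)
      also have "C x = K x l' * C (s \<beta> ** x)" by (rule C(2)[OF x])
      finally have 1: "C' x = am (zv \<gamma> (Z t)) a * (K (x ** s \<alpha>) l' * C (s \<beta> ** x ** s \<alpha>)) +
        bm (zv \<gamma> (Z t)) a * (K x l' * C (s \<beta> ** x))" .
      have 2: "C' (s \<beta> ** x) = am (zv (s \<beta> *v \<gamma>) (Z t)) a * C (s \<beta> ** x ** s \<alpha>) +
          bm (zv (s \<beta> *v \<gamma>) (Z t)) a * C (s \<beta> ** x)"
        using regular[of "s \<beta> ** x"] C'[OF xs(2)[OF x]] extends_to_unique xs(2)[OF x] ne unfolding y\<alpha> by blast
      \<comment> \<open>At t the arguments for \<gamma> and s_\<beta> \<gamma> differ by N times the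
        period z_\<beta>, so the coefficients at x and s_\<beta> x differ by multipliers; these
        match the changes of weight.\<close>
      have "zv (s \<beta> *v \<gamma>) (Z t) = zv \<gamma> (Z t) - of_int N * zv \<beta> (Z t)"
        unfolding reflection_apply by (simp add: cvec_diff cvec_scale pairing_diff_left pairing_scale_left N_def)
      also have "\<dots> = zv \<gamma> (Z t) + (of_int (- N * m) + of_int (- N * n) * \<tau>)"
        using t by (simp add: Z_def algebra_simps)
      finally have z: "zv (s \<beta> *v \<gamma>) (Z t) = zv \<gamma> (Z t) + (of_int (- N * m) + of_int (- N * n) * \<tau>)" .
      have "K x l * unit_exp (of_int (- N * n) * h) = K (x ** s \<alpha>) l'"
        unfolding K_def l'_def weight_cross[OF \<alpha>] \<gamma>_def[symmetric] N_def[symmetric] unit_exp_add[symmetric]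
        by (rule arg_cong[where f = unit_exp]) (simp add: algebra_simps)
      moreover have "K x l * unit_exp (- of_int (- N * n) * a) = K x l'"
        unfolding K_def l'_def weight_stay \<gamma>_def[symmetric] N_def[symmetric] unit_exp_add[symmetric] a_def
        by (rule arg_cong[where f = unit_exp]) (simp add: algebra_simps)
      ultimately show ?thesis
        unfolding 1 2 z am_shift bm_shift by (simp only: distrib_left mult.assoc[symmetric]) (simp only: mult_ac)
    qed
  qed
  then show ?case using C' unfolding \<Psi>_def Z_def K_def by blast
qed

end

section \<open>Orthogonality\<close>

context elliptic_curve
begin

lemma period_diff: "period a \<Longrightarrow> period b \<Longrightarrow> period (a - b)"
proof -
  assume "period a" "period b"
  then obtain m n m' n' :: int where "a = lattice m n" "b = of_int m' + of_int n' * \<tau>"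
    unfolding period_def by blast
  then have "a - b = of_int (m - m') + of_int (n - n') * \<tau>" by (simp add: algebra_simps)
  then show ?thesis unfolding period_def by blast
qed

lemma period_of_int_mult: "period a \<Longrightarrow> period (of_int k * a)"
proof -
  assume "period a"
  then obtain m n :: int where "a = lattice m n"
    unfolding period_def by blast
  then have "of_int k * a = of_int (k * m) + of_int (k * n) * \<tau>" by (simp add: algebra_simps)
  then show ?thesis unfolding period_def by blast
qed

lemma theta_eq_0_diff_swap: "th (a - b) = 0 \<longleftrightarrow> th (b - a) = 0"
  using theta_minus[of "a - b"] by auto

text \<open>In a field the product of \<open>f\<close> with finitely many nonzero theta classes is
  nonzero, and a nonzero class has a representative with a nonzero value; there all factors are
  nonzero at once.\<close>

lemma generic_point:
  fixes I :: "((complex^'n::finite) \<times> (complex^'n) \<times> complex) set"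
  assumes I: "finite I" "\<forall>(a, b, c)\<in>I. a \<noteq> 0 \<or> b \<noteq> 0"
    and f: "is_mero (f :: 'n pt \<Rightarrow> complex)" "abs_mero f \<noteq> 0"
  shows "\<exists>p. f p \<noteq> 0 \<and>
    (\<forall>(a, b, c)\<in>I. th (pairing a (fst p) + pairing b (snd p) + c) \<noteq> 0)"
proof -
  define F :: "_ \<Rightarrow> 'n pt \<Rightarrow> complex" where "F = (\<lambda>i p. th (pairing (fst i) (fst p) + pairing (fst (snd i)) (snd p) + snd (snd i)))"
  have F: "is_mero (F i)" for i :: "(complex^'n) \<times> (complex^'n) \<times> complex"
    unfolding F_def by (intro is_mero_theta) (auto simp: affine_form_def)
  have nz: "abs_mero (F i) \<noteq> 0" if "i \<in> I" for i
    using theta_at_nonzero[of "fst i" "fst (snd i)" "snd (snd i)"] I(2) that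
    by (auto simp: F_def theta_at_def)
  have "abs_mero (\<lambda>p. f p * (\<Prod>i\<in>I. F i p)) = abs_mero f * (\<Prod>i\<in>I. abs_mero (F i))"
    by (simp add: abs_mero_mult abs_mero_prod is_mero_prod F f)
  also have "\<dots> \<noteq> 0" using f nz I by simp
  finally obtain p where "f p * (\<Prod>i\<in>I. F i p) \<noteq> 0" using abs_mero_nonzeroD by blast
  then have "f p \<noteq> 0" "\<And>i. i \<in> I \<Longrightarrow> F i p \<noteq> 0" using I(1) by auto
  then show ?thesis unfolding F_def by (intro exI[of _ p]) auto
qed

end

lemma prod_unit_exp: "(\<Prod>i\<in>I. unit_exp (f i)) = unit_exp (\<Sum>i\<in>I. f i)"
  by (induction I rule: infinite_finite_induct) (simp_all add: unit_exp_add)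

context elliptic_root_datum
begin

lemma theta_ratio_shift:
  "th (x + lattice m n) / th (h - (x + lattice m n)) =
    unit_exp (- of_int n * h) * (th x / th (h - x))"
proof -
  have "unit_exp (- of_int n * h) * theta_factor (- m) (- n) (h - x) =
      unit_exp (of_int (- (m + n))) * theta_factor m n x"
    unfolding theta_factor_def unit_exp_add[symmetric]
    by (rule arg_cong[where f = unit_exp]) (simp add: field_simps)
  then have 1: "theta_factor m n x = unit_exp (- of_int n * h) * theta_factor (- m) (- n) (h - x)"
    by (simp only: unit_exp_of_int mult_1)
  have 2: "th (h - (x + lattice m n)) = theta_factor (- m) (- n) (h - x) * th (h - x)"
    using theta_add_period[of "h - x" "- m" "- n"] by (simp add: algebra_simps)
  show ?thesis unfolding theta_add_period 2 unfolding 1 by simp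
qed

text \<open>\<open>base\<close> makes the point t = 0 regular, \<open>cross\<close> keeps zeros of
  theta at z_\<beta> or h - z_\<beta> for different positive roots at different t, and
  \<open>mult\<close> says that the multiplier for \<tau> does not belong to an exponential.\<close>

lemma phi_eq_0_on_generic_line:
  assumes ws: "set ws \<subseteq> B" and l: "generic l" and h: "th h \<noteq> 0"
    and base: "\<And>\<beta>. \<beta> \<in> P \<Longrightarrow> th (zv \<beta> z) \<noteq> 0" "\<And>\<beta>. \<beta> \<in> P \<Longrightarrow> th (h - zv \<beta> z) \<noteq> 0"
    and cross: "\<And>\<beta> \<gamma> e e'. \<beta> \<in> P \<Longrightarrow> \<gamma> \<in> P \<Longrightarrow> \<beta> \<noteq> \<gamma> \<Longrightarrow> pairing \<beta> \<nu> \<noteq> 0 \<Longrightarrow> pairing \<gamma> \<nu> \<noteq> 0 \<Longrightarrow>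
      e \<in> {0, h} \<Longrightarrow> e' \<in> {0, h} \<Longrightarrow>
      th (of_int (pairing \<gamma> \<nu>) * (zv \<beta> z - e) - of_int (pairing \<beta> \<nu>) * (zv \<gamma> z - e')) \<noteq> 0"
    and mult: "th (pairing (l - cmat w0 *v (cmat (wprod (rev ws)) *v l)) (cvec \<nu>)) \<noteq> 0"
  shows "phi ws (mat 1) z l = 0"
proof -
  define Z where "Z = line z \<nu>"
  have Zv: "zv \<mu> (Z t) = zv \<mu> z + of_int (pairing \<mu> \<nu>) * t" for \<mu> t
    unfolding Z_def by (rule zv_line)
  have base': "th (zv \<beta> z - e) \<noteq> 0" if "\<beta> \<in> P" "e \<in> {0, h}" for \<beta> e
    using base[OF that(1)] that(2) theta_eq_0_diff_swap[of h "zv \<beta> z"] by auto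
  have moving: "pairing \<beta> \<nu> \<noteq> 0" if "\<beta> \<in> P" "e \<in> {0, h}" "th (zv \<beta> (Z t) - e) = 0" for \<beta> e t
    using base'[OF that(1,2)] that(3) by (auto simp: Zv)
  \<comment> \<open>Two simultaneous zeros are two congruences for t modulo periods; eliminating t
    leaves a congruence for the base point that \<open>cross\<close> forbids.\<close>
  have sep: "th (zv \<gamma> (Z t) - e') \<noteq> 0"
    if \<beta>\<gamma>: "\<beta> \<in> P" "\<gamma> \<in> P" "\<beta> \<noteq> \<gamma>" "e \<in> {0, h}" "e' \<in> {0, h}" and zero: "th (zv \<beta> (Z t) - e) = 0" for \<beta> \<gamma> e e' t
  proof
    assume zero': "th (zv \<gamma> (Z t) - e') = 0"
    have "period (of_int (pairing \<gamma> \<nu>) * (zv \<beta> (Z t) - e) - of_int (pairing \<beta> \<nu>) * (zv \<gamma> (Z t) - e'))"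
      by (rule period_diff[OF period_of_int_mult period_of_int_mult]) (use zero zero' theta_eq_0_iff in blast)+
    also have "of_int (pairing \<gamma> \<nu>) * (zv \<beta> (Z t) - e) - of_int (pairing \<beta> \<nu>) * (zv \<gamma> (Z t) - e') =
        of_int (pairing \<gamma> \<nu>) * (zv \<beta> z - e) - of_int (pairing \<beta> \<nu>) * (zv \<gamma> z - e')"
      unfolding Zv by (simp add: algebra_simps)
    finally show False
      using cross[OF \<beta>\<gamma>(1-3) moving[OF \<beta>\<gamma>(1,4) zero] moving[OF \<beta>\<gamma>(2,5) zero'] \<beta>\<gamma>(4,5)]
      unfolding theta_eq_0_iff by blast
  qed
  define q where "q = (\<lambda>\<beta> t. th (zv \<beta> (Z t)) / th (h - zv \<beta> (Z t)))"
  define f where "f = (\<lambda>t. phi ws (mat 1) (Z t) l)"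
  define k where "k = (\<lambda>t. f t * (\<Prod>\<beta>\<in>P. q \<beta> t))"
  have an: "(\<lambda>u. th (zv \<beta> (Z u))) analytic_on {t}" "(\<lambda>u. th (h - zv \<beta> (Z u))) analytic_on {t}" for \<beta> t
    unfolding Z_def by (auto intro!: analytic_intros)
  have q: "q \<beta> analytic_on {t}" if "th (h - zv \<beta> (Z t)) \<noteq> 0" for \<beta> t
    unfolding q_def using that an by (auto intro!: analytic_on_divide)
  have hz: "th (h - zv \<beta> (Z t)) = 0 \<longleftrightarrow> th (zv \<beta> (Z t) - h) = 0" for \<beta> t
    by (rule theta_eq_0_diff_swap)
  have deriv: "deriv (\<lambda>u. th (h - zv \<beta> (Z u))) t \<noteq> 0"
    if "\<beta> \<in> P" "th (h - zv \<beta> (Z t)) = 0" for \<beta> t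
  proof -
    have "((\<lambda>u. th (h - zv \<beta> (Z u))) has_field_derivative
        deriv th (h - zv \<beta> (Z t)) * - of_int (pairing \<beta> \<nu>)) (at t)"
      by (rule DERIV_chain2[OF theta_has_deriv]) (auto simp: Zv intro!: derivative_eq_intros)
    then show ?thesis
      using DERIV_imp_deriv theta_deriv_at_zero[OF that(2)] moving[of \<beta> h t] that hz by force
  qed
  have f_an: "f analytic_on {t}" if "\<And>\<gamma>. \<gamma> \<in> P \<Longrightarrow> th (zv \<gamma> (Z t)) \<noteq> 0" for t
    unfolding f_def Z_def
  proof (rule phi_analytic[OF ws one_in_W l])
    fix \<gamma> assume "\<gamma> \<in> R"
    then show "th (zv \<gamma> (line z \<nu> t)) \<noteq> 0"
      using that[of \<gamma>] that[of "- \<gamma>"] pos_or_neg[of \<gamma>] theta_minus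
      by (auto simp: Z_def cvec_minus pairing_minus_left)
  qed
  have split: "(\<Prod>\<beta>\<in>P. q \<beta> u) = q \<beta> u * (\<Prod>\<gamma>\<in>P - {\<beta>}. q \<gamma> u)" if "\<beta> \<in> P" for \<beta> u
    by (rule prod.remove[OF finite_P that])
  have ext: "\<exists>c. extends_to k t c" for t
  proof -
    consider \<beta> where "\<beta> \<in> P" "th (zv \<beta> (Z t)) = 0"
      | \<beta> where "\<And>\<gamma>. \<gamma> \<in> P \<Longrightarrow> th (zv \<gamma> (Z t)) \<noteq> 0" "\<beta> \<in> P" "th (h - zv \<beta> (Z t)) = 0"
      | "\<And>\<gamma>. \<gamma> \<in> P \<Longrightarrow> th (zv \<gamma> (Z t)) \<noteq> 0" "\<And>\<gamma>. \<gamma> \<in> P \<Longrightarrow> th (h - zv \<gamma> (Z t)) \<noteq> 0"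
      by blast
    then show ?thesis
    proof cases
      case (1 \<beta>)
      have "period (zv \<beta> (Z t))" using 1(2) theta_eq_0_iff by blast
      then obtain m n where mn: "zv \<beta> (line z \<nu> t) = lattice m n"
        by (auto simp: period_def Z_def)
      have others: "th (zv \<gamma> (line z \<nu> t)) \<noteq> 0" if \<gamma>: "\<gamma> \<in> R" "\<gamma> \<noteq> \<beta>" "\<gamma> \<noteq> - \<beta>" for \<gamma>
      proof (cases "\<gamma> \<in> P")
        case True
        then show ?thesis using sep[of \<beta> \<gamma> 0 0 t] 1 \<gamma> by (simp add: Z_def)
      next
        case False
        then have "- \<gamma> \<in> P" "\<beta> \<noteq> - \<gamma>" using pos_or_neg \<gamma> by auto
        then have "th (zv (- \<gamma>) (Z t)) \<noteq> 0" using sep[of \<beta> "- \<gamma>" 0 0 t] 1 by simp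
        then show ?thesis by (simp add: Z_def cvec_minus pairing_minus_left theta_minus)
      qed
      obtain c where c: "extends_to (\<lambda>u. th (zv \<beta> (Z u)) * f u) t c"
        using phi_simple_pole[OF ws l P_root[OF 1(1)] moving[of \<beta> 0 t] mn others] 1 one_in_W
        unfolding Z_def f_def by auto
      \<comment> \<open>For \<gamma> = \<beta> both zeros at once would make h a period; other roots
        are handled by separation.\<close>
      have nz: "th (h - zv \<gamma> (Z t)) \<noteq> 0" if "\<gamma> \<in> P" for \<gamma>
      proof (cases "\<gamma> = \<beta>")
        case True
        show ?thesis
        proof
          assume "th (h - zv \<gamma> (Z t)) = 0"
          then have "period (zv \<beta> (Z t) - (zv \<beta> (Z t) - h))"
            using 1(2) True hz theta_eq_0_iff by (intro period_diff[of "zv \<beta> (Z t)" "zv \<beta> (Z t) - h"]) auto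
          then show False using h theta_eq_0_iff by simp
        qed
      next
        case False
        then show ?thesis using sep[of \<beta> \<gamma> 0 h t] 1 that hz by simp
      qed
      have "(\<lambda>u. 1 / th (h - zv \<beta> (Z u)) * (\<Prod>\<gamma>\<in>P - {\<beta>}. q \<gamma> u)) analytic_on {t}"
        by (intro analytic_on_mult analytic_on_divide analytic_on_const analytic_on_prod an q)
          (use nz 1(1) in auto)
      from extends_to_mult[OF c extends_to_analytic[OF this]]
      obtain c' where "extends_to (\<lambda>u. th (zv \<beta> (Z u)) * f u *
          (1 / th (h - zv \<beta> (Z u)) * (\<Prod>\<gamma>\<in>P - {\<beta>}. q \<gamma> u))) t c'" by blast
      moreover have "(\<lambda>u. th (zv \<beta> (Z u)) * f u *
          (1 / th (h - zv \<beta> (Z u)) * (\<Prod>\<gamma>\<in>P - {\<beta>}. q \<gamma> u))) = k"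
        unfolding k_def split[OF 1(1)] by (simp add: q_def mult_ac)
      ultimately show ?thesis by auto
    next
      case (2 \<beta>)
      have nz: "th (h - zv \<gamma> (Z t)) \<noteq> 0" if "\<gamma> \<in> P" "\<gamma> \<noteq> \<beta>" for \<gamma>
        using sep[of \<beta> \<gamma> h h t] 2 that hz by simp
      \<comment> \<open>At the identity the sign condition on the inverse image of \<beta> is just
        that \<beta> is positive. Since \<open>f\<close> is analytic at t here, the value 0 is a
        genuine zero and not a junk value.\<close>
      have "matrix_inv (mat 1 :: 'n wmat) = mat 1" by (rule matrix_inv_eqI) simp_all
      then have "f t = 0"
        unfolding f_def using phi_eq_0_at_theta_zero[OF ws one_in_W 2(2) _ 2(3)] 2(2) by simp
      moreover have "(\<lambda>u. f u * (th (zv \<beta> (Z u)) * (\<Prod>\<gamma>\<in>P - {\<beta>}. q \<gamma> u))) analytic_on {t}"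
        by (intro analytic_on_mult analytic_on_prod an q f_an) (use nz 2(1) in auto)
      ultimately have "extends_to (\<lambda>u. f u * (th (zv \<beta> (Z u)) * (\<Prod>\<gamma>\<in>P - {\<beta>}. q \<gamma> u))) t 0"
        using extends_to_analytic by force
      from extends_to_divide_simple_zero[OF this an(2) 2(3) deriv[OF 2(2,3)]]
      show ?thesis unfolding k_def split[OF 2(2)] by (simp add: q_def mult_ac)
    next
      case 3
      then have "k analytic_on {t}"
        unfolding k_def by (intro analytic_on_mult analytic_on_prod q f_an)
      then show ?thesis using extends_to_analytic by blast
    qed
  qed
  define c where "c = - pairing (l - cmat w0 *v (cmat (wprod (rev ws)) *v l)) (cvec \<nu>)"
  have Zshift: "Z (lattice m n + t) = Z t + lattice m n *s cvec \<nu>" for m n t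
    by (simp add: Z_def line_def vec_eq_iff algebra_simps)
  have shift: "k (lattice m n + t) = unit_exp (of_int n * c) * k t" for m n t
  proof -
    have q: "q \<beta> (lattice m n + t) = unit_exp (- of_int n * h * of_int (pairing \<beta> \<nu>)) * q \<beta> t" for \<beta>
    proof -
      have "zv \<beta> (Z (lattice m n + t)) =
          zv \<beta> (Z t) + (of_int (pairing \<beta> \<nu> * m) + of_int (pairing \<beta> \<nu> * n) * \<tau>)"
        unfolding Zv by (simp add: algebra_simps)
      then show ?thesis unfolding q_def by (simp only: theta_ratio_shift) (simp add: mult_ac)
    qed
    have "(\<Sum>\<beta>\<in>P. - of_int n * h * of_int (pairing \<beta> \<nu>)) = - of_int n * h * of_int (pairing two_rho \<nu>)"
      unfolding two_rho_def using pairing_sum_left[of "\<lambda>x. x" P \<nu>] by (simp add: sum_distrib_left)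
    then have prod: "(\<Prod>\<beta>\<in>P. q \<beta> (lattice m n + t)) =
        unit_exp (- of_int n * h * of_int (pairing two_rho \<nu>)) * (\<Prod>\<beta>\<in>P. q \<beta> t)"
      unfolding q prod.distrib prod_unit_exp by simp
    have rho: "pairing rhoc (cvec \<nu>) = of_int (pairing two_rho \<nu>) / 2"
      by (simp add: rhoc_def pairing_scale_left pairing_cvec)
    \<comment> \<open>w_0 \<rho> = -\<rho> makes the h-parts of the two weights add up to h times
      the pairing of 2 \<rho> with \<nu>, which the shift of the theta ratios cancels.\<close>
    have exponent: "(weight (mat 1) l \<nu> - weight w0 (cmat (wprod (rev ws)) *v l) \<nu>)
        - h * of_int (pairing two_rho \<nu>) = c"
      by (simp add: weight_def c_def cmat_one matrix_vector_mult_diff_distrib matrix_vector_scale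
          longest_rhoc pairing_diff_left pairing_scale_left pairing_minus_left rho)
    have "k (lattice m n + t) =
        unit_exp (of_int n * (weight (mat 1) l \<nu> - weight w0 (cmat (wprod (rev ws)) *v l) \<nu>)) *
        unit_exp (- of_int n * h * of_int (pairing two_rho \<nu>)) * k t"
      unfolding k_def f_def Zshift phi_shift[OF ws] prod by (simp only: mult_ac)
    then show ?thesis
      unfolding unit_exp_add[symmetric] exponent[symmetric] by (simp add: algebra_simps)
  qed
  obtain K where K: "K holomorphic_on UNIV" "\<And>t. extends_to k t (K t)"
    using extends_to_everywhere_entire[OF ext] by blast
  have Kshift: "K (lattice m n + t) = unit_exp (of_int n * c) * K t" for m n t
  proof -
    have "extends_to (\<lambda>u. k (lattice m n + 1 * u)) t (K (lattice m n + t))"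
      by (rule extends_to_compose_affine[OF K(2)]) simp_all
    then have "extends_to (\<lambda>u. unit_exp (of_int n * c) * k u) t (K (lattice m n + t))"
      unfolding mult_1 shift .
    moreover have "extends_to (\<lambda>u. unit_exp (of_int n * c) * k u) t (unit_exp (of_int n * c) * K t)"
      by (rule extends_to_cmult[OF K(2)])
    ultimately show ?thesis by (rule extends_to_unique)
  qed
  have "th c \<noteq> 0" using mult unfolding c_def theta_minus by simp
  then have "\<not> period c" using theta_eq_0_iff by blast
  have "K 0 = 0"
  proof (rule entire_quasi_periodic_eq_0[OF K(1) _ _ \<open>\<not> period c\<close>])
    show "K (t + 1) = K t" for t using Kshift[of 1 0 t] by (simp add: add.commute)
    show "K (t + \<tau>) = unit_exp c * K t" for t using Kshift[of 0 1 t] by (simp add: add.commute)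
  qed
  have Z0: "Z 0 = z" by (simp add: Z_def line_def)
  \<comment> \<open>The base point is regular, so the entire extension takes the actual value of
    \<open>k\<close> there and the conclusion concerns \<open>phi\<close> itself.\<close>
  have "k analytic_on {0}"
    unfolding k_def by (intro analytic_on_mult analytic_on_prod q f_an) (simp_all add: Z0 base)
  then have "k 0 = K 0" using extends_to_analytic K(2) extends_to_unique by blast
  then have "k 0 = 0" using \<open>K 0 = 0\<close> by simp
  then show ?thesis using base finite_P by (auto simp: k_def f_def q_def Z0)
qed

text \<open>If the class were nonzero, some point with nonzero value would avoid finitely many theta
  divisors, and vanishing on the line through it would give a contradiction.\<close>

lemma abs_mero_phi_eq_0:
  assumes ws: "set ws \<subseteq> B" and ne: "wprod ws \<noteq> w0"
  shows "abs_mero (\<lambda>p. phi ws (mat 1) (fst p) (snd p)) = (0 :: 'n mero)"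
proof (cases "th h = 0")
  case True
  then have "phi ws (mat 1) z l = 0" for z l
    using phi_eq_0_of_theta_h[of "mat 1" ws] ne by simp
  then show ?thesis by (simp add: abs_mero_0)
next
  case h: False
  define M where "M = w0 ** wprod (rev ws)"
  have "M \<noteq> mat 1"
  proof
    assume "M = mat 1"
    then have "w0 ** matrix_inv (wprod ws) ** wprod ws = wprod ws"
      by (simp add: M_def wprod_rev ws)
    then show False using ne W_inv(3)[OF wprod_in_W[OF ws]] by (simp flip: matrix_mul_assoc)
  qed
  \<comment> \<open>The direction \<nu> is chosen from a row in which M differs from the identity;
    then \<eta> = \<nu> - M^T \<nu> is nonzero and the exponent of the multiplier is a nonconstant
    linear form in \<lambda>.\<close>
  then obtain i j where ij: "M $ i $ j \<noteq> (mat 1 :: 'n wmat) $ i $ j" by (auto simp: vec_eq_iff)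
  define \<nu> :: "int^'n" where "\<nu> = axis i 1"
  define \<eta> where "\<eta> = \<nu> - transpose M *v \<nu>"
  have "\<eta> $ j = (mat 1 :: 'n wmat) $ i $ j - M $ i $ j"
    unfolding \<eta>_def \<nu>_def
    by (simp add: matrix_vector_mult_def transpose_def axis_def mat_def if_distrib[of "\<lambda>x. _ * x"] cong: if_cong)
  then have \<eta>: "cvec \<eta> \<noteq> 0" using ij unfolding cvec_eq_0_iff by auto
  define N where "N = (\<lambda>\<beta>. pairing \<beta> \<nu>)"
  \<comment> \<open>Index set of the collisions to avoid: pairs of positive roots that both vary
    along \<nu>, each with a choice of level 0 or h.\<close>
  define S where "S = {(\<beta>, \<gamma>). \<beta> \<in> P \<and> \<gamma> \<in> P \<and> \<beta> \<noteq> \<gamma> \<and> N \<beta> \<noteq> 0 \<and> N \<gamma> \<noteq> 0} \<times> ({0, h} \<times> {0, h})"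
  define I1 where "I1 = (\<lambda>\<gamma>. (0 :: complex^'n, cvec (cv \<gamma>), h)) ` R"
  define I2 where "I2 = (\<lambda>\<beta>. (cvec \<beta>, 0 :: complex^'n, 0 :: complex)) ` P"
  define I3 where "I3 = (\<lambda>\<beta>. (cvec (- \<beta>), 0 :: complex^'n, h)) ` P"
  define I4 where "I4 = (\<lambda>((\<beta>, \<gamma>), (e, e')). (cvec (N \<gamma> *s \<beta> - N \<beta> *s \<gamma>), 0 :: complex^'n,
      of_int (N \<beta>) * e' - of_int (N \<gamma>) * e)) ` S"
  define I where "I = I1 \<union> I2 \<union> I3 \<union> I4 \<union> {(0, cvec \<eta>, 0)}"
  have "finite S"
    unfolding S_def by (intro finite_cartesian_product finite_subset[OF _ finite_cartesian_product[OF finite_P finite_P]]) auto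
  then have fin: "finite I"
    unfolding I_def I1_def I2_def I3_def I4_def using finite_R finite_P by simp
  \<comment> \<open>Distinct positive roots are not proportional, so eliminating t leaves a linear
    form that really depends on z and its theta divisor can be avoided.\<close>
  have indep: "N \<gamma> *s \<beta> - N \<beta> *s \<gamma> \<noteq> 0"
    if "\<beta> \<in> P" "\<gamma> \<in> P" "\<beta> \<noteq> \<gamma>" "N \<beta> \<noteq> 0" "N \<gamma> \<noteq> 0" for \<beta> \<gamma>
    using proportional_roots[of \<beta> \<gamma> "N \<gamma>" "N \<beta>"] that P_root not_pos_and_neg by auto
  have nz: "\<forall>(a, b, c)\<in>I. a \<noteq> 0 \<or> b \<noteq> 0"
    using \<eta> coroot_nonzero root_nonzero P_root indep
    by (auto simp: I_def I1_def I2_def I3_def I4_def S_def cvec_eq_0_iff)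
  show ?thesis
  proof (rule ccontr)
    assume nonzero: "abs_mero (\<lambda>p. phi ws (mat 1) (fst p) (snd p)) \<noteq> (0 :: 'n mero)"
    have "is_mero (\<lambda>p. phi ws (mat 1) (fst p) (snd p))"
      using word_act_phi[OF ws one_in_W] by blast
    then obtain p where p: "phi ws (mat 1) (fst p) (snd p) \<noteq> 0"
      and gen: "\<And>a b c. (a, b, c) \<in> I \<Longrightarrow> th (pairing a (fst p) + pairing b (snd p) + c) \<noteq> 0"
      using generic_point[OF fin nz _ nonzero] by blast
    have "phi ws (mat 1) (fst p) (snd p) = 0"
    proof (rule phi_eq_0_on_generic_line[OF ws _ h])
      show "generic (snd p)"
        unfolding generic_def
      proof
        fix \<gamma> assume "\<gamma> \<in> R"
        then show "th (h + lv (snd p) \<gamma>) \<noteq> 0"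
          using gen[of 0 "cvec (cv \<gamma>)" h]
          by (simp add: I_def I1_def pairing_commute[of "snd p"] add.commute)
      qed
      show "th (zv \<beta> (fst p)) \<noteq> 0" if "\<beta> \<in> P" for \<beta>
        using gen[of "cvec \<beta>" 0 0] that by (simp add: I_def I2_def)
      show "th (h - zv \<beta> (fst p)) \<noteq> 0" if "\<beta> \<in> P" for \<beta>
        using gen[of "cvec (- \<beta>)" 0 h] that by (simp add: I_def I3_def cvec_minus pairing_minus_left)
      show "th (of_int (pairing \<gamma> \<nu>) * (zv \<beta> (fst p) - e) - of_int (pairing \<beta> \<nu>) * (zv \<gamma> (fst p) - e')) \<noteq> 0"
        if "\<beta> \<in> P" "\<gamma> \<in> P" "\<beta> \<noteq> \<gamma>" "pairing \<beta> \<nu> \<noteq> 0" "pairing \<gamma> \<nu> \<noteq> 0" "e \<in> {0, h}" "e' \<in> {0, h}"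
        for \<beta> \<gamma> e e'
      proof -
        have "((\<beta>, \<gamma>), (e, e')) \<in> S" using that by (auto simp: S_def N_def)
        then have "(cvec (N \<gamma> *s \<beta> - N \<beta> *s \<gamma>), 0, of_int (N \<beta>) * e' - of_int (N \<gamma>) * e) \<in> I"
          unfolding I_def I4_def by force
        from gen[OF this] show ?thesis
          by (simp add: N_def cvec_diff cvec_scale pairing_diff_left pairing_scale_left algebra_simps)
      qed
      have "cmat w0 *v (cmat (wprod (rev ws)) *v snd p) = cmat M *v snd p"
        by (simp add: M_def cmat_mult matrix_vector_mul_assoc)
      then have "pairing (snd p - cmat w0 *v (cmat (wprod (rev ws)) *v snd p)) (cvec \<nu>) =
          pairing (cvec \<eta>) (snd p)"
        by (simp add: \<eta>_def pairing_diff_left pairing_matrix cmat_cvec cvec_diff pairing_commute[of "cvec _"]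
            pairing_diff_right flip: cmat_transpose)
      then show "th (pairing (snd p - cmat w0 *v (cmat (wprod (rev ws)) *v snd p)) (cvec \<nu>)) \<noteq> 0"
        using gen[of 0 "cvec \<eta>" 0] by (simp add: I_def)
    qed
    then show False using p by simp
  qed
qed

section \<open>The diagonal value\<close>

lemma inversions_mult_longest:
  assumes "y \<in> W"
  shows "inversions (y ** w0) = P - inversions y"
proof -
  define v where "v = matrix_inv w0"
  \<comment> \<open>The inverse of w_0 exchanges positive and negative roots, which turns inversions
    into non-inversions.\<close>
  have v: "v *v \<gamma> \<notin> P \<longleftrightarrow> \<gamma> \<in> P" if "\<gamma> \<in> R" for \<gamma>
  proof
    assume "\<gamma> \<in> P"
    then show "v *v \<gamma> \<notin> P" using inversions_longest unfolding v_def inversions_def by blast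
  next
    assume "v *v \<gamma> \<notin> P"
    show "\<gamma> \<in> P"
    proof (rule ccontr)
      assume "\<gamma> \<notin> P"
      then have "- \<gamma> \<in> P" using neg_iff that by blast
      then have "v *v (- \<gamma>) \<notin> P" using inversions_longest unfolding v_def inversions_def by blast
      moreover have "v *v \<gamma> \<in> R" unfolding v_def using that W_root W_inv longest_in_W by blast
      ultimately show False using \<open>v *v \<gamma> \<notin> P\<close> pos_or_neg by (auto simp: matrix_vector_minus)
    qed
  qed
  have "matrix_inv (y ** w0) *v \<beta> = v *v (matrix_inv y *v \<beta>)" for \<beta>
    using assms longest_in_W by (simp add: W_inv_mult v_def matrix_vector_mul_assoc)
  moreover have "matrix_inv y *v \<beta> \<in> R" if "\<beta> \<in> P" for \<beta>
    using that assms W_root W_inv P_root by blast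
  ultimately show ?thesis using v by (auto simp: inversions_def)
qed

text \<open>Since -w_0 permutes the positive roots, applying w_0 amounts to replacing \<lambda> by
  -\<lambda> in the product; the signs are those of \<open>a_minus\<close>, and its z-parts cancel
  against g.\<close>

lemma dyn_act_longest_theta_Pi:
  "dyn_act w0 (theta_Pi D \<tau> / theta_Pi_shift D \<tau> h) = g_inv * (\<Prod>\<beta>\<in>P. a_minus \<beta>)"
proof -
  have "dyn_act w0 (theta_Pi D \<tau> / theta_Pi_shift D \<tau> h) =
      (\<Prod>\<beta>\<in>P. theta_at \<tau> (l_lin (cv (w0 *v \<beta>))) / theta_at \<tau> (\<lambda>p. h - l_lin (cv (w0 *v \<beta>)) p))"
    unfolding theta_Pi_def theta_Pi_shift_def
    by (simp add: dyn_act_W_divide dyn_act_W_prod longest_in_W dyn_act_theta_at l_lin_block P_root prod_dividef)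
  also have "\<dots> = (\<Prod>\<beta>\<in>P. - theta_at \<tau> (l_lin (cv (- (w0 *v \<beta>)))) /
      theta_at \<tau> (\<lambda>p. h + l_lin (cv (- (w0 *v \<beta>))) p))"
    by (rule prod.cong) (simp_all add: l_lin_uminus W_root longest_in_W P_root theta_at_uminus[symmetric])
  also have "\<dots> = (\<Prod>\<beta>\<in>P. - theta_at \<tau> (l_lin (cv \<beta>)) / theta_at \<tau> (\<lambda>p. h + l_lin (cv \<beta>) p))"
    by (rule prod.reindex_bij_betw[OF longest_bij])
  also have "\<dots> = (\<Prod>\<beta>\<in>P. theta_at \<tau> (z_lin \<beta>) / theta_at \<tau> (\<lambda>p. h - z_lin \<beta> p) * a_minus \<beta>)"
  proof (rule prod.cong)
    fix \<beta> assume "\<beta> \<in> P"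
    then have "\<beta> \<noteq> 0" using P_root root_nonzero by blast
    then have "theta_at \<tau> (z_lin \<beta>) \<noteq> (0 :: 'n mero)" "theta_at \<tau> (\<lambda>p. h - z_lin \<beta> p) \<noteq> (0 :: 'n mero)"
      by (simp_all add: theta_at_z_nonzero theta_at_hz_nonzero)
    then show "- theta_at \<tau> (l_lin (cv \<beta>)) / theta_at \<tau> (\<lambda>p. h + l_lin (cv \<beta>) p) =
        theta_at \<tau> (z_lin \<beta>) / theta_at \<tau> (\<lambda>p. h - z_lin \<beta> p) * a_minus \<beta>"
      by (simp add: a_minus_def)
  qed simp
  finally show ?thesis unfolding g_inv_eq prod.distrib .
qed

lemma abs_mero_phi_longest:
  assumes "set ws \<subseteq> B" "wprod ws = w0" "length ws = card P"
  shows "abs_mero (\<lambda>p. phi ws (mat 1) (fst p) (snd p)) = (\<Prod>\<beta>\<in>P. a_minus \<beta>)"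
proof -
  have "phi ws (mat 1) (fst p) (snd p) = (\<Prod>\<beta>\<in>P. am (z_lin \<beta> p) (l_lin (cv \<beta>) p))" for p :: "'n pt"
    using phi_reduced_word[OF assms(1) one_in_W] assms(2,3)
    by (simp add: cmat_one z_lin_def l_lin_def)
  then show ?thesis
    unfolding a_minus_abs by (simp add: abs_mero_prod is_mero_am)
qed

lemma pairing_schubert_classes:
  assumes w: "w \<in> W" and v: "v \<in> W"
  shows "(\<Sum>u\<in>W. dyn_act u (pair (schubert_class D \<tau> h w) (opp_schubert_class D \<tau> h v))) =
    (if w = v then 1 else 0) * (\<Sum>u\<in>W. dyn_act u (theta_Pi D \<tau> / theta_Pi_shift D \<tau> h))"
proof -
  have f0: "fbasis y x = 0" if "y \<in> W" "x \<notin> W" for x y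
    using that by (auto simp: fbasis_def)
  define y where "y = matrix_inv v ** w0"
  have yW: "y \<in> W" using v longest_in_W by (simp add: y_def W_mult W_inv)
  obtain us where us: "set us \<subseteq> B" "wprod us = matrix_inv w" "length us = card (inversions (matrix_inv w))"
    "schubert_class D \<tau> h w = word_act Tplus us (fbasis (mat 1))"
    unfolding schubert_class_def
    using bullet_along_word[OF W_inv(1)[OF w], of Tplus] supported_T f0[OF one_in_W] by metis
  obtain vs where vs: "set vs \<subseteq> B" "wprod vs = y" "length vs = card (inversions y)"
    "opp_schubert_class D \<tau> h v = word_act Tminus vs (fbasis w0)"
    unfolding opp_schubert_class_def y_def[symmetric]
    using bullet_along_word[OF yW, of Tminus] supported_T f0[OF longest_in_W] by metis
  \<comment> \<open>Reversing \<open>us\<close> inverts its product, so this is a word for w v^(-1)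
    w_0, reduced or not.\<close>
  define ws where "ws = rev us @ vs"
  have ws: "set ws \<subseteq> B" "wprod ws = w ** y"
    using us vs w by (simp_all add: ws_def wprod_append wprod_rev W_inv_inv)
  have pair_e: "pair (fbasis (mat 1)) f = g_inv * f (mat 1)" for f
  proof -
    have "pair (fbasis (mat 1)) f = (\<Sum>u\<in>W. if u = mat 1 then g_inv * f (mat 1) else 0)"
      unfolding pair_def by (rule sum.cong) (simp_all add: fbasis_def)
    then show ?thesis using finite_W one_in_W by simp
  qed
  have "(\<Sum>u\<in>W. dyn_act u (pair (schubert_class D \<tau> h w) (opp_schubert_class D \<tau> h v))) =
      (\<Sum>u\<in>W. dyn_act u (g_inv * abs_mero (\<lambda>p. phi ws (mat 1) (fst p) (snd p))))"
    unfolding us(4) vs(4) sum_dyn_act_pair_word[OF us(1)] word_act_append[symmetric] pair_e ws_def[symmetric]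
    using word_act_phi[OF ws(1) one_in_W] by simp
  also have "\<dots> = (if w = v then 1 else 0) * (\<Sum>u\<in>W. dyn_act u (theta_Pi D \<tau> / theta_Pi_shift D \<tau> h))"
  proof (cases "w = v")
    case True
    have "w ** y = w0" unfolding y_def True by (simp add: matrix_mul_assoc W_inv[OF v])
    moreover have "length ws = card P"
    proof -
      have "inversions y = P - inversions (matrix_inv w)"
        unfolding y_def True by (rule inversions_mult_longest[OF W_inv(1)[OF v]])
      moreover have "inversions (matrix_inv w) \<subseteq> P" by (auto simp: inversions_def)
      ultimately show ?thesis
        using card_mono[OF finite_P, of "inversions (matrix_inv w)"]
        by (simp add: ws_def us vs card_Diff_subset finite_inversions)
    qed
    ultimately have "abs_mero (\<lambda>p. phi ws (mat 1) (fst p) (snd p)) = (\<Prod>\<beta>\<in>P. a_minus \<beta>)"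
      using abs_mero_phi_longest ws by simp
    then show ?thesis
      using True sum_dyn_act_invariant[OF longest_in_W] by (simp flip: dyn_act_longest_theta_Pi)
  next
    case False
    have "w ** y \<noteq> w0"
    proof
      assume "w ** y = w0"
      then have "(w ** matrix_inv v) ** w0 = mat 1 ** w0" by (simp add: y_def matrix_mul_assoc)
      then have "w ** matrix_inv v = mat 1" using W_cancel_right[OF longest_in_W] by blast
      then have "w ** (matrix_inv v ** v) = v" by (simp add: matrix_mul_assoc)
      then show False using False by (simp add: W_inv[OF v])
    qed
    then show ?thesis using False abs_mero_phi_eq_0[OF ws(1)] ws(2) by (simp add: dyn_act_W_0)
  qed
  finally show ?thesis .
qed

end

theorem theorem4p10:
  fixes D :: "'n::finite root_datum" and \<tau> h :: complex and w v :: "'n wmat"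
  assumes "root_datum D" and "is_base D" and "Im \<tau> > 0"
    and "w \<in> weyl D" and "v \<in> weyl D"
  shows "bullet D (Y_Pi D \<tau> h) (\<lambda>x. schubert_class D \<tau> h w x * opp_schubert_class D \<tau> h v x) =
    (\<lambda>x. dual_one D x * (if w = v then 1 else 0) *
       (\<Sum>u\<in>weyl D. dyn_act u (theta_Pi D \<tau> / theta_Pi_shift D \<tau> h)))"
proof -
  interpret elliptic_root_datum D \<tau> h
    using assms by unfold_locales
  show ?thesis
    using pairing_schubert_classes[OF assms(4,5)] by (simp add: bullet_Y_Pi fun_eq_iff mult.assoc)
qed

end
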